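(* Let $\mathsf{A}$ be a $C^*$-algebra with representations $(\pi,\mathsf{h})$ and $(\pi',\mathsf{h}')$, and let $\delta:\mathsf{A}\to B(\mathsf{h};\mathsf{h}')$ be a completely bounded $(\pi',\pi)$-derivation. Then $\delta$ is inner.
   Context: Representations are *-representations on Hilbert spaces. A $(\pi',\pi)$-derivation is a linear map $\delta:\mathsf{A}\to B(\mathsf{h};\mathsf{h}')$ satisfying $\delta(ab)=\delta(a)\pi(b)+\pi'(a)\delta(b)$ for all $a,b\in\mathsf{A}$; it is inner if there is an operator $T\in B(\mathsf{h};\mathsf{h}')$ such that $\delta(a)=\pi'(a)T-T\pi(a)$ for all $a\in\mathsf{A}$. *)

theory Defs
  imports "HOL-Analysis.Analysis" "Jordan_Normal_Form.Matrix"
begin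

(* Complex scalars are added on top of the real normed structure of the library. *)
class complex_normed_vector = real_normed_vector +
  fixes scaleC :: "complex \<Rightarrow> 'a \<Rightarrow> 'a"  (infixr "*\<^sub>C" 75)
  assumes scaleC_add_right: "c *\<^sub>C (x + y) = c *\<^sub>C x + c *\<^sub>C y"
    and scaleC_add_left: "(c + d) *\<^sub>C x = c *\<^sub>C x + d *\<^sub>C x"
    and scaleC_scaleC: "c *\<^sub>C d *\<^sub>C x = (c * d) *\<^sub>C x"
    and scaleC_of_real: "complex_of_real r *\<^sub>C x = r *\<^sub>R x"
    and norm_scaleC: "norm (c *\<^sub>C x) = cmod c * norm x"

(* The inner product is linear in the second argument. *)
class chilbert_space = complex_normed_vector + complete_space +
  fixes cinner :: "'a \<Rightarrow> 'a \<Rightarrow> complex"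
  assumes cinner_commute: "cinner x y = cnj (cinner y x)"
    and cinner_add_right: "cinner x (y + z) = cinner x y + cinner x z"
    and cinner_scaleC_right: "cinner x (c *\<^sub>C y) = c * cinner x y"
    and cinner_self: "cinner x x = complex_of_real ((norm x)\<^sup>2)"

(* C*-algebras, not assumed to be unital. *)
class cstar_algebra = complex_normed_vector + real_normed_algebra + complete_space +
  fixes star :: "'a \<Rightarrow> 'a"
  assumes scaleC_mult_left: "(c *\<^sub>C x) * y = c *\<^sub>C (x * y)"
    and scaleC_mult_right: "x * (c *\<^sub>C y) = c *\<^sub>C (x * y)"
    and star_add: "star (x + y) = star x + star y"
    and star_scaleC: "star (c *\<^sub>C x) = cnj c *\<^sub>C star x"
    and star_mult: "star (x * y) = star y * star x"
    and star_star: "star (star x) = x"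
    and cstar_identity: "norm (star x * x) = (norm x)\<^sup>2"

definition clinear :: "('a::complex_normed_vector \<Rightarrow> 'b::complex_normed_vector) \<Rightarrow> bool" where
  "clinear f \<longleftrightarrow>
     (\<forall>x y. f (x + y) = f x + f y) \<and> (\<forall>c x. f (c *\<^sub>C x) = c *\<^sub>C f x)"

lemma bounded_linear_scaleC_comp:
  fixes f :: "'a::real_normed_vector \<Rightarrow> 'b::complex_normed_vector"
  assumes "bounded_linear f"
  shows "bounded_linear (\<lambda>x. c *\<^sub>C f x)"
proof -
  interpret f: bounded_linear f by fact
  obtain K where K: "\<And>x. norm (f x) \<le> norm x * K"
    using f.bounded by blast
  show ?thesis
  proof (rule bounded_linear_intro[where K = "cmod c * K"])
    show "c *\<^sub>C f (x + y) = c *\<^sub>C f x + c *\<^sub>C f y" for x y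
      by (simp add: f.add scaleC_add_right)
    show "c *\<^sub>C f (r *\<^sub>R x) = r *\<^sub>R c *\<^sub>C f x" for r x
      by (simp add: f.scaleR scaleC_scaleC mult.commute flip: scaleC_of_real)
    show "norm (c *\<^sub>C f x) \<le> norm x * (cmod c * K)" for x
      using mult_left_mono[OF K[of x] norm_ge_zero[of c]] by (simp add: norm_scaleC algebra_simps)
  qed
qed

instantiation blinfun :: (real_normed_vector, complex_normed_vector) complex_normed_vector
begin

lift_definition scaleC_blinfun :: "complex \<Rightarrow> 'a \<Rightarrow>\<^sub>L 'b \<Rightarrow> 'a \<Rightarrow>\<^sub>L 'b"
  is "\<lambda>c f x. c *\<^sub>C f x"
  by (rule bounded_linear_scaleC_comp)

instance
proof
  fix c d :: complex and r :: real and f g :: "'a \<Rightarrow>\<^sub>L 'b"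
  show "c *\<^sub>C (f + g) = c *\<^sub>C f + c *\<^sub>C g"
    by (rule blinfun_eqI) (simp add: scaleC_blinfun.rep_eq plus_blinfun.rep_eq scaleC_add_right)
  show "(c + d) *\<^sub>C f = c *\<^sub>C f + d *\<^sub>C f"
    by (rule blinfun_eqI) (simp add: scaleC_blinfun.rep_eq plus_blinfun.rep_eq scaleC_add_left)
  show "c *\<^sub>C d *\<^sub>C f = (c * d) *\<^sub>C f"
    by (rule blinfun_eqI) (simp add: scaleC_blinfun.rep_eq scaleC_scaleC)
  show "complex_of_real r *\<^sub>C f = r *\<^sub>R f"
    by (rule blinfun_eqI) (simp add: scaleC_blinfun.rep_eq scaleR_blinfun.rep_eq scaleC_of_real)
  have le: "norm (e *\<^sub>C h) \<le> cmod e * norm h" for e and h :: "'a \<Rightarrow>\<^sub>L 'b"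
  proof (rule norm_blinfun_bound)
    show "norm (blinfun_apply (e *\<^sub>C h) x) \<le> cmod e * norm h * norm x" for x
      using mult_left_mono[OF norm_blinfun[of h x] norm_ge_zero[of e]]
      by (simp add: scaleC_blinfun.rep_eq norm_scaleC mult.assoc)
  qed simp
  show "norm (c *\<^sub>C f) = cmod c * norm f"
  proof (cases "c = 0")
    case True
    then show ?thesis using le[of 0 f] by simp
  next
    case False
    have one: "1 *\<^sub>C f = f"
      by (rule blinfun_eqI) (use scaleC_of_real[of 1] in \<open>simp add: scaleC_blinfun.rep_eq\<close>)
    have "inverse c *\<^sub>C c *\<^sub>C f = (inverse c * c) *\<^sub>C f"
      by (rule blinfun_eqI) (simp add: scaleC_blinfun.rep_eq scaleC_scaleC)
    then have "norm f \<le> cmod (inverse c) * norm (c *\<^sub>C f)"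
      using le[of "inverse c" "c *\<^sub>C f"] one False by simp
    then have "cmod c * norm f \<le> norm (c *\<^sub>C f)"
      using False by (simp add: norm_inverse norm_divide field_simps)
    with le[of c f] show ?thesis by simp
  qed
qed

end

(* B(h;h'): the blinfun type consists of the real-linear bounded operators,
   with the operator norm. *)
definition B_ops :: "('h::chilbert_space \<Rightarrow>\<^sub>L 'k::chilbert_space) set" where
  "B_ops = {T. clinear (blinfun_apply T)}"

definition is_adjoint ::
  "('h::chilbert_space \<Rightarrow>\<^sub>L 'k::chilbert_space) \<Rightarrow> ('k \<Rightarrow>\<^sub>L 'h) \<Rightarrow> bool" where
  "is_adjoint T S \<longleftrightarrow> (\<forall>x y. cinner (blinfun_apply T x) y = cinner x (blinfun_apply S y))"

(* Representations are not assumed to be nondegenerate. *)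
definition star_representation :: "('a::cstar_algebra \<Rightarrow> 'h::chilbert_space \<Rightarrow>\<^sub>L 'h) \<Rightarrow> bool" where
  "star_representation \<pi> \<longleftrightarrow>
     range \<pi> \<subseteq> B_ops \<and> clinear \<pi> \<and>
     (\<forall>a b. \<pi> (a * b) = \<pi> a o\<^sub>L \<pi> b) \<and>
     (\<forall>a. is_adjoint (\<pi> a) (\<pi> (star a)))"

definition derivation ::
  "('a::cstar_algebra \<Rightarrow> 'k::chilbert_space \<Rightarrow>\<^sub>L 'k) \<Rightarrow>
   ('a \<Rightarrow> 'h::chilbert_space \<Rightarrow>\<^sub>L 'h) \<Rightarrow> ('a \<Rightarrow> 'h \<Rightarrow>\<^sub>L 'k) \<Rightarrow> bool" where
  "derivation \<pi>' \<pi> \<delta> \<longleftrightarrow>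
     range \<delta> \<subseteq> B_ops \<and> clinear \<delta> \<and>
     (\<forall>a b. \<delta> (a * b) = (\<delta> a o\<^sub>L \<pi> b) + (\<pi>' a o\<^sub>L \<delta> b))"

definition inner_derivation ::
  "('a::cstar_algebra \<Rightarrow> 'k::chilbert_space \<Rightarrow>\<^sub>L 'k) \<Rightarrow>
   ('a \<Rightarrow> 'h::chilbert_space \<Rightarrow>\<^sub>L 'h) \<Rightarrow> ('a \<Rightarrow> 'h \<Rightarrow>\<^sub>L 'k) \<Rightarrow> bool" where
  "inner_derivation \<pi>' \<pi> \<delta> \<longleftrightarrow>
     (\<exists>T\<in>B_ops. \<forall>a. \<delta> a = (\<pi>' a o\<^sub>L T) - (T o\<^sub>L \<pi> a))"

definition mat_star :: "'a::cstar_algebra mat \<Rightarrow> 'a mat" where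
  "mat_star X = map_mat star (transpose_mat X)"

(* N makes the *-algebra of n by n matrices over the C*-algebra 'a a C*-algebra. *)
definition is_mat_cstar_norm :: "nat \<Rightarrow> ('a::cstar_algebra mat \<Rightarrow> real) \<Rightarrow> bool" where
  "is_mat_cstar_norm n N \<longleftrightarrow>
     (\<forall>X\<in>carrier_mat n n. 0 \<le> N X \<and> (N X = 0 \<longleftrightarrow> X = 0\<^sub>m n n)) \<and>
     (\<forall>X\<in>carrier_mat n n. \<forall>Y\<in>carrier_mat n n. N (X + Y) \<le> N X + N Y) \<and>
     (\<forall>X\<in>carrier_mat n n. \<forall>c. N (map_mat ((*\<^sub>C) c) X) = cmod c * N X) \<and>
     (\<forall>X\<in>carrier_mat n n. \<forall>Y\<in>carrier_mat n n. N (X * Y) \<le> N X * N Y) \<and>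
     (\<forall>X\<in>carrier_mat n n. N (mat_star X * X) = (N X)\<^sup>2) \<and>
     (\<forall>S. (\<forall>k. S k \<in> carrier_mat n n) \<and>
          (\<forall>e>0. \<exists>M. \<forall>k\<ge>M. \<forall>l\<ge>M. N (S k - S l) < e) \<longrightarrow>
          (\<exists>X\<in>carrier_mat n n. (\<lambda>k. N (S k - X)) \<longlonglongrightarrow> 0))"

(* A C*-norm on n by n matrices exists and its values on carrier_mat n n are unique.
   Hilbert choice is used instead of THE because N is arbitrary off carrier_mat n n. *)
definition mat_cstar_norm :: "nat \<Rightarrow> 'a::cstar_algebra mat \<Rightarrow> real" where
  "mat_cstar_norm n = (SOME N. is_mat_cstar_norm n N)"

(* The operator norm of an n by n matrix over B(h;h'), acting from the Hilbert space
   direct sum of n copies of h to that of n copies of h'. *)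
definition mat_op_norm :: "nat \<Rightarrow> ('h::chilbert_space \<Rightarrow>\<^sub>L 'k::chilbert_space) mat \<Rightarrow> real" where
  "mat_op_norm n Y =
     Sup {L2_set (\<lambda>i. norm (\<Sum>j<n. blinfun_apply (Y $$ (i, j)) (\<xi> j))) {..<n} | \<xi> :: nat \<Rightarrow> 'h.
            L2_set (\<lambda>j. norm (\<xi> j)) {..<n} \<le> 1}"

definition completely_bounded ::
  "('a::cstar_algebra \<Rightarrow> 'h::chilbert_space \<Rightarrow>\<^sub>L 'k::chilbert_space) \<Rightarrow> bool" where
  "completely_bounded \<phi> \<longleftrightarrow>
     (\<exists>C. \<forall>n. \<forall>X\<in>carrier_mat n n. mat_op_norm n (map_mat \<phi> X) \<le> C * mat_cstar_norm n X)"

end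

theory Submission
  imports Defs "HOL-Analysis.Finite_Function_Topology"
begin

text \<open>
  Extend \<open>\<pi>\<close>, \<open>\<pi>'\<close> and \<open>\<delta>\<close> to the unitization \<open>A~\<close> by \<open>\<pi>(1) = 1\<close>, \<open>\<pi>'(1) = 1\<close>, \<open>\<delta>(1) = 0\<close>. On \<open>A~ \<otimes> h\<close>
  consider the maps \<open>Q\<^sub>1 (b \<otimes> \<xi>) = \<delta>(b) \<xi>\<close> and \<open>Q\<^sub>2 (b \<otimes> \<xi>) = \<pi>(b) \<xi>\<close>, which satisfy
  \<open>Q\<^sub>1 (a u) = \<pi>'(a) Q\<^sub>1 u + \<delta>(a) Q\<^sub>2 u\<close>. Complete boundedness and the Hahn-Banach theorem give a
  semi-inner product on \<open>A~ \<otimes> h\<close> for which \<open>A~\<close> acts by a *-representation, \<open>Q\<^sub>1\<close> is bounded and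
  \<open>\<parallel>1 \<otimes> \<xi>\<parallel> \<le> \<parallel>\<xi>\<parallel>\<close>. The component of \<open>1 \<otimes> \<xi>\<close> orthogonal to the kernel of \<open>Q\<^sub>2\<close> depends on \<open>\<xi>\<close>
  linearly and \<open>A~\<close>-equivariantly, so its image \<open>T \<xi>\<close> under \<open>Q\<^sub>1\<close> satisfies
  \<open>T \<pi>(a) = \<pi>'(a) T + \<delta>(a)\<close>, and \<open>-T\<close> implements \<open>\<delta>\<close>.

  The domination \<open>w \<le> diag D\<close> in the Hahn-Banach argument is tested with the positive functionals of
  \<open>A~\<close>. It controls the C*-norm of matrices over \<open>A\<close> because that norm exists and is unique.
\<close>

text \<open>\<open>A~ \<otimes> h\<close> is modelled by finitely supported functions from the bare
  set \<open>h\<close> to \<open>A~\<close>: \<open>\<xi>\<close> is a mere label, and nothing is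
  linear in it. Linearity returns because the component orthogonal to the kernel of
  \<open>Q2\<close> depends only on the value of \<open>Q2\<close>, which is the same at
  \<open>1 \<otimes> (\<xi> - \<eta>)\<close> and
  \<open>1 \<otimes> \<xi> - 1 \<otimes> \<eta>\<close>. Equivariance arises alike:
  \<open>b \<otimes> \<xi>\<close> and \<open>1 \<otimes> \<pi>(b) \<xi>\<close> share their value,
  and the kernel is invariant under \<open>A~\<close>.

  \<open>Q2\<close> is not known to be bounded for the semi-inner product. The orthogonal component
  is therefore approximated inside \<open>1 \<otimes> \<xi>\<close> plus the kernel, where
  \<open>Q2\<close> keeps the value \<open>\<xi>\<close>; this turns the identity for
  \<open>Q1 (a u)\<close> into the relation for \<open>T\<close>.

  Hahn-Banach needs a bound of the sum of the \<open>(norm (Q1 u_k))\<^sup>2\<close> by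
  \<open>K\<close> times the sum of the \<open>D_\<xi> (norm \<xi>)\<^sup>2\<close> whenever the sum
  of the \<open>u_k\<^sup>* u_k\<close> is below \<open>diag D\<close>. The rows \<open>u_k\<close>,
  with column \<open>\<xi>\<close> divided by the root of a perturbed \<open>D_\<xi>\<close>, then
  form a contraction over \<open>A~\<close>. \<open>K\<close> is the square of twice the bound for
  \<open>\<delta>\<close>; the 2 pays for dropping the scalar parts of the entries.\<close>

section \<open>Rules for complex scalars and the involution\<close>

lemma scaleC_zero_right [simp]: "c *\<^sub>C (0::'a::complex_normed_vector) = 0"
  using norm_scaleC[of c "0::'a"] by simp

lemma scaleC_zero_left [simp]: "0 *\<^sub>C (x::'a::complex_normed_vector) = 0"
  using norm_scaleC[of 0 x] by simp

lemma scaleC_one [simp]: "1 *\<^sub>C (x::'a::complex_normed_vector) = x"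
  using scaleC_of_real[of 1 x] by simp

lemma scaleC_minus_right: "c *\<^sub>C (- x) = - (c *\<^sub>C (x::'a::complex_normed_vector))"
  using scaleC_add_right[of c x "- x"] by (simp add: eq_neg_iff_add_eq_0 add.commute)

lemma scaleC_minus_left: "(- c) *\<^sub>C x = - (c *\<^sub>C (x::'a::complex_normed_vector))"
  using scaleC_add_left[of c "- c" x] by (simp add: eq_neg_iff_add_eq_0 add.commute)

lemma scaleC_diff_right: "c *\<^sub>C (x - y) = c *\<^sub>C x - c *\<^sub>C (y::'a::complex_normed_vector)"
  using scaleC_add_right[of c x "- y"] by (simp add: scaleC_minus_right)

lemma scaleC_scaleR: "c *\<^sub>C r *\<^sub>R x = r *\<^sub>R c *\<^sub>C (x::'a::complex_normed_vector)"
  by (simp add: scaleC_scaleC mult.commute flip: scaleC_of_real)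

lemma scaleR_scaleC: "(r *\<^sub>R c) *\<^sub>C x = r *\<^sub>R c *\<^sub>C (x::'a::complex_normed_vector)"
  by (simp add: scaleR_conv_of_real scaleC_of_real flip: scaleC_scaleC)

lemma scaleC_sum_right: "c *\<^sub>C sum f A = (\<Sum>i\<in>A. c *\<^sub>C (f i :: 'a::complex_normed_vector))"
  by (induction A rule: infinite_finite_induct) (auto simp: scaleC_add_right)

lemma bounded_linear_scaleC_right: "bounded_linear (\<lambda>x::'a::complex_normed_vector. c *\<^sub>C x)"
  using bounded_linear_scaleC_comp[OF bounded_linear_ident] .

lemma clinear_scaleR: "clinear f \<Longrightarrow> f (r *\<^sub>R x) = r *\<^sub>R f x"
  by (metis clinear_def scaleC_of_real)

lemma clinear_imp_linear: "clinear f \<Longrightarrow> linear f"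
  by (rule linearI) (auto simp: clinear_def clinear_scaleR)

lemma star_scaleR: "star (r *\<^sub>R x) = r *\<^sub>R star (x::'a::cstar_algebra)"
  using star_scaleC[of "complex_of_real r" x] by (simp add: scaleC_of_real)

lemma linear_star: "linear (star :: 'a::cstar_algebra \<Rightarrow> 'a)"
  by (rule linearI) (auto simp: star_add star_scaleR)

lemmas star_zero [simp] = linear_0[OF linear_star]
  and star_minus = linear_neg[OF linear_star]
  and star_diff = linear_diff[OF linear_star]
  and star_sum = linear_sum[OF linear_star]

lemma norm_star [simp]: "norm (star x) = norm (x::'a::cstar_algebra)"
proof -
  have le: "norm x \<le> norm (star x)" for x :: 'a
  proof (cases "x = 0")
    case False
    have "norm x * norm x \<le> norm (star x) * norm x"
      using norm_mult_ineq[of "star x" x] by (simp add: cstar_identity power2_eq_square)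
    then show ?thesis using False by simp
  qed simp
  show ?thesis using le[of x] le[of "star x"] by (simp add: star_star)
qed

lemma bounded_linear_star: "bounded_linear (star :: 'a::cstar_algebra \<Rightarrow> 'a)"
  using linear_star by (auto intro!: bounded_linear_intro[where K=1] simp: linear_iff)

lemmas tendsto_star = bounded_linear.tendsto[OF bounded_linear_star]

class cstar_algebra_1 = cstar_algebra + real_normed_algebra_1

lemma star_one [simp]: "star (1::'a::cstar_algebra_1) = 1"
  by (metis mult.right_neutral star_mult star_star mult_1)

section \<open>Adjoining a unit\<close>

text \<open>The modulus of the scalar part enters the norm because left multiplication is not faithful
  on the unitization when \<^typ>\<open>'a\<close> already has a unit.\<close>

datatype 'a unitization = Unitization (alg: 'a) (scalar: complex)

instantiation unitization :: (cstar_algebra) real_algebra_1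
begin

definition "0 = Unitization 0 0"
definition "1 = Unitization 0 1"
definition "u + v = Unitization (alg u + alg v) (scalar u + scalar v)"
definition "u - v = Unitization (alg u - alg v) (scalar u - scalar v)"
definition "- u = Unitization (- alg u) (- scalar u)"
definition "r *\<^sub>R u = Unitization (r *\<^sub>R alg u) (r *\<^sub>R scalar u)"
definition "u * v = Unitization
  (alg u * alg v + scalar u *\<^sub>C alg v + scalar v *\<^sub>C alg u) (scalar u * scalar v)"

lemmas unitization_ops = zero_unitization_def one_unitization_def plus_unitization_def
  minus_unitization_def uminus_unitization_def scaleR_unitization_def times_unitization_def

instance
  by standard (auto simp: unitization_ops algebra_simps scaleC_add_right scaleC_add_left
      scaleC_scaleC scaleC_mult_left scaleC_mult_right scaleC_scaleR scaleR_conv_of_real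
      simp flip: scaleC_of_real)

end

lemma unitization_sel [simp]:
  fixes u v :: "'a::cstar_algebra unitization"
  shows "alg (0 :: 'a unitization) = 0" "scalar (0 :: 'a unitization) = 0"
    "alg (1 :: 'a unitization) = 0" "scalar (1 :: 'a unitization) = 1"
    "alg (u + v) = alg u + alg v" "scalar (u + v) = scalar u + scalar v"
    "alg (u - v) = alg u - alg v" "scalar (u - v) = scalar u - scalar v"
    "alg (- u) = - alg u" "scalar (- u) = - scalar u"
    "alg (r *\<^sub>R u) = r *\<^sub>R alg u" "scalar (r *\<^sub>R u) = r *\<^sub>R scalar u"
    "alg (u * v) = alg u * alg v + scalar u *\<^sub>C alg v + scalar v *\<^sub>C alg u"
    "scalar (u * v) = scalar u * scalar v"
  by (simp_all add: unitization_ops)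

definition left_mult :: "'a::cstar_algebra unitization \<Rightarrow> 'a \<Rightarrow>\<^sub>L 'a" where
  "left_mult u = Blinfun (\<lambda>b. alg u * b + scalar u *\<^sub>C b)"

lemma left_mult_apply: "blinfun_apply (left_mult u) b = alg u * b + scalar u *\<^sub>C b"
  unfolding left_mult_def
  by (subst bounded_linear_Blinfun_apply)
    (intro bounded_linear_add bounded_linear_mult_right bounded_linear_scaleC_right refl)+

lemma left_mult_add: "left_mult (u + v) = left_mult u + left_mult v"
  by (rule blinfun_eqI) (simp add: left_mult_apply plus_blinfun.rep_eq algebra_simps scaleC_add_left)

lemma left_mult_scaleR: "left_mult (r *\<^sub>R u) = r *\<^sub>R left_mult u"
  by (rule blinfun_eqI) (simp add: left_mult_apply scaleR_blinfun.rep_eq scaleR_add_right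
      scaleR_scaleC)

lemma left_mult_mult: "left_mult (u * v) = left_mult u o\<^sub>L left_mult v"
  by (rule blinfun_eqI) (simp add: left_mult_apply algebra_simps scaleC_add_right scaleC_scaleC
      scaleC_mult_left scaleC_mult_right)

text \<open>Testing the operator on \<open>star a\<close> gives the lower bound, by the C*-identity.
  The embedded algebra thus keeps its norm.\<close>

lemma norm_left_mult_alg: "norm (left_mult (Unitization a 0)) = norm (a::'a::cstar_algebra)"
proof (rule antisym)
  show "norm (left_mult (Unitization a 0)) \<le> norm a"
    by (rule norm_blinfun_bound) (auto simp: left_mult_apply norm_mult_ineq)
  show "norm a \<le> norm (left_mult (Unitization a 0))"
  proof (cases "a = 0")
    case False
    have "norm a * norm a \<le> norm (left_mult (Unitization a 0)) * norm a"
      using norm_blinfun[of "left_mult (Unitization a 0)" "star a"]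
        cstar_identity[of "star a"] by (simp add: left_mult_apply star_star power2_eq_square)
    then show ?thesis using False by simp
  qed simp
qed

instantiation unitization :: (cstar_algebra) real_normed_algebra_1
begin

definition "norm u = max (norm (left_mult u)) (cmod (scalar u))"
definition "sgn u = inverse (norm u) *\<^sub>R (u :: 'a unitization)"
definition "dist u v = norm (u - v :: 'a unitization)"
definition "(uniformity :: ('a unitization \<times> 'a unitization) filter) =
  (INF e\<in>{0<..}. principal {(x, y). dist x y < e})"
definition "open (U :: 'a unitization set) \<longleftrightarrow>
  (\<forall>x\<in>U. eventually (\<lambda>(x', y). x' = x \<longrightarrow> y \<in> U) uniformity)"

instance
proof
  fix u v :: "'a unitization" and r :: real
  show "(norm u = 0) = (u = 0)"
  proof
    assume "norm u = 0"
    then have *: "norm (left_mult u) \<le> 0" "cmod (scalar u) \<le> 0"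
      by (auto simp: norm_unitization_def max_def split: if_splits)
    then have "u = Unitization (alg u) 0" by (cases u) auto
    then show "u = 0" using * norm_left_mult_alg[of "alg u"] by (simp add: zero_unitization_def)
  next
    assume "u = 0"
    have "left_mult (0 :: 'a unitization) = 0"
      by (rule blinfun_eqI) (simp add: left_mult_apply)
    with \<open>u = 0\<close> show "norm u = 0" by (simp add: norm_unitization_def)
  qed
  show "norm (u + v) \<le> norm u + norm v"
    using norm_triangle_ineq[of "left_mult u" "left_mult v"] norm_triangle_ineq[of "scalar u" "scalar v"]
    by (simp add: norm_unitization_def left_mult_add) linarith
  show "norm (r *\<^sub>R u) = \<bar>r\<bar> * norm u"
    by (simp add: norm_unitization_def left_mult_scaleR max_mult_distrib_left)
  show "norm (u * v) \<le> norm u * norm v"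
  proof -
    have "norm (left_mult (u * v)) \<le> norm u * norm v"
      unfolding left_mult_mult
      by (rule order_trans[OF norm_blinfun_compose mult_mono]) (auto simp: norm_unitization_def le_max_iff_disj)
    moreover have "cmod (scalar (u * v)) \<le> norm u * norm v"
      unfolding unitization_sel norm_mult
      by (rule mult_mono) (auto simp: norm_unitization_def le_max_iff_disj)
    ultimately show ?thesis by (simp add: norm_unitization_def)
  qed
  have "left_mult (1 :: 'a unitization) = id_blinfun"
    by (rule blinfun_eqI) (simp add: left_mult_apply)
  then show "norm (1 :: 'a unitization) = 1"
    using norm_blinfun_id_le[where 'a='a] by (simp add: norm_unitization_def max_def)
qed (auto simp: sgn_unitization_def dist_unitization_def uniformity_unitization_def open_unitization_def)

end

lemma norm_Unitization_alg [simp]: "norm (Unitization a 0) = norm (a::'a::cstar_algebra)"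
  by (simp add: norm_unitization_def norm_left_mult_alg)

lemma norm_scalar_le: "cmod (scalar u) \<le> norm u"
  by (simp add: norm_unitization_def)

text \<open>Serves completeness: the algebra parts of a Cauchy sequence are Cauchy. The 2 counts
  \<open>u\<close> and its scalar part.\<close>

lemma norm_alg_le: "norm (alg u) \<le> 2 * norm (u :: 'a::cstar_algebra unitization)"
proof -
  have "norm (alg u) = norm (u - Unitization 0 (scalar u))"
    by (simp add: minus_unitization_def flip: norm_Unitization_alg)
  moreover have "norm (left_mult (Unitization 0 (scalar u) :: 'a unitization)) \<le> cmod (scalar u)"
    by (rule norm_blinfun_bound) (auto simp: left_mult_apply norm_scaleC)
  then have "norm (Unitization 0 (scalar u) :: 'a unitization) \<le> cmod (scalar u)"
    by (simp add: norm_unitization_def)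
  ultimately show ?thesis
    using norm_triangle_ineq4[of u "Unitization 0 (scalar u)"] norm_scalar_le[of u] by simp
qed

lemma norm_Unitization_le: "norm (Unitization a c) \<le> norm (a::'a::cstar_algebra) + cmod c"
proof -
  have "norm (left_mult (Unitization 0 c :: 'a unitization)) \<le> cmod c"
    by (rule norm_blinfun_bound) (auto simp: left_mult_apply norm_scaleC)
  then have "norm (Unitization 0 c :: 'a unitization) \<le> cmod c"
    by (simp add: norm_unitization_def)
  moreover have "Unitization a c = Unitization a 0 + Unitization 0 c"
    by (simp add: plus_unitization_def)
  ultimately show ?thesis
    using norm_triangle_ineq[of "Unitization a 0" "Unitization 0 c"] by simp
qed

lemma left_mult_scaleC: "left_mult (Unitization (c *\<^sub>C alg u) (c * scalar u)) = c *\<^sub>C left_mult u"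
  by (rule blinfun_eqI) (simp add: left_mult_apply scaleC_blinfun.rep_eq scaleC_add_right
      scaleC_scaleC scaleC_mult_left)

instantiation unitization :: (cstar_algebra) cstar_algebra_1
begin

definition "c *\<^sub>C u = Unitization (c *\<^sub>C alg u) (c * scalar u)"
definition "star u = Unitization (star (alg u)) (cnj (scalar u))"

text \<open>\<open>left_mult (star u)\<close> is the adjoint of \<open>left_mult u\<close> for the
  algebra-valued inner product \<open>star b * c\<close>. The C*-identity of the unitization then
  follows as for operators on a Hilbert space.\<close>

lemma star_left_mult:
  "star (blinfun_apply (left_mult u) b) * c = star b * blinfun_apply (left_mult (star u)) c"
  by (simp add: left_mult_apply star_unitization_def star_add star_mult star_scaleC algebra_simps
      scaleC_mult_left scaleC_mult_right)

lemma norm_left_mult_square_le: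
  "(norm (left_mult u))\<^sup>2 \<le> norm (left_mult (star u * u))" for u :: "'a unitization"
proof -
  have "norm (left_mult u) \<le> sqrt (norm (left_mult (star u * u)))"
  proof (rule norm_blinfun_bound)
    fix b
    have "(norm (blinfun_apply (left_mult u) b))\<^sup>2
        = norm (star b * blinfun_apply (left_mult (star u * u)) b)"
      by (simp add: left_mult_mult star_left_mult flip: cstar_identity)
    also have "\<dots> \<le> norm b * (norm (left_mult (star u * u)) * norm b)"
      by (rule order_trans[OF norm_mult_ineq]) (simp add: mult_left_mono norm_blinfun)
    finally have "(norm (blinfun_apply (left_mult u) b))\<^sup>2 \<le> norm (left_mult (star u * u)) * (norm b)\<^sup>2"
      by (simp add: power2_eq_square algebra_simps)
    from real_sqrt_le_mono[OF this]
    show "norm (blinfun_apply (left_mult u) b) \<le> sqrt (norm (left_mult (star u * u))) * norm b"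
      by (simp add: real_sqrt_mult)
  qed simp
  then show ?thesis
    by (metis norm_ge_zero power_mono real_sqrt_pow2)
qed

lemma norm_left_mult_star: "norm (left_mult (star u)) = norm (left_mult u)" for u :: "'a unitization"
proof -
  have le: "norm (left_mult u) \<le> norm (left_mult (star u))" for u :: "'a unitization"
  proof (cases "left_mult u = 0")
    case False
    have "norm (left_mult u) * norm (left_mult u) \<le> norm (left_mult (star u)) * norm (left_mult u)"
      using norm_left_mult_square_le[of u] norm_blinfun_compose[of "left_mult (star u)" "left_mult u"]
      by (simp add: power2_eq_square left_mult_mult)
    then show ?thesis using False by simp
  qed simp
  show ?thesis using le[of u] le[of "star u"] by (simp add: star_unitization_def star_star)
qed

instance
proof
  fix u v :: "'a unitization" and c d :: complex and r :: real
  show "c *\<^sub>C (u + v) = c *\<^sub>C u + c *\<^sub>C v" "(c + d) *\<^sub>C u = c *\<^sub>C u + d *\<^sub>C u"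
    "c *\<^sub>C d *\<^sub>C u = (c * d) *\<^sub>C u" "complex_of_real r *\<^sub>C u = r *\<^sub>R u"
    "(c *\<^sub>C u) * v = c *\<^sub>C (u * v)" "u * (c *\<^sub>C v) = c *\<^sub>C (u * v)"
    by (auto simp: scaleC_unitization_def unitization_ops algebra_simps scaleC_add_right scaleC_add_left
        scaleC_scaleC scaleC_of_real scaleR_conv_of_real scaleC_mult_left scaleC_mult_right)
  show "norm (c *\<^sub>C u) = cmod c * norm u"
    by (simp add: norm_unitization_def scaleC_unitization_def left_mult_scaleC norm_scaleC
        norm_mult max_mult_distrib_left)
  show "star (u + v) = star u + star v" "star (c *\<^sub>C u) = cnj c *\<^sub>C star u"
    "star (u * v) = star v * star u" "star (star u) = u"
    by (auto simp: scaleC_unitization_def star_unitization_def unitization_ops star_add star_scaleC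
        star_mult star_star)
  have "norm (left_mult (star u * u)) = (norm (left_mult u))\<^sup>2"
    using norm_left_mult_square_le[of u] norm_blinfun_compose[of "left_mult (star u)" "left_mult u"]
    by (simp add: norm_left_mult_star left_mult_mult power2_eq_square)
  moreover have "cmod (scalar (star u * u)) = (cmod (scalar u))\<^sup>2"
    by (simp add: star_unitization_def norm_mult power2_eq_square)
  moreover have "max (x\<^sup>2) (y\<^sup>2) = (max x y)\<^sup>2" if "0 \<le> x" "0 \<le> y" for x y :: real
    using that by (auto simp: max_def intro: power_mono antisym)
  ultimately show "norm (star u * u) = (norm u)\<^sup>2"
    by (simp add: norm_unitization_def)
next
  fix X :: "nat \<Rightarrow> 'a unitization"
  assume X: "Cauchy X"
  have "Cauchy (\<lambda>n. alg (X n))"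
  proof (rule metric_CauchyI)
    fix e :: real assume "e > 0"
    then obtain M where M: "\<And>m n. m \<ge> M \<Longrightarrow> n \<ge> M \<Longrightarrow> dist (X m) (X n) < e / 2"
      using metric_CauchyD[OF X, of "e / 2"] by auto
    have "dist (alg (X m)) (alg (X n)) < e" if "m \<ge> M" "n \<ge> M" for m n
      using M[OF that] norm_alg_le[of "X m - X n"] by (simp add: dist_norm)
    then show "\<exists>M. \<forall>m\<ge>M. \<forall>n\<ge>M. dist (alg (X m)) (alg (X n)) < e" by blast
  qed
  then obtain a where a: "(\<lambda>n. alg (X n)) \<longlonglongrightarrow> a" using Cauchy_convergent convergent_def by blast
  have "Cauchy (\<lambda>n. scalar (X n))"
  proof (rule metric_CauchyI)
    fix e :: real assume "e > 0"
    then obtain M where M: "\<And>m n. m \<ge> M \<Longrightarrow> n \<ge> M \<Longrightarrow> dist (X m) (X n) < e"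
      using metric_CauchyD[OF X, of e] by auto
    have "dist (scalar (X m)) (scalar (X n)) < e" if "m \<ge> M" "n \<ge> M" for m n
      using M[OF that] norm_scalar_le[of "X m - X n"] by (simp add: dist_norm)
    then show "\<exists>M. \<forall>m\<ge>M. \<forall>n\<ge>M. dist (scalar (X m)) (scalar (X n)) < e" by blast
  qed
  then obtain c where c: "(\<lambda>n. scalar (X n)) \<longlonglongrightarrow> c" using Cauchy_convergent convergent_def by blast
  have "(\<lambda>n. norm (alg (X n) - a) + cmod (scalar (X n) - c)) \<longlonglongrightarrow> 0"
    using tendsto_add[OF tendsto_norm_zero[OF LIM_zero[OF a]] tendsto_norm_zero[OF LIM_zero[OF c]]]
    by simp
  then have "X \<longlonglongrightarrow> Unitization a c"
    by (rule Lim_transform_bound[THEN LIM_zero_cancel, rotated])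
      (simp add: minus_unitization_def norm_Unitization_le)
  then show "convergent X" by (auto simp: convergent_def)
qed

end

section \<open>Square roots and positivity in C*-algebras\<close>

text \<open>Iterates for the fixed point equation \<open>w = (x + w\<^sup>2) / 2\<close>, that is
  \<open>(1 - w)\<^sup>2 = 1 - x\<close>. They are polynomials in \<open>x\<close> with nonnegative
  coefficients and no constant term, so they make sense without a unit, and on the unit ball their
  norms are majorized by their values at the real number 1.\<close>

primrec sqrt_iter :: "'a::real_normed_algebra \<Rightarrow> nat \<Rightarrow> 'a" where
  "sqrt_iter x 0 = 0"
| "sqrt_iter x (Suc n) = (1/2) *\<^sub>R (x + sqrt_iter x n * sqrt_iter x n)"

lemma sqrt_iter_one_bounds:
  "0 \<le> sqrt_iter (1::real) n \<and> sqrt_iter (1::real) n \<le> sqrt_iter 1 (Suc n) \<and> sqrt_iter (1::real) n \<le> 1"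
proof (induction n)
  case (Suc n)
  let ?a = "sqrt_iter (1::real) n" and ?b = "sqrt_iter (1::real) (Suc n)"
  have b: "0 \<le> ?b" "?a \<le> ?b" using Suc by auto
  have "?a * ?a \<le> 1" using Suc by (simp add: mult_le_one)
  then have "?b \<le> 1" by simp
  moreover have "?a * ?a \<le> ?b * ?b" using Suc b by (intro mult_mono) auto
  then have "?b \<le> sqrt_iter 1 (Suc (Suc n))" by simp
  ultimately show ?case using b by simp
qed simp

lemma sqrt_iter_commute: "c * x = x * c \<Longrightarrow> c * sqrt_iter x n = sqrt_iter x n * c"
  by (induction n) (auto simp: algebra_simps, metis mult.assoc)

lemma sqrt_iter_commute_self: "sqrt_iter x m * sqrt_iter x n = sqrt_iter x n * sqrt_iter x m"
  by (metis sqrt_iter_commute)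

lemma norm_sqrt_iter_le:
  assumes "norm x \<le> 1"
  shows "norm (sqrt_iter x n) \<le> sqrt_iter 1 n"
proof (induction n)
  case (Suc n)
  have "norm (sqrt_iter x n * sqrt_iter x n) \<le> sqrt_iter 1 n * sqrt_iter 1 n"
    by (rule order_trans[OF norm_mult_ineq mult_mono]) (use Suc sqrt_iter_one_bounds in auto)
  then show ?case
    using norm_triangle_ineq[of x "sqrt_iter x n * sqrt_iter x n"] assms by simp
qed simp

text \<open>Since the iterates commute, \<open>b\<^sup>2 - a\<^sup>2 = (b - a) (b + a)\<close>, and
  each increment is bounded by that of the scalar sequence at 1. That sequence increases and is
  bounded, which gives the Cauchy property even for \<open>norm x = 1\<close>, where the iteration
  has no uniform contraction factor.\<close>

lemma norm_sqrt_iter_step: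
  assumes "norm x \<le> 1"
  shows "norm (sqrt_iter x (Suc n) - sqrt_iter x n) \<le> sqrt_iter 1 (Suc n) - sqrt_iter 1 n"
proof (induction n)
  case (Suc n)
  let ?a = "sqrt_iter x n" and ?b = "sqrt_iter x (Suc n)"
  let ?r = "sqrt_iter (1::real) n" and ?s = "sqrt_iter (1::real) (Suc n)"
  have "sqrt_iter x (Suc (Suc n)) - ?b = (1/2) *\<^sub>R (?b * ?b - ?a * ?a)"
    by (simp add: algebra_simps)
  also have "?b * ?b - ?a * ?a = (?b - ?a) * (?b + ?a)"
    using sqrt_iter_commute_self[of x "Suc n" n] by (simp only: algebra_simps)
  finally have "norm (sqrt_iter x (Suc (Suc n)) - ?b) \<le> (1/2) * (norm (?b - ?a) * norm (?b + ?a))"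
    by (simp add: norm_mult_ineq)
  also have "\<dots> \<le> (1/2) * ((?s - ?r) * (?s + ?r))"
  proof (intro mult_left_mono mult_mono)
    show "norm (?b + ?a) \<le> ?s + ?r"
      by (rule norm_triangle_le[OF add_mono]) (rule norm_sqrt_iter_le[OF assms])+
    show "0 \<le> ?s - ?r" using sqrt_iter_one_bounds[of n] by linarith
  qed (use Suc in auto)
  also have "\<dots> = sqrt_iter 1 (Suc (Suc n)) - ?s"
    by (simp add: algebra_simps)
  finally show ?case .
qed (use assms in simp)

lemma Cauchy_sqrt_iter:
  assumes "norm x \<le> 1"
  shows "Cauchy (sqrt_iter x)"
proof -
  have step: "dist (sqrt_iter x (n + k)) (sqrt_iter x n) \<le> sqrt_iter 1 (n + k) - sqrt_iter 1 n" for n k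
  proof (induction k)
    case (Suc k)
    then show ?case
      using norm_sqrt_iter_step[OF assms, of "n + k"]
        dist_triangle[of "sqrt_iter x (n + Suc k)" "sqrt_iter x n" "sqrt_iter x (n + k)"]
      by (simp add: dist_norm)
  qed simp
  have "incseq (sqrt_iter (1::real))"
    by (rule incseq_SucI) (use sqrt_iter_one_bounds in blast)
  then have "convergent (sqrt_iter (1::real))"
    using sqrt_iter_one_bounds by (auto intro!: Bseq_mono_convergent BseqI'[where K=1] simp: incseq_def)
  then have C: "Cauchy (sqrt_iter (1::real))" by (rule convergent_Cauchy)
  show ?thesis
  proof (rule metric_CauchyI)
    fix e :: real assume "e > 0"
    then obtain M where M: "\<And>m n. m \<ge> M \<Longrightarrow> n \<ge> M \<Longrightarrow> dist (sqrt_iter (1::real) m) (sqrt_iter 1 n) < e"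
      using metric_CauchyD[OF C] by blast
    have *: "dist (sqrt_iter x m) (sqrt_iter x n) < e" if "m \<ge> n" "n \<ge> M" for m n
      using step[of n "m - n"] M[of m n] that by (simp add: dist_real_def)
    show "\<exists>M. \<forall>m\<ge>M. \<forall>n\<ge>M. dist (sqrt_iter x m) (sqrt_iter x n) < e"
      by (rule exI[of _ M]) (metis * dist_commute nle_le)
  qed
qed

text \<open>In a unital algebra the equation says \<open>(1 - w)\<^sup>2 = 1 - x\<close>.\<close>

lemma ex_quasi_sqrt:
  fixes x :: "'a::cstar_algebra"
  assumes "star x = x" and "norm x \<le> 1"
  obtains w where "star w = w" and "norm w \<le> 1" and "x = 2 *\<^sub>R w - w * w"
    and "\<And>c. c * x = x * c \<Longrightarrow> c * w = w * c"
proof -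
  obtain w where w: "sqrt_iter x \<longlonglongrightarrow> w"
    using Cauchy_sqrt_iter[OF assms(2)] Cauchy_convergent convergent_def by blast
  have "star (sqrt_iter x n) = sqrt_iter x n" for n
    by (induction n) (auto simp: star_scaleR star_add star_mult assms)
  then have "sqrt_iter x \<longlonglongrightarrow> star w"
    using tendsto_star[OF w] by simp
  then have "star w = w"
    using w LIMSEQ_unique by blast
  moreover have "norm (sqrt_iter x n) \<le> 1" for n
    using norm_sqrt_iter_le[OF assms(2)] sqrt_iter_one_bounds order_trans by blast
  then have "norm w \<le> 1"
    using Lim_bounded[OF tendsto_norm[OF w], of 0] by simp
  moreover have "x = 2 *\<^sub>R w - w * w"
  proof -
    have "(\<lambda>n. sqrt_iter x (Suc n)) \<longlonglongrightarrow> (1/2) *\<^sub>R (x + w * w)"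
      unfolding sqrt_iter.simps by (intro tendsto_intros w)
    then have "w = (1/2) *\<^sub>R (x + w * w)"
      using LIMSEQ_unique LIMSEQ_Suc[OF w] by blast
    then have "2 *\<^sub>R w = 2 *\<^sub>R ((1/2) *\<^sub>R (x + w * w))" by simp
    then show ?thesis by simp
  qed
  moreover have "c * w = w * c" if "c * x = x * c" for c
  proof -
    have "(\<lambda>n. c * sqrt_iter x n) \<longlonglongrightarrow> c * w" "(\<lambda>n. sqrt_iter x n * c) \<longlonglongrightarrow> w * c"
      by (intro tendsto_intros w)+
    then show ?thesis unfolding sqrt_iter_commute[OF that] by (rule LIMSEQ_unique)
  qed
  ultimately show ?thesis using that by blast
qed

section \<open>Positive elements and their square roots\<close>

text \<open>For self-adjoint \<open>y\<close> the inequality says that the spectrum lies between 0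
  and \<open>2 s\<close>. In this form positivity is preserved by sums through the triangle
  inequality, and it is what \<open>ex_quasi_sqrt\<close> asks for after rescaling.\<close>

definition positive :: "'a::cstar_algebra_1 \<Rightarrow> bool" where
  "positive y \<longleftrightarrow> star y = y \<and> (\<exists>s>0. norm (s *\<^sub>R 1 - y) \<le> s)"

lemma positiveI: "star y = y \<Longrightarrow> 0 < s \<Longrightarrow> norm (s *\<^sub>R 1 - y) \<le> s \<Longrightarrow> positive y"
  by (auto simp: positive_def)

lemma positive_star: "positive y \<Longrightarrow> star y = y"
  by (simp add: positive_def)

lemma positive_add:
  assumes "positive x" "positive y"
  shows "positive (x + y)"
proof -
  obtain s t where s: "s > 0" "norm (s *\<^sub>R 1 - x) \<le> s" and t: "t > 0" "norm (t *\<^sub>R 1 - y) \<le> t"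
    using assms by (auto simp: positive_def)
  have eq: "(s + t) *\<^sub>R 1 - (x + y) = (s *\<^sub>R 1 - x) + (t *\<^sub>R 1 - y)"
    by (simp add: algebra_simps)
  have "norm ((s + t) *\<^sub>R 1 - (x + y)) \<le> s + t"
    unfolding eq using norm_triangle_le[OF add_mono[OF s(2) t(2)]] .
  then show ?thesis
    using assms s t by (intro positiveI[of _ "s + t"]) (auto simp: positive_def star_add)
qed

lemma positive_scaleR:
  assumes "positive x" "r > 0"
  shows "positive (r *\<^sub>R x)"
proof -
  obtain s where s: "s > 0" "norm (s *\<^sub>R 1 - x) \<le> s" using assms by (auto simp: positive_def)
  have "(r * s) *\<^sub>R 1 - r *\<^sub>R x = r *\<^sub>R (s *\<^sub>R 1 - x)" by (simp add: scaleR_diff_right)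
  then show ?thesis
    using assms s by (intro positiveI[of _ "r * s"]) (auto simp: positive_def star_scaleR)
qed

lemma positive_scaleR_one:
  assumes "positive (r *\<^sub>R (1::'a::cstar_algebra_1))"
  shows "r \<ge> 0"
proof -
  obtain s where "s > 0" "norm (s *\<^sub>R 1 - r *\<^sub>R (1::'a)) \<le> s" using assms by (auto simp: positive_def)
  then show ?thesis by (simp flip: scaleR_diff_left)
qed

lemma positive_norm_diff:
  assumes "star x = x"
  shows "positive (norm x *\<^sub>R 1 - x)"
proof (rule positiveI[of _ "norm x + 1"])
  show "norm ((norm x + 1) *\<^sub>R 1 - (norm x *\<^sub>R 1 - x)) \<le> norm x + 1"
    using norm_triangle_ineq[of 1 x] by (simp add: scaleR_add_left add.commute)
qed (auto simp: assms star_diff star_scaleR add_nonneg_pos)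

text \<open>The inequality in \<open>positive\<close> puts \<open>1 - y / s\<close> into the unit
  ball, where \<open>ex_quasi_sqrt\<close> applies. The commutation clause stands in for functional
  calculus: later proofs need roots that commute with given elements.\<close>

lemma ex_positive_sqrt:
  assumes "positive y"
  obtains h where "positive h" "h * h = y" "\<And>c. c * y = y * c \<Longrightarrow> c * h = h * c"
proof -
  obtain s where s: "s > 0" "norm (s *\<^sub>R 1 - y) \<le> s" using assms by (auto simp: positive_def)
  define x where "x = 1 - (1/s) *\<^sub>R y"
  have xs: "x = (1/s) *\<^sub>R (s *\<^sub>R 1 - y)" using s by (simp add: x_def scaleR_diff_right)
  have "norm x \<le> 1" unfolding xs norm_scaleR using s by simp
  moreover have "star x = x" using positive_star[OF assms] by (simp add: x_def star_diff star_scaleR)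
  ultimately obtain w where w: "star w = w" "norm w \<le> 1" "x = 2 *\<^sub>R w - w * w"
    and comm: "\<And>c. c * x = x * c \<Longrightarrow> c * w = w * c"
    using ex_quasi_sqrt by blast
  define h where "h = sqrt s *\<^sub>R (1 - w)"
  have "(1 - w) * (1 - w) = 1 - x" by (simp add: w(3) algebra_simps scaleR_2)
  then have "h * h = y" using s by (simp add: h_def x_def)
  moreover have "positive (1 - w)"
    using w by (intro positiveI[of _ 1]) (auto simp: star_diff)
  then have "positive h" using s by (simp add: h_def positive_scaleR)
  moreover have "c * h = h * c" if "c * y = y * c" for c
  proof -
    have "c * x = x * c" using that by (simp add: x_def algebra_simps)
    then show ?thesis using comm by (simp add: h_def algebra_simps)
  qed
  ultimately show ?thesis using that by blast
qed

lemma norm_square_selfadjoint: "star a = a \<Longrightarrow> norm (a * a) = (norm (a::'a::cstar_algebra))\<^sup>2"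
  by (metis cstar_identity)

lemma norm_add_i_times:
  fixes a b :: "'a::cstar_algebra"
  assumes "star a = a" "star b = b" "a * b = b * a"
  shows "(norm (a + \<i> *\<^sub>C b))\<^sup>2 = norm (a * a + b * b)"
proof -
  have "star (a + \<i> *\<^sub>C b) * (a + \<i> *\<^sub>C b) = a * a + b * b"
    using assms by (simp add: star_add star_scaleC scaleC_minus_left algebra_simps
        scaleC_mult_left scaleC_mult_right scaleC_scaleC scaleC_diff_right scaleC_add_right)
  then show ?thesis by (metis cstar_identity)
qed

lemma norm_square_le_sum_squares:
  fixes a b :: "'a::cstar_algebra"
  assumes "star a = a" "star b = b" "a * b = b * a"
  shows "(norm a)\<^sup>2 \<le> norm (a * a + b * b)"
proof -
  let ?z = "a + \<i> *\<^sub>C b"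
  have "2 *\<^sub>R a = ?z + star ?z"
    using assms by (simp add: star_add star_scaleC scaleC_minus_left scaleR_2)
  then have "norm (2 *\<^sub>R a) \<le> norm ?z + norm (star ?z)"
    by (metis norm_triangle_ineq)
  then have "norm a \<le> norm ?z" by simp
  then show ?thesis using norm_add_i_times[OF assms] by (metis norm_ge_zero power_mono)
qed

text \<open>With \<open>k\<close> the root of \<open>1 - h\<^sup>2\<close>, the element
  \<open>z = h + i k\<close> is unitary and \<open>1 - 2 h\<^sup>2\<close> is minus the mean of
  \<open>z\<^sup>2\<close> and \<open>(star z)\<^sup>2\<close>, as in the double angle formula.
  Halved, the bound is the inequality in \<open>positive\<close> for \<open>h * h\<close> with
  \<open>s = 1/2\<close>.\<close>

lemma norm_one_minus_square_le:
  fixes h :: "'a::cstar_algebra_1"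
  assumes "star h = h" "norm h \<le> 1"
  shows "norm (1 - 2 *\<^sub>R (h * h)) \<le> 1"
proof -
  have "norm (h * h) \<le> 1" using assms by (simp add: norm_square_selfadjoint power_le_one)
  then have "positive (1 - h * h)"
    by (intro positiveI[of _ 1]) (auto simp: star_diff star_mult assms)
  then obtain k where k: "positive k" "k * k = 1 - h * h"
    and comm: "\<And>c. c * (1 - h * h) = (1 - h * h) * c \<Longrightarrow> c * k = k * c"
    using ex_positive_sqrt by blast
  have hk: "h * k = k * h" by (rule comm) (simp add: algebra_simps)
  have sk: "star k = k" using k positive_star by blast
  let ?z = "h + \<i> *\<^sub>C k"
  have "(norm ?z)\<^sup>2 = 1"
    using norm_add_i_times[OF assms(1) sk hk] k by simp
  then have z: "norm ?z = 1" by (metis abs_norm_cancel power2_eq_1_iff abs_1 abs_minus_cancel)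
  have "?z * ?z + star ?z * star ?z = 2 *\<^sub>R (h * h - k * k)"
    using assms sk hk by (simp add: star_add star_scaleC scaleC_minus_left algebra_simps scaleC_add_right
        scaleC_diff_right scaleC_mult_left scaleC_mult_right scaleC_scaleC scaleR_2)
  also have "\<dots> = - (2 *\<^sub>R (1 - 2 *\<^sub>R (h * h)))"
    unfolding scaleR_2 k(2) by (simp add: algebra_simps)
  finally have "norm (- (2 *\<^sub>R (1 - 2 *\<^sub>R (h * h)))) \<le> norm (?z * ?z) + norm (star ?z * star ?z)"
    by (metis norm_triangle_ineq)
  also have "\<dots> \<le> norm ?z * norm ?z + norm ?z * norm ?z"
    using norm_mult_ineq[of ?z ?z] norm_mult_ineq[of "star ?z" "star ?z"] by simp
  finally show ?thesis using z by simp
qed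

lemma positive_square:
  assumes "star h = h"
  shows "positive (h * h)"
proof (cases "h = 0")
  case True
  then show ?thesis by (intro positiveI[of _ 1]) auto
next
  case False
  define g where "g = (1 / norm h) *\<^sub>R h"
  have "norm (1 - 2 *\<^sub>R (g * g)) \<le> 1"
    using False assms by (intro norm_one_minus_square_le) (auto simp: g_def star_scaleR)
  moreover have "(1/2) *\<^sub>R 1 - g * g = (1/2) *\<^sub>R (1 - 2 *\<^sub>R (g * g))"
    by (simp add: scaleR_diff_right)
  ultimately have "positive (g * g)"
    using assms by (intro positiveI[of _ "1/2"]) (auto simp: g_def star_scaleR star_mult)
  moreover have "h * h = ((norm h)\<^sup>2) *\<^sub>R (g * g)"
    using False by (simp add: g_def power2_eq_square)
  ultimately show ?thesis using False by (simp add: positive_scaleR)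
qed

text \<open>Stands for the fact that the norm of a positive element is the top of its spectrum. With
  \<open>R\<close> the norm on the right, \<open>R - t - y\<close> has a root \<open>d\<close>
  commuting with the root \<open>h\<close> of \<open>y\<close>, and
  \<open>h\<^sup>2 + d\<^sup>2 = R - t\<close> bounds the norm of
  \<open>h\<^sup>2 = y\<close>.\<close>

lemma norm_add_scalar_ge:
  fixes y :: "'a::cstar_algebra_1"
  assumes "positive y"
  shows "t + norm y \<le> norm (t *\<^sub>R 1 + y)"
proof -
  let ?R = "norm (t *\<^sub>R 1 + y)"
  obtain h where h: "positive h" "h * h = y" using ex_positive_sqrt[OF assms] by blast
  have sh: "star h = h" using h positive_star by blast
  have "positive (?R *\<^sub>R 1 - (t *\<^sub>R 1 + y))"
    using positive_star[OF assms] by (intro positive_norm_diff) (simp add: star_add star_scaleR)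
  then obtain d where d: "positive d" "d * d = ?R *\<^sub>R 1 - (t *\<^sub>R 1 + y)"
    and comm: "\<And>c. c * (?R *\<^sub>R 1 - (t *\<^sub>R 1 + y)) = (?R *\<^sub>R 1 - (t *\<^sub>R 1 + y)) * c \<Longrightarrow> c * d = d * c"
    using ex_positive_sqrt by blast
  have hd: "h * d = d * h" by (rule comm) (simp add: algebra_simps flip: h(2))
  have eq: "h * h + d * d = (?R - t) *\<^sub>R 1" by (simp add: d(2) h(2) algebra_simps)
  have "positive ((?R - t) *\<^sub>R (1::'a))"
    unfolding eq[symmetric] using positive_add positive_square sh d(1) positive_star by blast
  then have "?R - t \<ge> 0" by (rule positive_scaleR_one)
  then show ?thesis
    using norm_square_le_sum_squares[OF sh _ hd] eq d(1) h(2) positive_star norm_square_selfadjoint[OF sh]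
    by fastforce
qed

text \<open>The core of the argument of Fukamiya and Kaplansky: completing the square in
  \<open>k + s k\<^sup>2 = z (1 - s h\<^sup>2) z\<^sup>*\<close>, where \<open>k = z z\<^sup>*\<close>, replaces the comparison of spectra.\<close>

lemma neg_star_mult_square_imp_zero:
  fixes z :: "'a::cstar_algebra_1"
  assumes z: "star z * z = - (h * h)" and h: "star h = h"
  shows "z = 0"
proof -
  define k where "k = z * star z"
  have sk: "star k = k" by (simp add: k_def star_mult star_star)
  \<comment> \<open>\<open>a\<close> and \<open>b\<close> are the real and imaginary parts of
    \<open>z\<close>, so \<open>z\<^sup>* z + z z\<^sup>* = 2 a\<^sup>2 + 2 b\<^sup>2\<close>. Hence
    \<open>k\<close> is a positive combination of squares.\<close>
  define a where "a = (1/2) *\<^sub>R (z + star z)"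
  define b where "b = (1/2) *\<^sub>R (\<i> *\<^sub>C (star z - z))"
  have sa: "star a = a" by (simp add: a_def star_scaleR star_add star_star add.commute)
  have sb: "star b = b"
    by (simp add: b_def star_scaleR star_scaleC star_diff star_star scaleC_minus_left scaleC_diff_right)
  have ii: "\<i> *\<^sub>C \<i> *\<^sub>C u = - u" for u :: 'a
    by (simp add: scaleC_scaleC scaleC_minus_left)
  have "2 *\<^sub>R (a * a) + 2 *\<^sub>R (b * b)
      = (1/2) *\<^sub>R ((z + star z) * (z + star z) - (star z - z) * (star z - z))"
    by (simp add: a_def b_def scaleC_mult_left scaleC_mult_right scaleC_scaleR ii
        scaleR_diff_right)
  also have "(z + star z) * (z + star z) - (star z - z) * (star z - z) = 2 *\<^sub>R (star z * z + z * star z)"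
    unfolding scaleR_2 by (simp add: algebra_simps)
  finally have "k = 2 *\<^sub>R (a * a) + 2 *\<^sub>R (b * b) + h * h"
    by (simp add: k_def z)
  then have pk: "positive k"
    using positive_square[OF sa] positive_square[OF sb] positive_square[OF h]
    by (simp add: positive_add positive_scaleR)
  obtain s0 where s0: "s0 > 0" "norm (s0 *\<^sub>R 1 - h * h) \<le> s0"
    using positive_square[OF h] by (auto simp: positive_def)
  \<comment> \<open>This \<open>s\<close> makes \<open>1 - s h\<^sup>2\<close> a contraction, so
    that \<open>?e\<close> has norm at most that of \<open>k\<close>.\<close>
  define s where "s = 1 / s0"
  have s: "s > 0" using s0 by (simp add: s_def)
  have "1 - s *\<^sub>R (h * h) = s *\<^sub>R (s0 *\<^sub>R 1 - h * h)" using s0 by (simp add: s_def scaleR_diff_right)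
  then have le1: "norm (1 - s *\<^sub>R (h * h)) \<le> 1" using s0 by (simp add: s_def)
  let ?e = "k + s *\<^sub>R (k * k)"
  have "k * k = z * (star z * z) * star z" by (simp add: k_def mult.assoc)
  also have "\<dots> = - (z * (h * h) * star z)" by (simp add: z)
  finally have "?e = z * (1 - s *\<^sub>R (h * h)) * star z"
    by (simp add: k_def algebra_simps)
  then have "norm ?e \<le> norm z * norm (1 - s *\<^sub>R (h * h)) * norm (star z)"
    using order_trans[OF norm_mult_ineq mult_right_mono[OF norm_mult_ineq norm_ge_zero]] by metis
  also have "\<dots> \<le> norm z * 1 * norm z"
    by (intro mult_mono) (use le1 in auto)
  also have "\<dots> = norm k"
    using cstar_identity[of "star z"] by (simp add: k_def star_star power2_eq_square)
  finally have e: "norm ?e \<le> norm k" .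
  have se: "star ?e = ?e" by (simp add: star_add star_scaleR star_mult sk)
  obtain d where d: "positive d" "d * d = norm ?e *\<^sub>R 1 - ?e"
    and comm: "\<And>c. c * (norm ?e *\<^sub>R 1 - ?e) = (norm ?e *\<^sub>R 1 - ?e) * c \<Longrightarrow> c * d = d * c"
    using ex_positive_sqrt[OF positive_norm_diff[OF se]] by blast
  have kd: "k * d = d * k" by (rule comm) (simp add: algebra_simps)
  \<comment> \<open>\<open>c\<^sup>2\<close> is \<open>?e + 1 / (4 s)\<close>. As \<open>k\<close>
    is positive, the squared norm of \<open>c\<close> is at least \<open>\<parallel>k\<parallel> + s
    \<parallel>k\<parallel>\<^sup>2 + 1 / (4 s)\<close>, while the bound on \<open>?e\<close> leaves
    room for \<open>\<parallel>k\<parallel> + 1 / (4 s)\<close> only.\<close>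
  define c where "c = sqrt s *\<^sub>R ((1 / (2 * s)) *\<^sub>R 1 + k)"
  have cd: "c * d = d * c" using kd by (simp add: c_def algebra_simps)
  have sc: "star c = c" by (simp add: c_def star_scaleR star_add sk)
  have "c * c = s *\<^sub>R (((1 / (2 * s)) *\<^sub>R 1 + k) * ((1 / (2 * s)) *\<^sub>R 1 + k))"
    using s by (simp add: c_def)
  also have "\<dots> = ?e + (1 / (4 * s)) *\<^sub>R 1"
    using s by (simp add: algebra_simps flip: scaleR_add_left)
  finally have cc: "c * c = ?e + (1 / (4 * s)) *\<^sub>R 1" .
  have "c * c + d * d = (norm ?e + 1 / (4 * s)) *\<^sub>R 1"
    unfolding cc d(2) by (simp add: scaleR_add_left)
  then have "(norm c)\<^sup>2 \<le> norm ((norm ?e + 1 / (4 * s)) *\<^sub>R (1::'a))"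
    using norm_square_le_sum_squares[OF sc positive_star[OF d(1)] cd] by simp
  also have "\<dots> \<le> norm k + 1 / (4 * s)" using e s by (simp add: abs_of_nonneg)
  finally have "s * (norm ((1 / (2 * s)) *\<^sub>R 1 + k))\<^sup>2 \<le> norm k + 1 / (4 * s)"
    using s by (simp add: c_def power_mult_distrib)
  moreover have "s * (1 / (2 * s) + norm k)\<^sup>2 \<le> s * (norm ((1 / (2 * s)) *\<^sub>R 1 + k))\<^sup>2"
    using s norm_add_scalar_ge[OF pk, of "1 / (2 * s)"] by (intro mult_left_mono power_mono) auto
  moreover have "s * (1 / (2 * s) + norm k)\<^sup>2 = norm k + 1 / (4 * s) + s * (norm k)\<^sup>2"
    using s by (simp add: power2_eq_square field_simps)
  ultimately have "s * (norm k)\<^sup>2 \<le> 0" by linarith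
  then have "norm k = 0" using s by (simp add: mult_le_0_iff)
  then show ?thesis
    using cstar_identity[of "star z"] by (simp add: k_def star_star)
qed

text \<open>Here \<open>m\<close> is the modulus of \<open>c = star x * x\<close>, and
  \<open>?e = m - c\<close> is twice the negative part of \<open>c\<close>. The previous lemma kills
  \<open>x * ?e\<close>, because \<open>star (x * ?e) * (x * ?e) = - (q * ?e)\<^sup>2\<close> with
  \<open>q\<close> the root of \<open>m\<close>. Then \<open>c * ?e = 0\<close>, so
  \<open>?e\<^sup>2 = - 2 c * ?e\<close> vanishes and \<open>c = m\<close>.\<close>

lemma positive_star_mult: "positive (star x * x :: 'a::cstar_algebra_1)"
proof -
  define c where "c = star x * x"
  have sc: "star c = c" by (simp add: c_def star_mult star_star)
  obtain m where m: "positive m" "m * m = c * c" and cm: "c * m = m * c"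
    using ex_positive_sqrt[OF positive_square[OF sc]] by (metis mult.assoc)
  obtain q where q: "positive q" "q * q = m" and qc: "c * q = q * c" and qm: "m * q = q * m"
    using ex_positive_sqrt[OF m(1)] cm by metis
  have sm: "star m = m" and sq: "star q = q" using m q positive_star by blast+
  let ?e = "m - c"
  have ee: "?e * ?e = 2 *\<^sub>R (m * ?e)" by (simp add: algebra_simps m(2) cm scaleR_2)
  have ce: "c * ?e = - (m * ?e)" by (simp add: algebra_simps m(2) cm)
  have comm: "c * ?e = ?e * c" "m * ?e = ?e * m" "q * ?e = ?e * q"
    by (simp_all add: algebra_simps cm qc qm)
  have "star (x * ?e) * (x * ?e) = star ?e * c * ?e"
    by (simp add: star_mult c_def mult.assoc)
  also have "\<dots> = ?e * c * ?e"
    by (simp add: star_diff sm sc)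
  also have "\<dots> = - ((q * ?e) * (q * ?e))"
    by (metis ce comm minus_mult_left mult.assoc q(2))
  finally have *: "star (x * ?e) * (x * ?e) = - ((q * ?e) * (q * ?e))" .
  moreover have "star (q * ?e) = q * ?e" by (simp add: star_mult star_diff sm sc sq comm)
  ultimately have "x * ?e = 0" by (rule neg_star_mult_square_imp_zero)
  then have "c * ?e = 0" by (simp add: c_def mult.assoc)
  then have "?e * ?e = 0" using ce ee by simp
  moreover have "star ?e = ?e" by (simp add: star_diff sm sc)
  ultimately have "?e = 0" by (metis norm_eq_zero norm_square_selfadjoint norm_zero power_eq_0_iff)
  then show ?thesis using m(1) by (simp add: c_def)
qed

section \<open>The Hahn-Banach theorem\<close>

definition sublinear :: "('v::real_vector \<Rightarrow> real) \<Rightarrow> bool" where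
  "sublinear p \<longleftrightarrow> (\<forall>x y. p (x + y) \<le> p x + p y) \<and> (\<forall>t>0. \<forall>x. p (t *\<^sub>R x) = t * p x)"

lemma sublinearI:
  assumes "\<And>x y. p (x + y) \<le> p x + p y" and "\<And>t x. t > 0 \<Longrightarrow> p (t *\<^sub>R x) \<le> t * p x"
  shows "sublinear p"
proof -
  have "p (t *\<^sub>R x) = t * p x" if "t > 0" for t x
    using assms(2)[of t x] assms(2)[of "inverse t" "t *\<^sub>R x"] that by (simp add: field_simps)
  then show ?thesis using assms(1) by (simp add: sublinear_def)
qed

lemma sublinear_add: "sublinear p \<Longrightarrow> p (x + y) \<le> p x + p y"
  by (simp add: sublinear_def)

lemma sublinear_scaleR: "sublinear p \<Longrightarrow> t > 0 \<Longrightarrow> p (t *\<^sub>R x) = t * p x"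
  by (simp add: sublinear_def)

lemma sublinear_zero: "sublinear p \<Longrightarrow> p 0 = 0"
  using sublinear_scaleR[of p 2 0] by simp

lemma sublinear_ge: "sublinear p \<Longrightarrow> - p (- x) \<le> p x"
  using sublinear_add[of p x "- x"] by (simp add: sublinear_zero)

text \<open>One criterion for every infimum taken below: over shifts of a functional, over chains in
  Zorn's lemma, and over diagonals and lists of vectors for the dominating functional.\<close>

lemma sublinear_Inf:
  fixes S :: "'v::real_vector \<Rightarrow> real set"
  assumes ne: "\<And>x. S x \<noteq> {}"
    and bdd: "\<And>x. bdd_below (S x)"
    and add: "\<And>a b x y. a \<in> S x \<Longrightarrow> b \<in> S y \<Longrightarrow> \<exists>c\<in>S (x + y). c \<le> a + b"
    and scale: "\<And>a t x. a \<in> S x \<Longrightarrow> t > 0 \<Longrightarrow> \<exists>c\<in>S (t *\<^sub>R x). c \<le> t * a"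
  shows "sublinear (\<lambda>x. Inf (S x))"
proof (rule sublinearI)
  have le: "Inf (S x) \<le> a" if "a \<in> S x" for a x by (rule cInf_lower[OF that bdd])
  fix x y
  have "Inf (S (x + y)) - b \<le> a" if "a \<in> S x" "b \<in> S y" for a b
    using add[OF that] le[of _ "x + y"] by fastforce
  then have "Inf (S (x + y)) - b \<le> Inf (S x)" if "b \<in> S y" for b
    using that ne by (auto intro!: cInf_greatest)
  then have "Inf (S (x + y)) - Inf (S x) \<le> b" if "b \<in> S y" for b
    using that by fastforce
  then have "Inf (S (x + y)) - Inf (S x) \<le> Inf (S y)"
    using ne by (auto intro!: cInf_greatest)
  then show "Inf (S (x + y)) \<le> Inf (S x) + Inf (S y)" by simp
next
  have le: "Inf (S x) \<le> a" if "a \<in> S x" for a x by (rule cInf_lower[OF that bdd])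
  fix t :: real and x assume t: "t > 0"
  have "Inf (S (t *\<^sub>R x)) / t \<le> a" if a: "a \<in> S x" for a
  proof -
    obtain c where c: "c \<in> S (t *\<^sub>R x)" "c \<le> t * a" using scale[OF a t] by blast
    then have "Inf (S (t *\<^sub>R x)) \<le> t * a" using le[OF c(1)] by linarith
    then show ?thesis using t by (simp add: field_simps)
  qed
  then have "Inf (S (t *\<^sub>R x)) / t \<le> Inf (S x)"
    using ne by (auto intro!: cInf_greatest)
  then show "Inf (S (t *\<^sub>R x)) \<le> t * Inf (S x)" using t by (simp add: field_simps)
qed

lemma sublinear_INF:
  fixes q :: "'i \<Rightarrow> 'v::real_vector \<Rightarrow> real"
  assumes ne: "I \<noteq> {}"
    and bdd: "\<And>x. bdd_below ((\<lambda>i. q i x) ` I)"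
    and add: "\<And>i j x y. i \<in> I \<Longrightarrow> j \<in> I \<Longrightarrow> \<exists>k\<in>I. q k (x + y) \<le> q i x + q j y"
    and scale: "\<And>i t x. i \<in> I \<Longrightarrow> t > 0 \<Longrightarrow> \<exists>k\<in>I. q k (t *\<^sub>R x) \<le> t * q i x"
  shows "sublinear (\<lambda>x. INF i\<in>I. q i x)"
  using assms by (intro sublinear_Inf) auto

text \<open>Take the infimum over \<open>t \<ge> 0\<close> of \<open>q (x + t a) - t q a\<close>. A
  minimal sublinear functional must therefore satisfy \<open>f (- a) \<le> - f a\<close> for every
  \<open>a\<close>, which makes it linear.\<close>

lemma ex_sublinear_below:
  assumes q: "sublinear q"
  obtains r where "sublinear r" "\<And>x. r x \<le> q x" "r (- a) \<le> - q a"
proof -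
  define h where "h t x = q (x + t *\<^sub>R a) - t * q a" for t x
  define r where "r x = (INF t\<in>{0..}. h t x)" for x
  have lower: "- q (- x) \<le> h t x" if "t \<ge> 0" for t x
  proof (cases "t = 0")
    case False
    then have "t * q a \<le> q (x + t *\<^sub>R a) + q (- x)"
      using sublinear_add[OF q, of "x + t *\<^sub>R a" "- x"] sublinear_scaleR[OF q, of t a] that by simp
    then show ?thesis by (simp add: h_def)
  qed (use sublinear_ge[OF q] in \<open>simp add: h_def\<close>)
  have bdd: "bdd_below ((\<lambda>t. h t x) ` {0..})" for x
    using lower by (auto intro!: bdd_belowI)
  have le: "r x \<le> h t x" if "t \<ge> 0" for t x
    unfolding r_def using that by (intro cINF_lower bdd) auto
  have "sublinear (\<lambda>x. INF t\<in>{0..}. h t x)"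
  proof (rule sublinear_INF[OF _ bdd])
    fix s t :: real and x y assume "s \<in> {0..}" "t \<in> {0..}"
    then show "\<exists>k\<in>{0..}. h k (x + y) \<le> h s x + h t y"
      using sublinear_add[OF q, of "x + s *\<^sub>R a" "y + t *\<^sub>R a"]
      by (intro bexI[of _ "s + t"]) (auto simp: h_def algebra_simps)
  next
    fix s t :: real and x assume "s \<in> {0..}" "t > 0"
    then show "\<exists>k\<in>{0..}. h k (t *\<^sub>R x) \<le> t * h s x"
      using sublinear_scaleR[OF q, of t "x + s *\<^sub>R a"]
      by (intro bexI[of _ "t * s"]) (auto simp: h_def algebra_simps)
  qed simp
  then have "sublinear r" by (simp add: r_def[abs_def])
  moreover have "r x \<le> q x" for x using le[of 0 x] by (simp add: h_def)
  moreover have "r (- a) \<le> - q a" using le[of 1 "- a"] by (simp add: h_def sublinear_zero[OF q])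
  ultimately show ?thesis using that by blast
qed

theorem Hahn_Banach_sublinear:
  fixes p :: "'v::real_vector \<Rightarrow> real"
  assumes p: "sublinear p"
  obtains f where "linear f" "\<And>x. f x \<le> p x" "f a = p a"
proof -
  \<comment> \<open>The value at \<open>a\<close> is fixed before minimizing: a linear
    \<open>f\<close> below \<open>p'\<close> satisfies both \<open>f a \<le> p a\<close> and
    \<open>- f a \<le> - p a\<close>.\<close>
  obtain p' where p': "sublinear p'" "\<And>x. p' x \<le> p x" "p' (- a) \<le> - p a"
    using ex_sublinear_below[OF p] by blast
  define A where "A = {q. sublinear q \<and> (\<forall>x. q x \<le> p' x)}"
  define P where "P = (\<lambda>q r :: 'v \<Rightarrow> real. \<forall>x. r x \<le> q x)"
  have "\<exists>m\<in>A. \<forall>q\<in>A. P m q \<longrightarrow> q = m"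
  proof (rule predicate_Zorn)
    show "partial_order_on A (relation_of P A)"
      by (rule partial_order_on_relation_ofI) (auto simp: P_def fun_eq_iff intro: order_trans antisym)
  next
    fix C assume C: "C \<in> Chains (relation_of P A)"
    then have CA: "C \<subseteq> A" and chain: "\<And>q r. q \<in> C \<Longrightarrow> r \<in> C \<Longrightarrow> P q r \<or> P r q"
      by (auto simp: Chains_def relation_of_def)
    show "\<exists>u\<in>A. \<forall>q\<in>C. P q u"
    proof (cases "C = {}")
      case True
      then show ?thesis using p' by (auto simp: A_def)
    next
      case False
      have bdd: "bdd_below ((\<lambda>q. q x) ` C)" for x
      proof (rule bdd_belowI[of _ "- p' (- x)"])
        fix y assume "y \<in> (\<lambda>q. q x) ` C"
        then obtain q where "q \<in> A" "y = q x" using CA by auto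
        then show "- p' (- x) \<le> y" using sublinear_ge[of q x]
          by (auto simp: A_def intro: order_trans[of _ "- q (- x)"])
      qed
      have "sublinear (\<lambda>x. INF q\<in>C. q x)"
      proof (rule sublinear_INF[OF False bdd])
        fix q r x y assume "q \<in> C" "r \<in> C"
        then obtain s where s: "s \<in> C" "s x \<le> q x" "s y \<le> r y"
          using chain[of q r] by (auto simp: P_def)
        then show "\<exists>s\<in>C. s (x + y) \<le> q x + r y"
          using CA sublinear_add[of s x y] by (intro bexI[of _ s]) (auto simp: A_def)
      next
        fix q t x assume "q \<in> C" "(t::real) > 0"
        then show "\<exists>s\<in>C. s (t *\<^sub>R x) \<le> t * q x"
          using CA sublinear_scaleR[of q t x] by (intro bexI[of _ q]) (auto simp: A_def)
      qed
      moreover have le: "(INF q\<in>C. q x) \<le> q x" if "q \<in> C" for q x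
        by (rule cINF_lower[OF bdd that])
      moreover have "(INF q\<in>C. q x) \<le> p' x" for x
      proof -
        obtain q where q: "q \<in> C" using False by blast
        then have "q x \<le> p' x" using CA by (auto simp: A_def)
        with le[OF q, of x] show ?thesis by linarith
      qed
      ultimately show ?thesis
        by (intro bexI[of _ "\<lambda>x. INF q\<in>C. q x"]) (auto simp: A_def P_def)
    qed
  qed
  then obtain f where fA: "f \<in> A" and max: "\<And>q. q \<in> A \<Longrightarrow> P f q \<Longrightarrow> q = f" by blast
  have f: "sublinear f" "\<And>x. f x \<le> p' x" using fA by (auto simp: A_def)
  have min: "q = f" if "sublinear q" "\<And>x. q x \<le> f x" for q
  proof (rule max)
    show "q \<in> A" using that f(2) by (auto simp: A_def intro: order_trans)
    show "P f q" using that by (simp add: P_def)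
  qed
  have neg: "f (- x) = - f x" for x
  proof -
    obtain r where r: "sublinear r" "\<And>y. r y \<le> f y" "r (- x) \<le> - f x"
      using ex_sublinear_below[OF f(1)] by blast
    have "r = f" by (rule min) (use r in auto)
    then have "f (- x) \<le> - f x" using r(3) by simp
    then show ?thesis using sublinear_ge[OF f(1), of x] by simp
  qed
  have "linear f"
  proof (rule linearI)
    fix x y
    have "f (- x + - y) \<le> f (- x) + f (- y)" by (rule sublinear_add[OF f(1)])
    then show "f (x + y) = f x + f y"
      using sublinear_add[OF f(1), of x y] neg[of "x + y"] by (simp add: neg)
  next
    fix t :: real and x
    consider "t > 0" | "t = 0" | "t < 0" by linarith
    then show "f (t *\<^sub>R x) = t *\<^sub>R f x"
    proof cases
      case 3
      then show ?thesis using sublinear_scaleR[OF f(1), of "- t" "x"] neg[of "t *\<^sub>R x"] by simp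
    qed (use f(1) sublinear_scaleR sublinear_zero in auto)
  qed
  moreover have "f x \<le> p x" for x using f(2) p'(2) order_trans by blast
  moreover have "f a = p a"
    using f(2)[of "- a"] p'(3) neg[of a] calculation(2)[of a] by simp
  ultimately show ?thesis using that by blast
qed

section \<open>Semi-inner products\<close>

locale semi_inner =
  fixes B :: "'v::real_vector \<Rightarrow> 'v \<Rightarrow> real"
  assumes linear_left: "linear (\<lambda>x. B x y)"
    and sym: "B x y = B y x"
    and nonneg: "0 \<le> B x x"
begin

lemma linear_right: "linear (B x)"
proof -
  have "B x = (\<lambda>y. B y x)" by (rule ext) (rule sym)
  then show ?thesis using linear_left[of x] by simp
qed

lemmas add_left = linear_add[OF linear_left] and add_right = linear_add[OF linear_right]
  and diff_left = linear_diff[OF linear_left] and diff_right = linear_diff[OF linear_right]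
  and scale_left = linear_scale[OF linear_left] and scale_right = linear_scale[OF linear_right]

lemma square_add_scale: "B (x + t *\<^sub>R y) (x + t *\<^sub>R y) = B x x + 2 * t * B x y + t\<^sup>2 * B y y"
  by (simp add: add_left add_right scale_left scale_right sym[of y x] power2_eq_square algebra_simps)

lemma Cauchy_Schwarz_square: "(B x y)\<^sup>2 \<le> B x x * B y y"
proof (cases "B y y = 0")
  case True
  have "B x y = 0"
  proof (rule ccontr)
    assume ne: "B x y \<noteq> 0"
    have "0 \<le> B x x + 2 * t * B x y" for t
      using nonneg[of "x + t *\<^sub>R y"] by (simp add: square_add_scale True)
    from this[of "- (B x x + 1) / (2 * B x y)"] show False using ne by (simp add: field_simps)
  qed
  then show ?thesis by (simp add: True)
next
  case False
  then have pos: "B y y > 0" using nonneg[of y] by simp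
  have "0 \<le> B x x + 2 * (- B x y / B y y) * B x y + (- B x y / B y y)\<^sup>2 * B y y"
    using nonneg[of "x + (- B x y / B y y) *\<^sub>R y"] by (simp only: square_add_scale)
  then have "0 \<le> B x x - (B x y)\<^sup>2 / B y y"
    using False by (simp add: power2_eq_square field_simps)
  then show ?thesis using pos by (simp add: field_simps)
qed

definition sn :: "'v \<Rightarrow> real" where "sn x = sqrt (B x x)"

lemma sn_nonneg [simp]: "0 \<le> sn x" by (simp add: sn_def nonneg)

lemma sn_square: "(sn x)\<^sup>2 = B x x" by (simp add: sn_def nonneg)

lemma Cauchy_Schwarz: "\<bar>B x y\<bar> \<le> sn x * sn y"
  using real_sqrt_le_mono[OF Cauchy_Schwarz_square[of x y]] by (simp add: sn_def real_sqrt_mult)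

lemma sn_scaleR: "sn (t *\<^sub>R x) = \<bar>t\<bar> * sn x"
  by (simp add: sn_def scale_left scale_right real_sqrt_mult)

lemma sn_triangle: "sn (x + y) \<le> sn x + sn y"
proof (rule power2_le_imp_le)
  have "(sn (x + y))\<^sup>2 = (sn x)\<^sup>2 + 2 * B x y + (sn y)\<^sup>2"
    using square_add_scale[of x 1 y] by (simp add: sn_square)
  also have "\<dots> \<le> (sn x + sn y)\<^sup>2"
    using Cauchy_Schwarz[of x y] by (simp add: power2_sum)
  finally show "(sn (x + y))\<^sup>2 \<le> (sn x + sn y)\<^sup>2" .
qed simp

lemma parallelogram: "B (x + y) (x + y) + B (x - y) (x - y) = 2 * B x x + 2 * B y y"
  by (simp add: add_left add_right diff_left diff_right)

end

section \<open>Positive functionals\<close>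

text \<open>Real-linear functionals suffice: they are the real parts of the complex positive ones.\<close>

definition pos_functional :: "('b::cstar_algebra_1 \<Rightarrow> real) \<Rightarrow> bool" where
  "pos_functional f \<longleftrightarrow> linear f \<and> (\<forall>x. f (star x) = f x) \<and> (\<forall>x. 0 \<le> f (star x * x))"

lemma pos_functional_linear: "pos_functional f \<Longrightarrow> linear f"
  by (simp add: pos_functional_def)

text \<open>\<open>p x\<close> is the top of the spectrum of the real part of \<open>x\<close>. A
  linear \<open>f\<close> below \<open>p\<close> is positive since
  \<open>p (- star x * x) \<le> 0\<close>, invariant under \<open>star\<close> since
  \<open>p\<close> sees only real parts, and normalized since \<open>p 1 \<le> 1\<close> and
  \<open>p (- 1) \<le> - 1\<close>. Hahn-Banach makes \<open>f\<close> touch \<open>p\<close> at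
  \<open>star a * a\<close>, where \<open>norm_add_scalar_ge\<close> bounds \<open>p\<close> from
  below.\<close>

theorem ex_norming_pos_functional:
  fixes a :: "'b::cstar_algebra_1"
  obtains f where "pos_functional f" "f 1 = 1" "(norm a)\<^sup>2 \<le> f (star a * a)"
proof -
  define re where "re x = (1/2) *\<^sub>R (x + star x)" for x :: 'b
  define h where "h t x = norm (t *\<^sub>R 1 + re x) - t" for t x
  define p where "p x = (INF t\<in>{0..}. h t x)" for x
  have lower: "- norm (re x) \<le> h t x" if "t \<ge> 0" for t x
    using norm_diff_ineq[of "t *\<^sub>R 1" "re x"] that by (simp add: h_def)
  have bdd: "bdd_below ((\<lambda>t. h t x) ` {0..})" for x
    using lower by (auto intro!: bdd_belowI)
  have le: "p x \<le> h t x" if "t \<ge> 0" for t x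
    unfolding p_def using that by (intro cINF_lower bdd) auto
  have re_add: "re (x + y) = re x + re y" for x y
    by (simp add: re_def star_add algebra_simps)
  have re_scale: "re (t *\<^sub>R x) = t *\<^sub>R re x" for t x
    by (simp add: re_def star_scaleR algebra_simps)
  have re_sa: "star x = x \<Longrightarrow> re x = x" for x
    by (simp add: re_def flip: scaleR_2)
  have "sublinear (\<lambda>x. INF t\<in>{0..}. h t x)"
  proof (rule sublinear_INF[OF _ bdd])
    fix s t :: real and x y assume "s \<in> {0..}" "t \<in> {0..}"
    moreover have "norm ((s + t) *\<^sub>R 1 + re (x + y)) \<le> norm (s *\<^sub>R 1 + re x) + norm (t *\<^sub>R 1 + re y)"
      using norm_triangle_ineq[of "s *\<^sub>R 1 + re x" "t *\<^sub>R 1 + re y"]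
      by (simp add: re_add scaleR_add_left algebra_simps)
    ultimately show "\<exists>k\<in>{0..}. h k (x + y) \<le> h s x + h t y"
      by (intro bexI[of _ "s + t"]) (auto simp: h_def)
  next
    fix s t :: real and x assume st: "s \<in> {0..}" "t > 0"
    have "(t * s) *\<^sub>R 1 + re (t *\<^sub>R x) = t *\<^sub>R (s *\<^sub>R 1 + re x)"
      by (simp add: re_scale scaleR_add_right)
    then have "h (t * s) (t *\<^sub>R x) = t * h s x"
      using st by (simp add: h_def right_diff_distrib)
    then show "\<exists>k\<in>{0..}. h k (t *\<^sub>R x) \<le> t * h s x"
      using st by (intro bexI[of _ "t * s"]) auto
  qed simp
  then have "sublinear p" by (simp add: p_def[abs_def])
  then obtain f where f: "linear f" "\<And>x. f x \<le> p x" "f (star a * a) = p (star a * a)"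
    using Hahn_Banach_sublinear by blast
  have sa: "star (star x * x) = star x * x" for x :: 'b by (simp add: star_mult star_star)
  have "0 \<le> f (star x * x)" for x
  proof -
    obtain s where s: "s > 0" "norm (s *\<^sub>R 1 - star x * x) \<le> s"
      using positive_star_mult[of x] by (auto simp: positive_def)
    have "re (- (star x * x)) = - (star x * x)" by (rule re_sa) (simp add: star_minus sa)
    then have "h s (- (star x * x)) \<le> 0" using s by (simp add: h_def)
    then have "f (- (star x * x)) \<le> 0" using f(2) le[of s] s by (meson less_imp_le order_trans)
    then show ?thesis by (simp add: linear_neg[OF f(1)])
  qed
  moreover have "f (star x) = f x" for x
  proof -
    have "f y \<le> 0" if "re y = 0" for y
      using order_trans[OF f(2)[of y] le[of 0 y]] that by (simp add: h_def)
    from this[of "star x - x"] this[of "x - star x"] show ?thesis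
      by (simp add: re_def star_diff star_star linear_diff[OF f(1)])
  qed
  ultimately have "pos_functional f" using f(1) by (simp add: pos_functional_def)
  moreover have "f 1 = 1"
  proof -
    have "f 1 \<le> 1" using order_trans[OF f(2)[of 1] le[of 0 1]] by (simp add: h_def re_sa)
    moreover have "f (- 1) \<le> - 1"
      using order_trans[OF f(2)[of "- 1"] le[of 1 "- 1"]] by (simp add: h_def re_sa star_minus)
    ultimately show ?thesis by (simp add: linear_neg[OF f(1)])
  qed
  moreover have "(norm a)\<^sup>2 \<le> p (star a * a)"
    unfolding p_def
  proof (rule cINF_greatest)
    fix t :: real
    show "(norm a)\<^sup>2 \<le> h t (star a * a)"
      using norm_add_scalar_ge[OF positive_star_mult[of a], of t]
      by (simp add: h_def re_sa sa cstar_identity)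
  qed simp
  ultimately show ?thesis using that f(3) by metis
qed

lemma semi_inner_pos_functional:
  assumes "pos_functional f"
  shows "semi_inner (\<lambda>x y. f (star x * y))"
proof (rule semi_inner.intro)
  have f: "linear f" using assms by (rule pos_functional_linear)
  show "linear (\<lambda>x. f (star x * y))" for y
    by (rule linearI) (simp_all add: star_add star_scaleR distrib_right linear_add[OF f] linear_scale[OF f])
  show "f (star x * y) = f (star y * x)" for x y
    using assms unfolding pos_functional_def by (metis star_mult star_star)
  show "0 \<le> f (star x * x)" for x
    using assms by (simp add: pos_functional_def)
qed

text \<open>For \<open>y = x / norm x\<close> there is \<open>w\<close> with
  \<open>1 - y\<^sup>* y = (1 - w)\<^sup>2\<close>. Conjugating by \<open>b\<close> shows that
  \<open>star b * b\<close> exceeds \<open>star (y * b) * (y * b)\<close> by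
  \<open>star (b - w * b) * (b - w * b)\<close>, on which \<open>f\<close> is nonnegative.\<close>

lemma pos_functional_conj_le:
  fixes x b :: "'b::cstar_algebra_1"
  assumes f: "pos_functional f"
  shows "f (star (x * b) * (x * b)) \<le> (norm x)\<^sup>2 * f (star b * b)"
proof (cases "x = 0")
  case True
  then show ?thesis using linear_0[OF pos_functional_linear[OF f]] by simp
next
  case False
  define y where "y = (1 / norm x) *\<^sub>R x"
  have xy: "x = norm x *\<^sub>R y" using False by (simp add: y_def)
  have "norm (star y * y) \<le> 1" unfolding cstar_identity using False by (simp add: y_def)
  then obtain w where w: "star w = w" "star y * y = 2 *\<^sub>R w - w * w"
    using ex_quasi_sqrt[of "star y * y"] by (metis star_mult star_star)
  have "star (y * b) * (y * b) = star b * (star y * y) * b"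
    by (simp add: star_mult mult.assoc)
  also have "\<dots> = star b * b - star (b - w * b) * (b - w * b)"
    unfolding w(2) by (simp add: star_diff star_mult w(1) algebra_simps scaleR_2)
  finally have "f (star (y * b) * (y * b)) \<le> f (star b * b)"
    using f linear_diff[OF pos_functional_linear[OF f]] by (simp add: pos_functional_def)
  moreover have "star (x * b) * (x * b) = (norm x)\<^sup>2 *\<^sub>R (star (y * b) * (y * b))"
    by (subst (1 2) xy) (simp add: star_mult star_scaleR power2_eq_square)
  ultimately show ?thesis
    by (simp add: linear_scale[OF pos_functional_linear[OF f]] mult_left_mono)
qed

section \<open>The C*-norm on matrices\<close>

text \<open>The norm of the vector \<open>b\<close> in \<open>n\<close> copies of the GNS space of
  \<open>f\<close>, before dividing by null vectors and completing.\<close>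

definition vec_norm :: "('b::cstar_algebra_1 \<Rightarrow> real) \<Rightarrow> nat \<Rightarrow> (nat \<Rightarrow> 'b) \<Rightarrow> real" where
  "vec_norm f n b = L2_set (\<lambda>i. sqrt (f (star (b i) * b i))) {..<n}"

definition mat_vec :: "nat \<Rightarrow> (nat \<Rightarrow> nat \<Rightarrow> 'b::cstar_algebra_1) \<Rightarrow> (nat \<Rightarrow> 'b) \<Rightarrow> nat \<Rightarrow> 'b" where
  "mat_vec n X b = (\<lambda>i. \<Sum>j<n. X i j * b j)"

text \<open>The operator norm of \<open>X\<close> on \<open>n\<close> copies of the GNS space, taken
  over all positive functionals at once. Matrices are functions here, and only indices below
  \<open>n\<close> enter.\<close>

definition mnorm :: "nat \<Rightarrow> (nat \<Rightarrow> nat \<Rightarrow> 'b::cstar_algebra_1) \<Rightarrow> real" where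
  "mnorm n X = Sup {vec_norm f n (mat_vec n X b) | f b. pos_functional f \<and> vec_norm f n b \<le> 1}"

lemma vec_norm_nonneg [simp]: "0 \<le> vec_norm f n b"
  by (simp add: vec_norm_def)

context
  fixes f :: "'b::cstar_algebra_1 \<Rightarrow> real"
  assumes f: "pos_functional f"
begin

interpretation F: semi_inner "\<lambda>x y. f (star x * y)"
  using f by (rule semi_inner_pos_functional)

lemma vec_norm_sn: "vec_norm f n b = L2_set (\<lambda>i. F.sn (b i)) {..<n}"
  by (simp add: vec_norm_def F.sn_def)

lemma sn_mult_le: "F.sn (x * b) \<le> norm x * F.sn b"
  using real_sqrt_le_mono[OF pos_functional_conj_le[OF f, of x b]]
  by (simp add: F.sn_def real_sqrt_mult)

lemma sn_sum_le: "F.sn (sum g A) \<le> (\<Sum>i\<in>A. F.sn (g i))"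
proof (induction A rule: infinite_finite_induct)
  case (insert x A)
  then show ?case using F.sn_triangle[of "g x" "sum g A"] by simp
qed (use F.sn_scaleR[of 0 0] in auto)

lemma sn_scaleC: "F.sn (c *\<^sub>C x) = cmod c * F.sn x"
proof -
  have "star (c *\<^sub>C x) * (c *\<^sub>C x) = (c * cnj c) *\<^sub>C (star x * x)"
    by (simp add: star_scaleC scaleC_mult_left scaleC_mult_right scaleC_scaleC)
  also have "\<dots> = (cmod c)\<^sup>2 *\<^sub>R (star x * x)"
    by (simp only: complex_norm_square[symmetric] scaleC_of_real)
  finally show ?thesis
    by (simp add: F.sn_def linear_scale[OF pos_functional_linear[OF f]] real_sqrt_mult)
qed

lemma vec_norm_triangle: "vec_norm f n (\<lambda>i. b i + c i) \<le> vec_norm f n b + vec_norm f n c"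
proof -
  have "vec_norm f n (\<lambda>i. b i + c i) \<le> L2_set (\<lambda>i. F.sn (b i) + F.sn (c i)) {..<n}"
    unfolding vec_norm_sn by (intro L2_set_mono F.sn_triangle F.sn_nonneg)
  also have "\<dots> \<le> vec_norm f n b + vec_norm f n c"
    unfolding vec_norm_sn by (rule L2_set_triangle_ineq)
  finally show ?thesis .
qed

lemma vec_norm_scaleC: "vec_norm f n (\<lambda>i. c *\<^sub>C b i) = cmod c * vec_norm f n b"
  by (simp add: vec_norm_sn sn_scaleC L2_set_right_distrib)

lemma vec_norm_square: "(vec_norm f n b)\<^sup>2 = (\<Sum>i<n. f (star (b i) * b i))"
  by (simp add: vec_norm_sn L2_set_def F.sn_square sum_nonneg F.nonneg)

lemma vec_norm_Cauchy_Schwarz: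
  "(\<Sum>i<n. f (star (b i) * c i)) \<le> vec_norm f n b * vec_norm f n c"
proof -
  have "(\<Sum>i<n. f (star (b i) * c i)) \<le> (\<Sum>i<n. \<bar>F.sn (b i)\<bar> * \<bar>F.sn (c i)\<bar>)"
    by (intro sum_mono) (use F.Cauchy_Schwarz abs_le_D1 in fastforce)
  also have "\<dots> \<le> vec_norm f n b * vec_norm f n c"
    unfolding vec_norm_sn by (rule L2_set_mult_ineq)
  finally show ?thesis .
qed

lemma vec_norm_mat_vec_le_entries:
  "vec_norm f n (mat_vec n X b) \<le> (\<Sum>i<n. \<Sum>j<n. norm (X i j)) * vec_norm f n b"
proof -
  have "vec_norm f n (mat_vec n X b) \<le> (\<Sum>i<n. F.sn (mat_vec n X b i))"
    unfolding vec_norm_sn by (rule L2_set_le_sum) simp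
  also have "\<dots> \<le> (\<Sum>i<n. \<Sum>j<n. norm (X i j) * vec_norm f n b)"
  proof (rule sum_mono)
    fix i
    have "F.sn (mat_vec n X b i) \<le> (\<Sum>j<n. F.sn (X i j * b j))"
      unfolding mat_vec_def by (rule sn_sum_le)
    also have "\<dots> \<le> (\<Sum>j<n. norm (X i j) * vec_norm f n b)"
    proof (rule sum_mono)
      fix j assume "j \<in> {..<n}"
      then have "F.sn (b j) \<le> vec_norm f n b"
        unfolding vec_norm_sn by (intro member_le_L2_set) auto
      then show "F.sn (X i j * b j) \<le> norm (X i j) * vec_norm f n b"
        by (intro order_trans[OF sn_mult_le mult_left_mono]) auto
    qed
    finally show "F.sn (mat_vec n X b i) \<le> (\<Sum>j<n. norm (X i j) * vec_norm f n b)" .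
  qed
  finally show ?thesis by (simp add: sum_distrib_right)
qed

lemma mat_vec_adjoint:
  "(\<Sum>i<n. f (star (mat_vec n X b i) * c i)) = (\<Sum>j<n. f (star (b j) * mat_vec n (\<lambda>i j. star (X j i)) c j))"
proof -
  have "(\<Sum>i<n. f (star (mat_vec n X b i) * c i)) = (\<Sum>i<n. \<Sum>j<n. f (star (b j) * star (X i j) * c i))"
    by (simp add: mat_vec_def star_sum sum_distrib_right star_mult linear_sum[OF pos_functional_linear[OF f]])
  also have "\<dots> = (\<Sum>j<n. \<Sum>i<n. f (star (b j) * star (X i j) * c i))"
    by (rule sum.swap)
  also have "\<dots> = (\<Sum>j<n. f (star (b j) * mat_vec n (\<lambda>i j. star (X j i)) c j))"
    by (simp add: mat_vec_def sum_distrib_left linear_sum[OF pos_functional_linear[OF f]] mult.assoc)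
  finally show ?thesis .
qed

end

lemma pos_functional_zero: "pos_functional (\<lambda>_. 0)"
  by (auto simp: pos_functional_def linear_iff)

lemma mnorm_bdd:
  "bdd_above {vec_norm f n (mat_vec n X b) | f b. pos_functional f \<and> vec_norm f n b \<le> 1}"
proof (rule bdd_aboveI)
  fix r assume "r \<in> {vec_norm f n (mat_vec n X b) | f b. pos_functional f \<and> vec_norm f n b \<le> 1}"
  then obtain f b where r: "r = vec_norm f n (mat_vec n X b)" and f: "pos_functional f" and "vec_norm f n b \<le> 1"
    by blast
  then have "(\<Sum>i<n. \<Sum>j<n. norm (X i j)) * vec_norm f n b \<le> (\<Sum>i<n. \<Sum>j<n. norm (X i j)) * 1"
    by (intro mult_left_mono sum_nonneg) auto
  then show "r \<le> (\<Sum>i<n. \<Sum>j<n. norm (X i j))"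
    using vec_norm_mat_vec_le_entries[OF f, of n X b] r by linarith
qed

lemma mnorm_ge: "pos_functional f \<Longrightarrow> vec_norm f n b \<le> 1 \<Longrightarrow> vec_norm f n (mat_vec n X b) \<le> mnorm n X"
  unfolding mnorm_def by (intro cSup_upper mnorm_bdd) blast

lemma mnorm_nonneg: "0 \<le> mnorm n X"
proof -
  have "vec_norm (\<lambda>_. 0) n (\<lambda>_. 0) \<le> (1::real)" by (simp add: vec_norm_def L2_set_def)
  then show ?thesis
    using mnorm_ge[OF pos_functional_zero] vec_norm_nonneg order_trans by blast
qed

lemma vec_norm_mat_vec_le:
  assumes f: "pos_functional f"
  shows "vec_norm f n (mat_vec n X b) \<le> mnorm n X * vec_norm f n b"
proof (cases "vec_norm f n b = 0")
  case True
  \<comment> \<open>A null vector cannot be rescaled to length one; the entrywise bound shows that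
    its image is null too.\<close>
  then show ?thesis using vec_norm_mat_vec_le_entries[OF f, of n X b] by simp
next
  case False
  define r where "r = complex_of_real (inverse (vec_norm f n b))"
  have pos: "vec_norm f n b > 0" using False vec_norm_nonneg[of f n b] by linarith
  have "vec_norm f n (mat_vec n X (\<lambda>i. r *\<^sub>C b i)) \<le> mnorm n X"
    by (rule mnorm_ge[OF f]) (use pos in \<open>simp add: vec_norm_scaleC[OF f] r_def norm_inverse\<close>)
  moreover have "mat_vec n X (\<lambda>i. r *\<^sub>C b i) = (\<lambda>i. r *\<^sub>C mat_vec n X b i)"
    by (simp add: mat_vec_def scaleC_sum_right scaleC_mult_right)
  ultimately show ?thesis
    using pos by (simp add: vec_norm_scaleC[OF f] r_def norm_inverse norm_divide field_simps)
qed

lemma mnorm_le: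
  assumes "K \<ge> 0" and "\<And>f b. pos_functional f \<Longrightarrow> vec_norm f n (mat_vec n X b) \<le> K * vec_norm f n b"
  shows "mnorm n X \<le> K"
  unfolding mnorm_def
proof (rule cSup_least)
  have "vec_norm (\<lambda>_. 0) n (\<lambda>_. 0) \<le> (1::real)" by (simp add: vec_norm_def L2_set_def)
  then show "{vec_norm f n (mat_vec n X b) | f b. pos_functional f \<and> vec_norm f n b \<le> 1} \<noteq> {}"
    using pos_functional_zero by blast
  fix r assume "r \<in> {vec_norm f n (mat_vec n X b) | f b. pos_functional f \<and> vec_norm f n b \<le> 1}"
  then obtain f b where r: "r = vec_norm f n (mat_vec n X b)" "pos_functional f" "vec_norm f n b \<le> 1" by blast
  then show "r \<le> K"
    using assms(2)[of f b] mult_left_mono[OF r(3) assms(1)] by simp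
qed

lemma mnorm_le_entries: "mnorm n X \<le> (\<Sum>i<n. \<Sum>j<n. norm (X i j))"
  by (rule mnorm_le) (auto intro!: sum_nonneg vec_norm_mat_vec_le_entries)

lemma vec_norm_cong: "(\<And>i. i < n \<Longrightarrow> b i = c i) \<Longrightarrow> vec_norm f n b = vec_norm f n c"
  unfolding vec_norm_def by (rule L2_set_cong) auto

lemma mnorm_cong:
  assumes "\<And>i j. i < n \<Longrightarrow> j < n \<Longrightarrow> X i j = Y i j"
  shows "mnorm n X = mnorm n Y"
proof -
  have "vec_norm f n (mat_vec n X b) = vec_norm f n (mat_vec n Y b)" for f b
    by (rule vec_norm_cong) (auto simp: mat_vec_def assms)
  then show ?thesis by (simp add: mnorm_def)
qed

text \<open>Apply \<open>X\<close> to the \<open>j\<close>-th unit vector under a functional that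
  norms \<open>X i j\<close>. With \<open>mnorm_le_entries\<close> this makes \<open>mnorm\<close>
  comparable with the entries up to a factor depending on \<open>n\<close> alone.\<close>

lemma norm_entry_le_mnorm:
  fixes X :: "nat \<Rightarrow> nat \<Rightarrow> 'b::cstar_algebra_1"
  assumes ij: "i < n" "j < n"
  shows "norm (X i j) \<le> mnorm n X"
proof -
  obtain f where f: "pos_functional f" "f 1 = 1" "(norm (X i j))\<^sup>2 \<le> f (star (X i j) * X i j)"
    using ex_norming_pos_functional .
  interpret F: semi_inner "\<lambda>x y. f (star x * y)" using f(1) by (rule semi_inner_pos_functional)
  define e where "e k = (if k = j then 1 else 0 :: 'b)" for k
  have "f (star (e k) * e k) = (if k = j then 1 else 0)" for k
    using linear_0[OF pos_functional_linear[OF f(1)]] f(2) by (simp add: e_def)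
  then have "(vec_norm f n e)\<^sup>2 = 1"
    using ij by (simp add: vec_norm_square[OF f(1)])
  then have e: "vec_norm f n e \<le> 1" by (auto simp: power2_eq_1_iff)
  have "mat_vec n X e i = X i j"
    using ij by (simp add: mat_vec_def e_def if_distrib[of "(*) _"] cong: if_cong)
  then have "norm (X i j) \<le> F.sn (mat_vec n X e i)"
    using real_sqrt_le_mono[OF f(3)] by (simp add: F.sn_def)
  also have "\<dots> \<le> vec_norm f n (mat_vec n X e)"
    unfolding vec_norm_sn[OF f(1)] by (rule member_le_L2_set) (use ij in auto)
  also have "\<dots> \<le> mnorm n X" by (rule mnorm_ge[OF f(1) e])
  finally show ?thesis .
qed

lemma mnorm_add: "mnorm n (\<lambda>i j. X i j + Y i j) \<le> mnorm n X + mnorm n Y"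
proof (rule mnorm_le)
  fix f b assume f: "pos_functional (f :: 'a \<Rightarrow> real)"
  have "mat_vec n (\<lambda>i j. X i j + Y i j) b = (\<lambda>i. mat_vec n X b i + mat_vec n Y b i)"
    by (simp add: mat_vec_def distrib_right sum.distrib)
  then have "vec_norm f n (mat_vec n (\<lambda>i j. X i j + Y i j) b)
      \<le> vec_norm f n (mat_vec n X b) + vec_norm f n (mat_vec n Y b)"
    using vec_norm_triangle[OF f] by simp
  then show "vec_norm f n (mat_vec n (\<lambda>i j. X i j + Y i j) b) \<le> (mnorm n X + mnorm n Y) * vec_norm f n b"
    using vec_norm_mat_vec_le[OF f, of n X b] vec_norm_mat_vec_le[OF f, of n Y b] by (simp add: distrib_right)
qed (simp add: mnorm_nonneg)

lemma mnorm_scaleC_le: "mnorm n (\<lambda>i j. c *\<^sub>C X i j) \<le> cmod c * mnorm n X"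
proof (rule mnorm_le)
  fix f b assume f: "pos_functional (f :: 'a \<Rightarrow> real)"
  have "mat_vec n (\<lambda>i j. c *\<^sub>C X i j) b = (\<lambda>i. c *\<^sub>C mat_vec n X b i)"
    by (simp add: mat_vec_def scaleC_mult_left scaleC_sum_right)
  then show "vec_norm f n (mat_vec n (\<lambda>i j. c *\<^sub>C X i j) b) \<le> cmod c * mnorm n X * vec_norm f n b"
    using vec_norm_mat_vec_le[OF f, of n X b] by (simp add: vec_norm_scaleC[OF f] mult.assoc mult_left_mono)
qed (simp add: mnorm_nonneg)

lemma mnorm_scaleC: "mnorm n (\<lambda>i j. c *\<^sub>C X i j) = cmod c * mnorm n X"
proof (cases "c = 0")
  case True
  then show ?thesis using mnorm_scaleC_le[of n c X] mnorm_nonneg[of n "\<lambda>i j. 0 *\<^sub>C X i j"] by simp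
next
  case False
  then show ?thesis
    using mnorm_scaleC_le[of n c X] mnorm_scaleC_le[of n "inverse c" "\<lambda>i j. c *\<^sub>C X i j"]
    by (simp add: scaleC_scaleC norm_inverse norm_divide field_simps)
qed

lemma mat_vec_mult: "mat_vec n (\<lambda>i j. \<Sum>k<n. X i k * Y k j) b = mat_vec n X (mat_vec n Y b)"
proof
  fix i
  have "mat_vec n (\<lambda>i j. \<Sum>k<n. X i k * Y k j) b i = (\<Sum>j<n. \<Sum>k<n. X i k * (Y k j * b j))"
    by (simp add: mat_vec_def sum_distrib_right mult.assoc)
  also have "\<dots> = (\<Sum>k<n. \<Sum>j<n. X i k * (Y k j * b j))"
    by (rule sum.swap)
  also have "\<dots> = mat_vec n X (mat_vec n Y b) i"
    by (simp add: mat_vec_def sum_distrib_left)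
  finally show "mat_vec n (\<lambda>i j. \<Sum>k<n. X i k * Y k j) b i = mat_vec n X (mat_vec n Y b) i" .
qed

lemma mnorm_mult: "mnorm n (\<lambda>i j. \<Sum>k<n. X i k * Y k j) \<le> mnorm n X * mnorm n Y"
proof (rule mnorm_le)
  fix f b assume f: "pos_functional (f :: 'a \<Rightarrow> real)"
  have "vec_norm f n (mat_vec n X (mat_vec n Y b)) \<le> mnorm n X * (mnorm n Y * vec_norm f n b)"
    by (rule order_trans[OF vec_norm_mat_vec_le[OF f] mult_left_mono[OF vec_norm_mat_vec_le[OF f]]])
      (rule mnorm_nonneg)
  then show "vec_norm f n (mat_vec n (\<lambda>i j. \<Sum>k<n. X i k * Y k j) b) \<le> mnorm n X * mnorm n Y * vec_norm f n b"
    by (simp add: mat_vec_mult mult.assoc)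
qed (simp add: mnorm_nonneg)

lemma mnorm_square_le: "(mnorm n X)\<^sup>2 \<le> mnorm n (\<lambda>i j. \<Sum>k<n. star (X k i) * X k j)"
  (is "_ \<le> ?M")
proof -
  have "mnorm n X \<le> sqrt ?M"
  proof (rule mnorm_le)
    fix f b assume f: "pos_functional (f :: 'a \<Rightarrow> real)"
    have "(vec_norm f n (mat_vec n X b))\<^sup>2
        = (\<Sum>j<n. f (star (b j) * mat_vec n (\<lambda>i j. \<Sum>k<n. star (X k i) * X k j) b j))"
      using mat_vec_mult[of n "\<lambda>i j. star (X j i)" X b]
      by (simp add: vec_norm_square[OF f] mat_vec_adjoint[OF f])
    also have "\<dots> \<le> vec_norm f n b * (?M * vec_norm f n b)"
      by (rule order_trans[OF vec_norm_Cauchy_Schwarz[OF f] mult_left_mono[OF vec_norm_mat_vec_le[OF f]]]) simp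
    finally have "(vec_norm f n (mat_vec n X b))\<^sup>2 \<le> ?M * (vec_norm f n b)\<^sup>2"
      by (simp add: power2_eq_square mult_ac)
    from real_sqrt_le_mono[OF this] show "vec_norm f n (mat_vec n X b) \<le> sqrt ?M * vec_norm f n b"
      by (simp add: real_sqrt_mult)
  qed (simp add: mnorm_nonneg)
  then have "(mnorm n X)\<^sup>2 \<le> (sqrt ?M)\<^sup>2"
    by (intro power_mono mnorm_nonneg)
  then show ?thesis by (simp add: mnorm_nonneg)
qed

lemma mnorm_star_le: "mnorm n X \<le> mnorm n (\<lambda>i j. star (X j i))"
proof (cases "mnorm n X = 0")
  case False
  have "mnorm n X * mnorm n X \<le> mnorm n (\<lambda>i j. star (X j i)) * mnorm n X"
    using mnorm_square_le[of n X] mnorm_mult[of n "\<lambda>i j. star (X j i)" X]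
    by (simp add: power2_eq_square)
  then show ?thesis using False mnorm_nonneg[of n X] by simp
qed (simp add: mnorm_nonneg)

lemma mnorm_cstar: "mnorm n (\<lambda>i j. \<Sum>k<n. star (X k i) * X k j) = (mnorm n X)\<^sup>2"
proof (rule antisym)
  have "mnorm n (\<lambda>i j. star (X j i)) = mnorm n X"
  proof (rule antisym)
    show "mnorm n (\<lambda>i j. star (X j i)) \<le> mnorm n X"
      using mnorm_star_le[of n "\<lambda>i j. star (X j i)"] unfolding star_star .
  qed (rule mnorm_star_le)
  then show "mnorm n (\<lambda>i j. \<Sum>k<n. star (X k i) * X k j) \<le> (mnorm n X)\<^sup>2"
    using mnorm_mult[of n "\<lambda>i j. star (X j i)" X] by (simp add: power2_eq_square)
qed (rule mnorm_square_le)

section \<open>A concrete C*-norm on matrices over an algebra without unit\<close>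

text \<open>The passage to the unitization supplies the norming positive functionals behind
  \<open>mnorm\<close>.\<close>

definition cstar_mat_norm :: "nat \<Rightarrow> 'a::cstar_algebra mat \<Rightarrow> real" where
  "cstar_mat_norm n X = mnorm n (\<lambda>i j. Unitization (X $$ (i, j)) 0)"

lemma Unitization_sum: "Unitization (sum g A) 0 = (\<Sum>i\<in>A. Unitization (g i) (0::complex) :: 'a::cstar_algebra unitization)"
proof -
  have add: "Unitization (x + y) (0::complex) = Unitization x 0 + Unitization y 0" for x y :: 'a
    by (simp add: plus_unitization_def)
  show ?thesis
    by (induction A rule: infinite_finite_induct) (auto simp: add simp flip: zero_unitization_def)
qed

lemma cstar_mat_norm_nonneg: "0 \<le> cstar_mat_norm n X"
  by (simp add: cstar_mat_norm_def mnorm_nonneg)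

lemma norm_entry_le_cstar_mat_norm:
  "i < n \<Longrightarrow> j < n \<Longrightarrow> norm (X $$ (i, j)) \<le> cstar_mat_norm n X"
  using norm_entry_le_mnorm[of i n j "\<lambda>i j. Unitization (X $$ (i, j)) 0"]
  by (simp add: cstar_mat_norm_def)

lemma cstar_mat_norm_le_entries:
  "cstar_mat_norm n X \<le> (\<Sum>i<n. \<Sum>j<n. norm (X $$ (i, j)))"
  using mnorm_le_entries[of n "\<lambda>i j. Unitization (X $$ (i, j)) 0"] by (simp add: cstar_mat_norm_def)

lemma index_mult_mat_sum:
  "X \<in> carrier_mat n n \<Longrightarrow> Y \<in> carrier_mat n n \<Longrightarrow> i < n \<Longrightarrow> j < n
    \<Longrightarrow> (X * Y) $$ (i, j) = (\<Sum>k<n. X $$ (i, k) * Y $$ (k, j))"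
  by (auto simp: scalar_prod_def lessThan_atLeast0)

lemma mat_star_carrier [simp]: "X \<in> carrier_mat n n \<Longrightarrow> mat_star X \<in> carrier_mat n n"
  by (simp add: mat_star_def)

lemma index_mat_star [simp]:
  "X \<in> carrier_mat n n \<Longrightarrow> i < n \<Longrightarrow> j < n \<Longrightarrow> mat_star X $$ (i, j) = star (X $$ (j, i))"
  by (auto simp: mat_star_def)

lemma mat_star_mat_star [simp]: "X \<in> carrier_mat n n \<Longrightarrow> mat_star (mat_star X) = X"
  by (rule eq_matI) (auto simp: mat_star_def star_star)

lemma mat_star_mult:
  assumes "X \<in> carrier_mat n n" "Y \<in> carrier_mat n n"
  shows "mat_star (X * Y) = mat_star Y * mat_star X"
proof (rule eq_matI)
  fix i j assume "i < dim_row (mat_star Y * mat_star X)" "j < dim_col (mat_star Y * mat_star X)"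
  then have ij: "i < n" "j < n" using assms by (auto simp: mat_star_def)
  show "mat_star (X * Y) $$ (i, j) = (mat_star Y * mat_star X) $$ (i, j)"
    using assms ij index_mult_mat_sum[OF assms, of j i]
      index_mult_mat_sum[OF mat_star_carrier[OF assms(2)] mat_star_carrier[OF assms(1)], of i j]
      index_mat_star[OF mult_carrier_mat[OF assms], of i j]
    by (simp add: star_sum star_mult)
qed (use assms in \<open>auto simp: mat_star_def\<close>)

lemma cstar_mat_norm_mult:
  assumes "X \<in> carrier_mat n n" "Y \<in> carrier_mat n n"
  shows "cstar_mat_norm n (X * Y) \<le> cstar_mat_norm n X * cstar_mat_norm n Y"
proof -
  have "cstar_mat_norm n (X * Y)
      = mnorm n (\<lambda>i j. \<Sum>k<n. Unitization (X $$ (i, k)) 0 * Unitization (Y $$ (k, j)) 0)"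
    unfolding cstar_mat_norm_def
    by (rule mnorm_cong) (simp add: index_mult_mat_sum[OF assms] Unitization_sum times_unitization_def
        del: index_mult_mat)
  then show ?thesis using mnorm_mult by (simp add: cstar_mat_norm_def)
qed

lemma cstar_mat_norm_cstar:
  assumes "X \<in> carrier_mat n n"
  shows "cstar_mat_norm n (mat_star X * X) = (cstar_mat_norm n X)\<^sup>2"
proof -
  have "cstar_mat_norm n (mat_star X * X)
      = mnorm n (\<lambda>i j. \<Sum>k<n. star (Unitization (X $$ (k, i)) 0) * Unitization (X $$ (k, j)) 0)"
    unfolding cstar_mat_norm_def
    by (rule mnorm_cong)
      (use assms in \<open>simp add: index_mult_mat_sum[OF mat_star_carrier[OF assms] assms] Unitization_sum
          times_unitization_def star_unitization_def del: index_mult_mat\<close>)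
  then show ?thesis using mnorm_cstar[of n "\<lambda>i j. Unitization (X $$ (i, j)) 0"]
    by (simp add: cstar_mat_norm_def)
qed

theorem is_mat_cstar_norm_cstar_mat_norm:
  "is_mat_cstar_norm n (cstar_mat_norm n :: 'a::cstar_algebra mat \<Rightarrow> real)"
  unfolding is_mat_cstar_norm_def
proof (intro conjI ballI allI impI)
  fix X Y :: "'a mat" and c
  assume X: "X \<in> carrier_mat n n" and Y: "Y \<in> carrier_mat n n"
  show "cstar_mat_norm n (X + Y) \<le> cstar_mat_norm n X + cstar_mat_norm n Y"
  proof -
    have "cstar_mat_norm n (X + Y)
        = mnorm n (\<lambda>i j. Unitization (X $$ (i, j)) 0 + Unitization (Y $$ (i, j)) 0)"
      unfolding cstar_mat_norm_def
      by (rule mnorm_cong) (use X Y in \<open>simp add: plus_unitization_def\<close>)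
    then show ?thesis using mnorm_add by (simp add: cstar_mat_norm_def)
  qed
  show "cstar_mat_norm n (X * Y) \<le> cstar_mat_norm n X * cstar_mat_norm n Y"
    using X Y by (rule cstar_mat_norm_mult)
next
  fix X :: "'a mat" and c
  assume X: "X \<in> carrier_mat n n"
  show "0 \<le> cstar_mat_norm n X" by (simp add: cstar_mat_norm_def mnorm_nonneg)
  show "cstar_mat_norm n X = 0 \<longleftrightarrow> X = 0\<^sub>m n n"
  proof
    assume "cstar_mat_norm n X = 0"
    then have "X $$ (i, j) = 0" if "i < n" "j < n" for i j
      using norm_entry_le_cstar_mat_norm[OF that, of X] by simp
    then show "X = 0\<^sub>m n n" using X by (intro eq_matI) auto
  next
    assume "X = 0\<^sub>m n n"
    then have "cstar_mat_norm n X \<le> 0" using cstar_mat_norm_le_entries[of n X] by simp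
    then show "cstar_mat_norm n X = 0" using mnorm_nonneg[of n "\<lambda>i j. Unitization (X $$ (i, j)) 0"] by (simp add: cstar_mat_norm_def)
  qed
  have "cstar_mat_norm n (map_mat ((*\<^sub>C) c) X) = mnorm n (\<lambda>i j. c *\<^sub>C Unitization (X $$ (i, j)) 0)"
    unfolding cstar_mat_norm_def
    by (rule mnorm_cong) (use X in \<open>simp add: scaleC_unitization_def\<close>)
  then show "cstar_mat_norm n (map_mat ((*\<^sub>C) c) X) = cmod c * cstar_mat_norm n X"
    using mnorm_scaleC by (simp add: cstar_mat_norm_def)
  show "cstar_mat_norm n (mat_star X * X) = (cstar_mat_norm n X)\<^sup>2"
    using X by (rule cstar_mat_norm_cstar)
next
  fix S :: "nat \<Rightarrow> 'a mat"
  assume S: "(\<forall>k. S k \<in> carrier_mat n n) \<and>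
    (\<forall>e>0. \<exists>M. \<forall>k\<ge>M. \<forall>l\<ge>M. cstar_mat_norm n (S k - S l) < e)"
  have idx: "(S k - Y) $$ (i, j) = S k $$ (i, j) - Y $$ (i, j)"
    if "Y \<in> carrier_mat n n" "i < n" "j < n" for k Y i j
    using that by auto
  have "\<exists>x. (\<lambda>k. S k $$ (i, j)) \<longlonglongrightarrow> x" if ij: "i < n" "j < n" for i j
  proof -
    have "Cauchy (\<lambda>k. S k $$ (i, j))"
    proof (rule metric_CauchyI)
      fix e :: real assume "e > 0"
      then obtain M where M: "\<And>k l. k \<ge> M \<Longrightarrow> l \<ge> M \<Longrightarrow> cstar_mat_norm n (S k - S l) < e"
        using S by blast
      have "dist (S k $$ (i, j)) (S l $$ (i, j)) < e" if "k \<ge> M" "l \<ge> M" for k l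
        using norm_entry_le_cstar_mat_norm[OF ij, of "S k - S l"] M[OF that] idx[of "S l" i j k] S ij
        by (simp add: dist_norm del: index_minus_mat)
      then show "\<exists>M. \<forall>m\<ge>M. \<forall>k\<ge>M. dist (S m $$ (i, j)) (S k $$ (i, j)) < e" by blast
    qed
    then show ?thesis using Cauchy_convergent convergent_def by blast
  qed
  then obtain x where x: "\<And>i j. i < n \<Longrightarrow> j < n \<Longrightarrow> (\<lambda>k. S k $$ (i, j)) \<longlonglongrightarrow> x i j" by metis
  define X where "X = mat n n (\<lambda>(i, j). x i j)"
  have X: "X \<in> carrier_mat n n" by (simp add: X_def)
  have "(\<lambda>k. \<Sum>i<n. \<Sum>j<n. norm ((S k - X) $$ (i, j))) \<longlonglongrightarrow> 0"
  proof (intro tendsto_null_sum tendsto_norm_zero)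
    fix i j assume "i \<in> {..<n}" "j \<in> {..<n}"
    then show "(\<lambda>k. (S k - X) $$ (i, j)) \<longlonglongrightarrow> 0"
      using LIM_zero[OF x[of i j]] idx[OF X, of i j] by (simp add: X_def del: index_minus_mat)
  qed
  then have "(\<lambda>k. cstar_mat_norm n (S k - X)) \<longlonglongrightarrow> 0"
    by (rule Lim_null_comparison[rotated])
      (simp add: cstar_mat_norm_nonneg cstar_mat_norm_le_entries)
  then show "\<exists>X\<in>carrier_mat n n. (\<lambda>k. cstar_mat_norm n (S k - X)) \<longlonglongrightarrow> 0" using X by blast
qed

subsection \<open>Comparison of C*-norms\<close>

definition entry_mat :: "nat \<Rightarrow> nat \<Rightarrow> nat \<Rightarrow> 'a::cstar_algebra \<Rightarrow> 'a mat" where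
  "entry_mat n i j x = mat n n (\<lambda>p. if p = (i, j) then x else 0)"

lemma entry_mat_carrier [simp]: "entry_mat n i j x \<in> carrier_mat n n"
  by (simp add: entry_mat_def)

lemma index_entry_mat [simp]:
  "p < n \<Longrightarrow> q < n \<Longrightarrow> entry_mat n i j x $$ (p, q) = (if (p, q) = (i, j) then x else 0)"
  by (simp add: entry_mat_def)

lemma entry_mat_add: "entry_mat n i j (x + y) = entry_mat n i j x + entry_mat n i j y"
  by (rule eq_matI) (auto simp: entry_mat_def)

lemma entry_mat_scaleC: "entry_mat n i j (c *\<^sub>C x) = map_mat ((*\<^sub>C) c) (entry_mat n i j x)"
  by (rule eq_matI) (auto simp: entry_mat_def)

lemma mat_star_entry_mat: "mat_star (entry_mat n i j x) = entry_mat n j i (star x)"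
  by (rule eq_matI) (auto simp: entry_mat_def mat_star_def)

lemma entry_mat_mult:
  assumes "k < n"
  shows "entry_mat n i k x * entry_mat n k j y = entry_mat n i j (x * y)"
proof (rule eq_matI)
  fix p q assume "p < dim_row (entry_mat n i j (x * y))" "q < dim_col (entry_mat n i j (x * y))"
  then have pq: "p < n" "q < n" by (auto simp: entry_mat_def)
  have "(entry_mat n i k x * entry_mat n k j y) $$ (p, q)
      = (\<Sum>l<n. entry_mat n i k x $$ (p, l) * entry_mat n k j y $$ (l, q))"
    by (rule index_mult_mat_sum) (use pq in auto)
  also have "\<dots> = (\<Sum>l<n. if l = k then (if p = i then x else 0) * (if q = j then y else 0) else 0)"
    using pq by (intro sum.cong) auto
  also have "\<dots> = entry_mat n i j (x * y) $$ (p, q)"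
    using pq assms by simp
  finally show "(entry_mat n i k x * entry_mat n k j y) $$ (p, q) = entry_mat n i j (x * y) $$ (p, q)" .
qed (auto simp: entry_mat_def)

text \<open>A factor \<open>K\<close> independent of \<open>k\<close> disappears under
  \<open>2 ^ k\<close>-th roots. Quantities that are squared by squaring a self-adjoint matrix and
  agree up to a constant can thus be compared without the constant.\<close>

lemma le_of_power_two_powers_le:
  fixes a b K :: real
  assumes le: "\<And>k. a ^ (2 ^ k) \<le> K * b ^ (2 ^ k)" and "b \<ge> 0" "K \<ge> 0"
  shows "a \<le> b"
proof (rule ccontr)
  assume "\<not> a \<le> b"
  then have ab: "b < a" by simp
  show False
  proof (cases "b = 0")
    case True
    then show ?thesis using le[of 0] ab by simp
  next
    case False
    then have b: "b > 0" using assms by simp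
    then obtain m where m: "K < (a / b) ^ m" using real_arch_pow[of "a / b" K] ab by auto
    have "(a / b) ^ m \<le> (a / b) ^ (2 ^ m)"
      using ab b by (intro power_increasing less_imp_le[OF less_exp]) auto
    also have "\<dots> \<le> K" using le[of m] b by (simp add: power_divide field_simps)
    finally show False using m by simp
  qed
qed

context
  fixes n :: nat and N :: "'a::cstar_algebra mat \<Rightarrow> real"
  assumes N: "is_mat_cstar_norm n N"
begin

lemma cstar_norm_nonneg: "X \<in> carrier_mat n n \<Longrightarrow> 0 \<le> N X"
  and cstar_norm_add: "X \<in> carrier_mat n n \<Longrightarrow> Y \<in> carrier_mat n n \<Longrightarrow> N (X + Y) \<le> N X + N Y"
  and cstar_norm_scaleC: "X \<in> carrier_mat n n \<Longrightarrow> N (map_mat ((*\<^sub>C) c) X) = cmod c * N X"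
  and cstar_norm_cstar: "X \<in> carrier_mat n n \<Longrightarrow> N (mat_star X * X) = (N X)\<^sup>2"
  and cstar_norm_zero: "N (0\<^sub>m n n) = 0"
  using N by (simp_all add: is_mat_cstar_norm_def)

text \<open>With \<open>v = \<surd>(1 - y\<^sup>2)\<close>, multiplication by the unitaries \<open>y \<plusminus> i v\<close> is isometric for every C*-norm,
  and \<open>y\<close> is their mean.\<close>

lemma cstar_norm_entry_selfadjoint_le_one:
  assumes j: "j < n" and y: "star y = y" "norm y \<le> 1"
  shows "N (entry_mat n j j y) \<le> 1"
proof -
  let ?E = "entry_mat n j j"
  have "norm (y * y) \<le> 1" using y by (simp add: norm_square_selfadjoint power_le_one)
  moreover have "star (y * y) = y * y" by (simp add: star_mult y)
  ultimately obtain w where w: "star w = w" "y * y = 2 *\<^sub>R w - w * w"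
    and comm: "\<And>c. c * (y * y) = (y * y) * c \<Longrightarrow> c * w = w * c"
    using ex_quasi_sqrt by metis
  have yw: "y * w = w * y" by (rule comm) (simp add: mult.assoc)
  then have yw': "y * (w * z) = w * (y * z)" for z by (simp flip: mult.assoc)
  \<comment> \<open>In an algebra without unit neither \<open>1 - w\<close> nor the unitaries exist,
    so both carry a factor \<open>y\<close>: \<open>v\<close> is \<open>y\<close> times the root of
    \<open>1 - y\<^sup>2\<close>, and \<open>u\<close> is \<open>y\<close> times a unitary. Then
    \<open>u\<close> and \<open>star u\<close> have the same \<open>N\<close>-value as
    \<open>y\<close>, and their mean \<open>y\<^sup>2\<close> gives
    \<open>(N y)\<^sup>2 \<le> N y\<close>.\<close>
  define v where "v = y - w * y"
  have sv: "star v = v" by (simp add: v_def star_diff star_mult w y yw)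
  have yv: "y * v = v * y" by (simp add: v_def algebra_simps yw yw')
  then have yv': "y * (v * z) = v * (y * z)" for z by (simp flip: mult.assoc)
  define u where "u = y * y + \<i> *\<^sub>C v"
  have su: "star u = y * y - \<i> *\<^sub>C v"
    by (simp add: u_def star_add star_mult star_scaleC sv y scaleC_minus_left)
  have "v * v = y * (y - 2 *\<^sub>R (w * y) + w * w * y)"
    unfolding v_def scaleR_2 by (simp add: algebra_simps yw yw')
  also have "y - 2 *\<^sub>R (w * y) + w * w * y = y - (2 *\<^sub>R w - w * w) * y"
    by (simp add: algebra_simps)
  also have "\<dots> = y - y * y * y" by (simp only: w(2))
  finally have vv: "v * v = y * y - y * y * y * y" by (simp add: algebra_simps)
  have "star u * u = y * y * (y * y) + v * v + \<i> *\<^sub>C (y * y * v - v * (y * y))"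
    unfolding su unfolding u_def
    by (simp add: algebra_simps scaleC_mult_left scaleC_mult_right scaleC_scaleC
        scaleC_minus_left scaleC_diff_right scaleC_add_right)
  also have "y * y * v = v * (y * y)" by (simp add: mult.assoc yv yv')
  finally have uu: "star u * u = star y * y" by (simp add: vv y mult.assoc)
  have "mat_star (?E u) * ?E u = ?E (star u * u)" "mat_star (?E y) * ?E y = ?E (star y * y)"
    using j by (simp_all add: mat_star_entry_mat entry_mat_mult)
  then have "(N (?E u))\<^sup>2 = (N (?E y))\<^sup>2"
    using uu by (metis cstar_norm_cstar entry_mat_carrier)
  then have Nu: "N (?E u) = N (?E y)" by (simp add: cstar_norm_nonneg power2_eq_iff_nonneg)
  have "u * star u = star u * u"
    unfolding su unfolding u_def
    by (simp add: algebra_simps scaleC_mult_left scaleC_mult_right scaleC_scaleC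
        scaleC_minus_left scaleC_diff_right scaleC_add_right yv yv')
  then have "(N (?E (star u)))\<^sup>2 = (N (?E u))\<^sup>2"
    using j by (metis star_star cstar_norm_cstar entry_mat_carrier entry_mat_mult mat_star_entry_mat)
  then have Nsu: "N (?E (star u)) = N (?E y)" by (simp add: Nu cstar_norm_nonneg power2_eq_iff_nonneg)
  have "2 *\<^sub>C (star y * y) = u + star u"
    unfolding su unfolding u_def using scaleC_of_real[of 2 "y * y"] by (simp add: y scaleR_2)
  then have "2 * N (?E (star y * y)) = N (?E u + ?E (star u))"
    using cstar_norm_scaleC[of "?E (star y * y)" 2] by (simp flip: entry_mat_scaleC entry_mat_add)
  also have "\<dots> \<le> 2 * N (?E y)" using cstar_norm_add[of "?E u" "?E (star u)"] by (simp add: Nu Nsu)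
  finally have "(N (?E y))\<^sup>2 \<le> N (?E y)"
    using j cstar_norm_cstar[of "?E y"] by (simp add: mat_star_entry_mat entry_mat_mult)
  then show ?thesis
    using cstar_norm_nonneg[of "?E y"] by (cases "N (?E y) = 0") (auto simp: power2_eq_square)
qed

text \<open>The C*-identity turns the entry \<open>x\<close> at \<open>(i, j)\<close> into the
  diagonal entry \<open>star x * x\<close>, which becomes a self-adjoint element of norm 1 after
  division by \<open>(norm x)\<^sup>2\<close>.\<close>

lemma cstar_norm_entry_le:
  assumes ij: "i < n" "j < n"
  shows "N (entry_mat n i j x) \<le> norm x"
proof (cases "x = 0")
  case True
  have "entry_mat n i j (0::'a) = 0\<^sub>m n n" by (rule eq_matI) (auto simp: entry_mat_def)
  then show ?thesis using True cstar_norm_zero by simp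
next
  case False
  define y where "y = complex_of_real (inverse ((norm x)\<^sup>2)) *\<^sub>C (star x * x)"
  have "N (entry_mat n j j y) \<le> 1"
    using False ij by (intro cstar_norm_entry_selfadjoint_le_one)
      (auto simp: y_def star_scaleC star_mult star_star norm_scaleC cstar_identity norm_inverse norm_power)
  moreover have "N (entry_mat n j j y) = inverse ((norm x)\<^sup>2) * N (entry_mat n j j (star x * x))"
    unfolding y_def entry_mat_scaleC by (simp add: cstar_norm_scaleC norm_inverse norm_power)
  moreover have "N (entry_mat n j j (star x * x)) = (N (entry_mat n i j x))\<^sup>2"
    using ij by (simp add: mat_star_entry_mat entry_mat_mult flip: cstar_norm_cstar)
  ultimately have "(N (entry_mat n i j x))\<^sup>2 \<le> (norm x)\<^sup>2"
    using False by (simp add: field_simps)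
  then show ?thesis by (rule power2_le_imp_le) simp
qed

lemma cstar_norm_le_entries:
  assumes X: "X \<in> carrier_mat n n"
  shows "N X \<le> (\<Sum>p\<in>{..<n} \<times> {..<n}. norm (X $$ p))"
proof -
  define R where "R S = mat n n (\<lambda>p. if p \<in> S then X $$ p else 0)" for S
  have RC: "R S \<in> carrier_mat n n" for S by (simp add: R_def)
  have "N (R S) \<le> (\<Sum>p\<in>S. norm (X $$ p))" if "finite S" "S \<subseteq> {..<n} \<times> {..<n}" for S
    using that
  proof (induction S)
    case empty
    have "R {} = 0\<^sub>m n n" by (rule eq_matI) (auto simp: R_def)
    then show ?case using cstar_norm_zero by simp
  next
    case (insert p S)
    obtain i j where p: "p = (i, j)" "i < n" "j < n" using insert by auto
    have "R (insert p S) = R S + entry_mat n i j (X $$ (i, j))"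
      by (rule eq_matI) (use insert p in \<open>auto simp: R_def entry_mat_def\<close>)
    then have "N (R (insert p S)) \<le> N (R S) + N (entry_mat n i j (X $$ (i, j)))"
      using cstar_norm_add RC by simp
    then show ?case
      using insert p cstar_norm_entry_le[of i j "X $$ (i, j)"] by simp
  qed
  moreover have "R ({..<n} \<times> {..<n}) = X"
    by (rule eq_matI) (use X in \<open>auto simp: R_def\<close>)
  ultimately show ?thesis by fastforce
qed

end

text \<open>\<open>H k\<close> is \<open>(X\<^sup>* X)\<close> raised to the power
  \<open>2 ^ k\<close>. It is self-adjoint, so both norms of \<open>H k\<close> are exact powers of
  the norms of \<open>X\<close>. Entrywise bounds compare the two norms of \<open>H k\<close> up to
  the factor \<open>n * n\<close>, which is lost in the limit.\<close>

lemma cstar_norm_unique_le: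
  fixes N :: "'a::cstar_algebra mat \<Rightarrow> real"
  assumes N: "is_mat_cstar_norm n N" and X: "X \<in> carrier_mat n n"
  shows "N X \<le> cstar_mat_norm n X"
proof -
  let ?M = "cstar_mat_norm n :: 'a mat \<Rightarrow> real"
  note M = is_mat_cstar_norm_cstar_mat_norm[of n, where 'a='a]
  define H where "H = rec_nat (mat_star X * X) (\<lambda>_ Y. Y * Y)"
  have H: "H 0 = mat_star X * X" "H (Suc k) = H k * H k" for k by (simp_all add: H_def)
  have HC: "H k \<in> carrier_mat n n" for k
    using X by (induction k) (auto simp: H intro!: mult_carrier_mat[of _ n n])
  have Hs: "mat_star (H k) = H k" for k
  proof (induction k)
    case 0
    show ?case using mat_star_mult[OF mat_star_carrier[OF X] X] X by (simp add: H)
  next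
    case (Suc k)
    then show ?case using mat_star_mult[OF HC[of k] HC[of k]] by (simp add: H)
  qed
  have pow: "L (H k) = ((L X)\<^sup>2) ^ (2 ^ k)" if L: "is_mat_cstar_norm n L" for L and k
  proof (induction k)
    case (Suc k)
    then show ?case
      using cstar_norm_cstar[OF L HC[of k]] by (simp add: H Hs power_mult mult.commute flip: power_mult)
  qed (use cstar_norm_cstar[OF L X] in \<open>simp add: H\<close>)
  have "((N X)\<^sup>2) ^ (2 ^ k) \<le> real (n * n) * ((?M X)\<^sup>2) ^ (2 ^ k)" for k
  proof -
    have "N (H k) \<le> (\<Sum>p\<in>{..<n} \<times> {..<n}. norm (H k $$ p))"
      by (rule cstar_norm_le_entries[OF N HC])
    also have "\<dots> \<le> (\<Sum>p\<in>{..<n} \<times> {..<n}. ?M (H k))"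
      by (intro sum_mono) (auto intro: norm_entry_le_cstar_mat_norm)
    finally show ?thesis by (simp add: pow[OF N] pow[OF M] card_cartesian_product)
  qed
  then have "(N X)\<^sup>2 \<le> (?M X)\<^sup>2"
    by (rule le_of_power_two_powers_le) auto
  then show ?thesis by (rule power2_le_imp_le) (rule cstar_mat_norm_nonneg)
qed

lemma is_mat_cstar_norm_mat_cstar_norm:
  "is_mat_cstar_norm n (mat_cstar_norm n :: 'a::cstar_algebra mat \<Rightarrow> real)"
  unfolding mat_cstar_norm_def
  by (rule someI[of "is_mat_cstar_norm n", OF is_mat_cstar_norm_cstar_mat_norm])

lemma mat_cstar_norm_nonneg:
  "X \<in> carrier_mat n n \<Longrightarrow> 0 \<le> mat_cstar_norm n (X :: 'a::cstar_algebra mat)"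
  by (rule cstar_norm_nonneg[OF is_mat_cstar_norm_mat_cstar_norm])

theorem mat_cstar_norm_le_mnorm:
  fixes X :: "'a::cstar_algebra mat"
  assumes "X \<in> carrier_mat n n"
  shows "mat_cstar_norm n X \<le> mnorm n (\<lambda>i j. Unitization (X $$ (i, j)) 0)"
  using cstar_norm_unique_le[OF is_mat_cstar_norm_mat_cstar_norm assms]
  by (simp add: cstar_mat_norm_def)

section \<open>Finitely supported functions\<close>

abbreviation lk :: "('x \<Rightarrow>\<^sub>0 'v::zero) \<Rightarrow> 'x \<Rightarrow> 'v" where "lk \<equiv> Poly_Mapping.lookup"

lemma lookup_scaleR: "lk (r *\<^sub>R w) x = r *\<^sub>R lk w (x::'x)" for w :: "'x \<Rightarrow>\<^sub>0 'v::real_vector"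
proof -
  have "finite {i. r *\<^sub>R lk w i \<noteq> 0}"
    by (rule finite_subset[OF _ finite_keys[of w]]) (auto simp: in_keys_iff)
  then show ?thesis by (simp add: scaleR_poly_mapping_def)
qed

definition lin_ext :: "('x \<Rightarrow> 'v::real_vector \<Rightarrow> 'w::real_vector) \<Rightarrow> ('x \<Rightarrow>\<^sub>0 'v) \<Rightarrow> 'w" where
  "lin_ext g w = (\<Sum>x\<in>Poly_Mapping.keys w. g x (lk w x))"

lemma lin_ext_superset:
  assumes "\<And>x. g x 0 = 0" "finite S" "Poly_Mapping.keys w \<subseteq> S"
  shows "lin_ext g w = (\<Sum>x\<in>S. g x (lk w x))"
  unfolding lin_ext_def using assms by (intro sum.mono_neutral_left) (auto simp: in_keys_iff)

lemma linear_lin_ext: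
  assumes "\<And>x. linear (g x)"
  shows "linear (lin_ext g)"
proof (rule linearI)
  have g0: "g x 0 = 0" for x by (rule linear_0[OF assms])
  show "lin_ext g (v + w) = lin_ext g v + lin_ext g w" for v w
  proof -
    let ?S = "Poly_Mapping.keys v \<union> Poly_Mapping.keys w"
    have "lin_ext g (v + w) = (\<Sum>x\<in>?S. g x (lk (v + w) x))"
      using keys_add[of v w] by (intro lin_ext_superset g0) auto
    also have "\<dots> = (\<Sum>x\<in>?S. g x (lk v x)) + (\<Sum>x\<in>?S. g x (lk w x))"
      by (simp add: lookup_add linear_add[OF assms] sum.distrib)
    also have "\<dots> = lin_ext g v + lin_ext g w"
      by (simp add: lin_ext_superset[of g ?S] g0)
    finally show ?thesis .
  qed
  show "lin_ext g (r *\<^sub>R w) = r *\<^sub>R lin_ext g w" for r w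
  proof -
    have "lin_ext g (r *\<^sub>R w) = (\<Sum>x\<in>Poly_Mapping.keys w. g x (lk (r *\<^sub>R w) x))"
      by (intro lin_ext_superset g0) (auto simp: in_keys_iff lookup_scaleR)
    then show ?thesis
      by (simp add: lookup_scaleR linear_scale[OF assms] scaleR_sum_right lin_ext_def)
  qed
qed

lemma lin_ext_single: "g x 0 = 0 \<Longrightarrow> lin_ext g (Poly_Mapping.single x v) = g x v"
  by (simp add: lin_ext_def)

lemma sum_single_keys: "w = (\<Sum>x\<in>Poly_Mapping.keys w. Poly_Mapping.single x (lk w x))"
  by (rule poly_mapping_eqI) (auto simp: lookup_sum lookup_single in_keys_iff when_def)

section \<open>Matrices indexed by labels and their domination by diagonals\<close>

text \<open>The rank one matrix \<open>u\<^sup>* v\<close> formed from two row vectors.\<close>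

definition gram :: "('x \<Rightarrow>\<^sub>0 'b) \<Rightarrow> ('x \<Rightarrow>\<^sub>0 'b) \<Rightarrow> ('x \<times> 'x \<Rightarrow>\<^sub>0 'b::cstar_algebra_1)" where
  "gram u v = Abs_poly_mapping (\<lambda>p. star (lk u (fst p)) * lk v (snd p))"

lemma keys_gram_finite: "finite {p. star (lk u (fst p)) * lk v (snd p) \<noteq> (0::'b::cstar_algebra_1)}"
  by (rule finite_subset[of _ "Poly_Mapping.keys u \<times> Poly_Mapping.keys v"]) (auto simp: in_keys_iff)

lemma lookup_gram: "lk (gram u v) p = star (lk u (fst p)) * lk v (snd p)"
  by (simp add: gram_def keys_gram_finite)

lemma linear_gram_left: "linear (\<lambda>u. gram u v)"
  by (rule linearI; rule poly_mapping_eqI)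
    (simp_all add: lookup_gram lookup_add lookup_scaleR star_add star_scaleR distrib_right)

definition left_scale :: "'b \<Rightarrow> ('x \<Rightarrow>\<^sub>0 'b) \<Rightarrow> ('x \<Rightarrow>\<^sub>0 'b::cstar_algebra_1)" where
  "left_scale b u = Abs_poly_mapping (\<lambda>x. b * lk u x)"

lemma lookup_left_scale: "lk (left_scale b u) x = b * lk u x"
proof -
  have "finite {x. b * lk u x \<noteq> 0}"
    by (rule finite_subset[OF _ finite_keys[of u]]) (auto simp: in_keys_iff)
  then show ?thesis by (simp add: left_scale_def)
qed

lemma linear_left_scale: "linear (left_scale b)"
  by (rule linearI; rule poly_mapping_eqI)
    (simp_all add: lookup_left_scale lookup_add lookup_scaleR distrib_left)

lemma gram_left_scale: "gram (left_scale b u) v = gram u (left_scale (star b) v)"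
  by (rule poly_mapping_eqI) (simp add: lookup_gram lookup_left_scale star_mult mult.assoc)

definition vec_eval :: "('x \<Rightarrow> 'b) \<Rightarrow> ('x \<Rightarrow>\<^sub>0 'b) \<Rightarrow> 'b::cstar_algebra_1" where
  "vec_eval b = lin_ext (\<lambda>x a. a * b x)"

lemma vec_eval_superset:
  "finite S \<Longrightarrow> Poly_Mapping.keys u \<subseteq> S \<Longrightarrow> vec_eval b u = (\<Sum>x\<in>S. lk u x * b x)"
  unfolding vec_eval_def by (rule lin_ext_superset) auto

lemma vec_eval_left_scale: "vec_eval b (left_scale c u) = c * vec_eval b u"
proof -
  have "vec_eval b (left_scale c u) = (\<Sum>x\<in>Poly_Mapping.keys u. lk (left_scale c u) x * b x)"
    by (rule vec_eval_superset) (auto simp: in_keys_iff lookup_left_scale)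
  then show ?thesis
    by (simp add: vec_eval_superset[of "Poly_Mapping.keys u"] lookup_left_scale sum_distrib_left mult.assoc)
qed

text \<open>\<open>f (b\<^sup>* w b)\<close> for a column \<open>b\<close>. The column may be
  nonzero at all labels, since \<open>w\<close> has finite support.\<close>

definition quad_form :: "('b \<Rightarrow> real) \<Rightarrow> ('x \<Rightarrow> 'b) \<Rightarrow> ('x \<times> 'x \<Rightarrow>\<^sub>0 'b::cstar_algebra_1) \<Rightarrow> real" where
  "quad_form f b = lin_ext (\<lambda>p a. f (star (b (fst p)) * a * b (snd p)))"

lemma linear_quad_form:
  assumes "pos_functional f"
  shows "linear (quad_form f b)"
  unfolding quad_form_def
proof (rule linear_lin_ext)
  note f = pos_functional_linear[OF assms]
  show "linear (\<lambda>a. f (star (b (fst p)) * a * b (snd p)))" for p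
    by (rule linearI) (simp_all add: distrib_left distrib_right linear_add[OF f] linear_scale[OF f])
qed

lemma quad_form_gram:
  assumes f: "pos_functional f"
  shows "quad_form f b (gram u v) = f (star (vec_eval b u) * vec_eval b v)"
proof -
  note fl = pos_functional_linear[OF f]
  let ?U = "Poly_Mapping.keys u" and ?V = "Poly_Mapping.keys v"
  have "quad_form f b (gram u v) = (\<Sum>p\<in>?U \<times> ?V. f (star (b (fst p)) * lk (gram u v) p * b (snd p)))"
    unfolding quad_form_def
    by (rule lin_ext_superset) (auto simp: linear_0[OF fl] in_keys_iff lookup_gram)
  also have "\<dots> = (\<Sum>x\<in>?U. \<Sum>y\<in>?V. f (star (lk u x * b x) * (lk v y * b y)))"
    by (simp add: sum.cartesian_product lookup_gram star_mult mult.assoc split_beta)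
  also have "\<dots> = f (star (vec_eval b u) * vec_eval b v)"
    by (simp add: vec_eval_superset[of ?U] vec_eval_superset[of ?V] star_sum sum_product linear_sum[OF fl])
  finally show ?thesis .
qed

definition diag_form :: "('b::cstar_algebra_1 \<Rightarrow> real) \<Rightarrow> ('x \<Rightarrow> 'b) \<Rightarrow> ('x \<Rightarrow>\<^sub>0 real) \<Rightarrow> real" where
  "diag_form f b = lin_ext (\<lambda>x d. d * f (star (b x) * b x))"

lemma linear_diag_form: "linear (diag_form f b)"
  unfolding diag_form_def by (intro linear_lin_ext linearI) (auto simp: algebra_simps)

text \<open>The upper bound that the functional will obey on \<open>diag D\<close>. The weight
  \<open>(norm x)\<^sup>2\<close> of the label \<open>x\<close> is what gives
  \<open>1 \<otimes> \<xi>\<close> length at most \<open>norm \<xi>\<close>.\<close>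

definition cost :: "('x::real_normed_vector \<Rightarrow>\<^sub>0 real) \<Rightarrow> real" where
  "cost = lin_ext (\<lambda>x d. d * (norm x)\<^sup>2)"

lemma linear_cost: "linear cost"
  unfolding cost_def by (intro linear_lin_ext linearI) (auto simp: algebra_simps)

text \<open>The matrix inequality \<open>w \<le> diag D\<close>.\<close>

definition dominated :: "('x \<times> 'x \<Rightarrow>\<^sub>0 'b::cstar_algebra_1) \<Rightarrow> ('x \<Rightarrow>\<^sub>0 real) \<Rightarrow> bool" where
  "dominated w D \<longleftrightarrow> (\<forall>x. 0 \<le> lk D x) \<and>
     (\<forall>f b. pos_functional f \<longrightarrow> quad_form f b w \<le> diag_form f b D)"

lemma dominated_add:
  assumes "dominated v D" "dominated w E"
  shows "dominated (v + w) (D + E)"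
proof -
  have "quad_form f b (v + w) \<le> diag_form f b (D + E)" if "pos_functional f" for f b
    using assms that unfolding dominated_def
    by (simp add: add_mono linear_add[OF linear_quad_form[OF that]] linear_add[OF linear_diag_form])
  then show ?thesis using assms by (simp add: dominated_def lookup_add)
qed

lemma dominated_scaleR:
  assumes "dominated w D" "t \<ge> 0"
  shows "dominated (t *\<^sub>R w) (t *\<^sub>R D)"
proof -
  have "quad_form f b (t *\<^sub>R w) \<le> diag_form f b (t *\<^sub>R D)" if "pos_functional f" for f b
    using assms that unfolding dominated_def
    by (simp add: mult_left_mono linear_scale[OF linear_quad_form[OF that]] linear_scale[OF linear_diag_form])
  then show ?thesis using assms by (simp add: dominated_def lookup_scaleR)
qed

lemma dominated_zero: "dominated 0 0"
  by (simp add: dominated_def linear_0[OF linear_quad_form] linear_0[OF linear_diag_form])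

lemma diag_form_single: "diag_form f b (Poly_Mapping.single x d) = d * f (star (b x) * b x)"
  unfolding diag_form_def by (rule lin_ext_single) simp

lemma dominated_single:
  "dominated (Poly_Mapping.single (x, y) a) (Poly_Mapping.single x (norm a) + Poly_Mapping.single y (norm a))"
  unfolding dominated_def
proof (intro conjI allI impI)
  show "0 \<le> lk (Poly_Mapping.single x (norm a) + Poly_Mapping.single y (norm a)) z" for z
    by (simp add: lookup_add lookup_single when_def)
next
  fix f b assume f: "pos_functional (f :: 'b \<Rightarrow> real)"
  note fl = pos_functional_linear[OF f]
  interpret F: semi_inner "\<lambda>x y. f (star x * y)" using f by (rule semi_inner_pos_functional)
  have "quad_form f b (Poly_Mapping.single (x, y) a) = f (star (b x) * (a * b y))"
    unfolding quad_form_def by (subst lin_ext_single) (auto simp: linear_0[OF fl] mult.assoc)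
  also have "\<dots> \<le> F.sn (b x) * F.sn (a * b y)"
    using F.Cauchy_Schwarz[of "b x" "a * b y"] by simp
  also have "\<dots> \<le> F.sn (b x) * (norm a * F.sn (b y))"
    by (intro mult_left_mono sn_mult_le[OF f]) simp
  also have "\<dots> = norm a * (F.sn (b x) * F.sn (b y))" by simp
  also have "\<dots> \<le> norm a * ((F.sn (b x))\<^sup>2 + (F.sn (b y))\<^sup>2)"
  proof (rule mult_left_mono)
    show "F.sn (b x) * F.sn (b y) \<le> (F.sn (b x))\<^sup>2 + (F.sn (b y))\<^sup>2"
      using sum_squares_bound[of "F.sn (b x)" "F.sn (b y)"]
        mult_nonneg_nonneg[OF F.sn_nonneg[of "b x"] F.sn_nonneg[of "b y"]] by linarith
  qed simp
  also have "\<dots> = diag_form f b (Poly_Mapping.single x (norm a) + Poly_Mapping.single y (norm a))"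
    by (simp add: linear_add[OF linear_diag_form] diag_form_single F.sn_square distrib_left)
  finally show "quad_form f b (Poly_Mapping.single (x, y) a)
    \<le> diag_form f b (Poly_Mapping.single x (norm a) + Poly_Mapping.single y (norm a))" .
qed

text \<open>Makes the infimum in the next theorem finite: for \<open>w\<close> its set is nonempty,
  and a diagonal dominating \<open>- w\<close> provides a lower bound.\<close>

lemma ex_dominated: "\<exists>D. dominated w D"
proof -
  have "\<exists>D. dominated (\<Sum>p\<in>S. Poly_Mapping.single p (lk w p)) D" if "finite S" for S
    using that
  proof (induction S)
    case empty
    then show ?case using dominated_zero by auto
  next
    case (insert p S)
    then obtain D where D: "dominated (\<Sum>p\<in>S. Poly_Mapping.single p (lk w p)) D" by blast
    have "\<exists>E. dominated (Poly_Mapping.single p (lk w p)) E"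
      using dominated_single[of "fst p" "snd p" "lk w p"] by auto
    then show ?case using dominated_add[OF _ D] insert by auto
  qed
  then show ?thesis using sum_single_keys[of w] by (metis finite_keys)
qed

text \<open>Let \<open>F\<close> be linear and below the infimum of \<open>S\<close>. The empty list
  gives \<open>F w \<le> cost D\<close>; the matrix \<open>- gram u u\<close> with the list
  \<open>[u]\<close> and \<open>D = 0\<close> gives the bound on \<open>Q u\<close>. The hypothesis
  \<open>key\<close> says that \<open>S 0\<close> has no negative element. Lists, not single
  vectors, occur because concatenation is what makes the infimum subadditive.\<close>

theorem ex_dominating_functional:
  fixes Q :: "('x::real_normed_vector \<Rightarrow>\<^sub>0 'b::cstar_algebra_1) \<Rightarrow> 'k::real_normed_vector"
  assumes Q: "linear Q" and K: "K > 0"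
    and key: "\<And>us D. dominated (\<Sum>u\<leftarrow>us. gram u u) D \<Longrightarrow> (\<Sum>u\<leftarrow>us. (norm (Q u))\<^sup>2) \<le> K * cost D"
  obtains F where "linear F" "\<And>u. (norm (Q u))\<^sup>2 \<le> K * F (gram u u)"
    "\<And>w D. dominated w D \<Longrightarrow> F w \<le> cost D"
proof -
  define S where "S w = {cost D - (\<Sum>u\<leftarrow>us. (norm (Q u))\<^sup>2) / K | D us.
    dominated (w + (\<Sum>u\<leftarrow>us. gram u u)) D}" for w
  have SI: "cost D - (\<Sum>u\<leftarrow>us. (norm (Q u))\<^sup>2) / K \<in> S w"
    if "dominated (w + (\<Sum>u\<leftarrow>us. gram u u)) D" for D us w
    using that by (auto simp: S_def)
  have bdd: "bdd_below (S w)" for w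
  proof -
    obtain E where E: "dominated (- w) E" using ex_dominated by blast
    show ?thesis
    proof (rule bdd_belowI[of _ "- cost E"])
      fix r assume "r \<in> S w"
      then obtain D us where r: "r = cost D - (\<Sum>u\<leftarrow>us. (norm (Q u))\<^sup>2) / K"
        and D: "dominated (w + (\<Sum>u\<leftarrow>us. gram u u)) D" by (auto simp: S_def)
      have "dominated (\<Sum>u\<leftarrow>us. gram u u) (D + E)"
        using dominated_add[OF D E] by simp
      from key[OF this] have "(\<Sum>u\<leftarrow>us. (norm (Q u))\<^sup>2) / K \<le> cost D + cost E"
        using K by (simp add: linear_add[OF linear_cost] field_simps)
      then show "- cost E \<le> r" using r by simp
    qed
  qed
  have "sublinear (\<lambda>w. Inf (S w))"
  proof (rule sublinear_Inf[OF _ bdd])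
    fix w :: "'x \<times> 'x \<Rightarrow>\<^sub>0 'b"
    obtain D where "dominated w D" using ex_dominated by blast
    then show "S w \<noteq> {}" using SI[of w "[]" D] by auto
  next
    fix v w r s assume "r \<in> S v" "s \<in> S w"
    then obtain D us E vs where *:
      "r = cost D - (\<Sum>u\<leftarrow>us. (norm (Q u))\<^sup>2) / K" "dominated (v + (\<Sum>u\<leftarrow>us. gram u u)) D"
      "s = cost E - (\<Sum>u\<leftarrow>vs. (norm (Q u))\<^sup>2) / K" "dominated (w + (\<Sum>u\<leftarrow>vs. gram u u)) E"
      by (auto simp: S_def)
    have "dominated (v + w + (\<Sum>u\<leftarrow>us @ vs. gram u u)) (D + E)"
      using dominated_add[OF *(2) *(4)] by (simp add: add_ac)
    from SI[OF this] have "r + s \<in> S (v + w)"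
      unfolding *(1) *(3) by (simp add: linear_add[OF linear_cost] add_divide_distrib algebra_simps)
    then show "\<exists>t\<in>S (v + w). t \<le> r + s" by blast
  next
    fix w r and t :: real assume "r \<in> S w" and t: "t > 0"
    then obtain D us where r: "r = cost D - (\<Sum>u\<leftarrow>us. (norm (Q u))\<^sup>2) / K"
      and D: "dominated (w + (\<Sum>u\<leftarrow>us. gram u u)) D"
      by (auto simp: S_def)
    \<comment> \<open>The root of \<open>t\<close> appears because \<open>gram u u\<close> is
      quadratic in \<open>u\<close>.\<close>
    let ?vs = "map (\<lambda>u. sqrt t *\<^sub>R u) us"
    have gr: "gram (s *\<^sub>R u) (s *\<^sub>R u) = (s * s) *\<^sub>R gram u u" for s u
      by (rule poly_mapping_eqI) (simp add: lookup_gram lookup_scaleR star_scaleR)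
    have "(\<Sum>u\<leftarrow>?vs. gram u u) = t *\<^sub>R (\<Sum>u\<leftarrow>us. gram u u)"
      using t by (induction us) (simp_all add: gr scaleR_add_right)
    moreover have "(\<Sum>u\<leftarrow>?vs. (norm (Q u))\<^sup>2) = t * (\<Sum>u\<leftarrow>us. (norm (Q u))\<^sup>2)"
      using t by (induction us) (simp_all add: linear_scale[OF Q] power_mult_distrib distrib_left)
    ultimately have "t * r \<in> S (t *\<^sub>R w)"
      using dominated_scaleR[OF D, of t] t SI[of "t *\<^sub>R w" ?vs "t *\<^sub>R D"]
      by (simp add: r linear_scale[OF linear_cost] right_diff_distrib scaleR_add_right)
    then show "\<exists>s\<in>S (t *\<^sub>R w). s \<le> t * r" by blast
  qed
  then obtain F where F: "linear F" "\<And>w. F w \<le> Inf (S w)"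
    using Hahn_Banach_sublinear by blast
  have le: "F w \<le> r" if "r \<in> S w" for w r
    using F(2)[of w] cInf_lower[OF that bdd] by linarith
  have "(norm (Q u))\<^sup>2 \<le> K * F (gram u u)" for u
  proof -
    have "F (- gram u u) \<le> - ((norm (Q u))\<^sup>2 / K)"
      using le[OF SI[of "- gram u u" "[u]" 0]] dominated_zero by (simp add: linear_0[OF linear_cost])
    then show ?thesis using K by (simp add: linear_neg[OF F(1)] field_simps)
  qed
  moreover have "F w \<le> cost D" if "dominated w D" for w D
    using le[OF SI[of w "[]" D]] that by simp
  ultimately show ?thesis using that F(1) by blast
qed

section \<open>Orthogonal projection in a semi-inner product space\<close>

text \<open>The sequences below represent, in the completion of \<^typ>\<open>'v\<close>, the component of \<open>e\<close>
  orthogonal to \<open>M\<close>; working with them avoids constructing the completion.\<close>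

context semi_inner
begin

definition ortho_seq :: "'v set \<Rightarrow> 'v \<Rightarrow> (nat \<Rightarrow> 'v) \<Rightarrow> bool" where
  "ortho_seq M e u \<longleftrightarrow> (\<forall>n. u n - e \<in> M) \<and>
     (\<forall>\<epsilon>>0. \<exists>N. \<forall>m\<ge>N. \<forall>n\<ge>N. sn (u m - u n) < \<epsilon>) \<and>
     (\<forall>k\<in>M. (\<lambda>n. B (u n) k) \<longlonglongrightarrow> 0)"

lemma ortho_seq_Cauchy:
  assumes "ortho_seq M e u" "\<epsilon> > 0"
  obtains N where "\<And>m n. m \<ge> N \<Longrightarrow> n \<ge> N \<Longrightarrow> sn (u m - u n) < \<epsilon>"
  using assms unfolding ortho_seq_def by blast

text \<open>A sequence in \<open>e + M\<close> that minimizes the length. Midpoints stay in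
  \<open>e + M\<close>, so the parallelogram law makes it Cauchy; varying \<open>u n\<close> along
  \<open>h\<close> with the optimal coefficient bounds \<open>(B (u n) h)\<^sup>2\<close> by
  \<open>r n * B h h\<close>. The second conclusion becomes the norm bound on the limit
  operator.\<close>

lemma ex_ortho_seq:
  assumes M: "subspace M"
  obtains u where "ortho_seq M e u" "\<And>n. B (u n) (u n) \<le> B e e + inverse (real (Suc n))"
proof -
  define d where "d = (INF k\<in>M. B (e + k) (e + k))"
  have bdd: "bdd_below ((\<lambda>k. B (e + k) (e + k)) ` M)" by (rule bdd_belowI[of _ 0]) (auto simp: nonneg)
  have ne: "M \<noteq> {}" using subspace_0[OF M] by blast
  have d_le: "d \<le> B (e + k) (e + k)" if "k \<in> M" for k
    unfolding d_def by (rule cINF_lower[OF bdd that])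
  have "\<exists>k\<in>M. B (e + k) (e + k) < d + inverse (real (Suc n))" for n
    unfolding d_def by (subst cINF_less_iff[OF ne bdd, symmetric]) simp
  then obtain k where k: "\<And>n. k n \<in> M" "\<And>n. B (e + k n) (e + k n) < d + inverse (real (Suc n))"
    by metis
  define u where "u n = e + k n" for n
  define r where "r n = inverse (real (Suc n))" for n
  have ur: "B (u n) (u n) < d + r n" for n using k by (simp add: u_def r_def)
  have lim: "r \<longlonglongrightarrow> 0" unfolding r_def by (rule LIMSEQ_inverse_real_of_nat)
  have diff: "(sn (u m - u n))\<^sup>2 \<le> 2 * r m + 2 * r n" for m n
  proof -
    have "(1/2) *\<^sub>R (k m + k n) \<in> M" using M k by (intro subspace_scale subspace_add) auto
    from d_le[OF this] have "4 * d \<le> B (2 *\<^sub>R (e + (1/2) *\<^sub>R (k m + k n))) (2 *\<^sub>R (e + (1/2) *\<^sub>R (k m + k n)))"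
      by (simp add: scale_left scale_right)
    also have "2 *\<^sub>R (e + (1/2) *\<^sub>R (k m + k n)) = u m + u n"
      by (simp add: u_def scaleR_add_right scaleR_2)
    finally show ?thesis using parallelogram[of "u m" "u n"] ur[of m] ur[of n] by (simp add: sn_square)
  qed
  have "\<exists>N. \<forall>m\<ge>N. \<forall>n\<ge>N. sn (u m - u n) < \<epsilon>" if "\<epsilon> > 0" for \<epsilon>
  proof -
    have "\<epsilon>\<^sup>2 / 4 > 0" using that by simp
    then obtain N where "\<forall>n\<ge>N. norm (r n - 0) < \<epsilon>\<^sup>2 / 4"
      using LIMSEQ_D[OF lim] by blast
    then have N: "\<And>n. n \<ge> N \<Longrightarrow> \<bar>r n\<bar> < \<epsilon>\<^sup>2 / 4" by simp
    have "sn (u m - u n) < \<epsilon>" if "m \<ge> N" "n \<ge> N" for m n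
      using diff[of m n] N[OF that(1)] N[OF that(2)] \<open>\<epsilon> > 0\<close>
      by (intro power2_less_imp_less[of _ \<epsilon>]) auto
    then show ?thesis by blast
  qed
  moreover have "(\<lambda>n. B (u n) h) \<longlonglongrightarrow> 0" if h: "h \<in> M" for h
  proof -
    have sq: "(B (u n) h)\<^sup>2 \<le> r n * B h h" for n
    proof (cases "B h h = 0")
      case True
      then show ?thesis using Cauchy_Schwarz_square[of "u n" h] by simp
    next
      case False
      then have pos: "B h h > 0" using nonneg[of h] by simp
      define t where "t = - B (u n) h / B h h"
      have "k n + t *\<^sub>R h \<in> M" using M k h by (intro subspace_scale subspace_add) auto
      from d_le[OF this] have "d \<le> B (u n) (u n) + 2 * t * B (u n) h + t\<^sup>2 * B h h"
        unfolding square_add_scale[symmetric] by (simp add: u_def add.assoc)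
      also have "\<dots> = B (u n) (u n) - (B (u n) h)\<^sup>2 / B h h"
        using False by (simp add: t_def power2_eq_square field_simps)
      finally have "(B (u n) h)\<^sup>2 / B h h \<le> r n" using ur[of n] by simp
      then show ?thesis using pos by (simp add: field_simps)
    qed
    have "(\<lambda>n. (B (u n) h)\<^sup>2) \<longlonglongrightarrow> 0"
      by (rule tendsto_sandwich[OF _ _ tendsto_const tendsto_mult_left_zero[OF lim, of "B h h"]])
        (use sq in auto)
    then show ?thesis by simp
  qed
  ultimately have "ortho_seq M e u" using k by (simp add: ortho_seq_def u_def)
  moreover have "B (u n) (u n) \<le> B e e + inverse (real (Suc n))" for n
    using ur[of n] d_le[OF subspace_0[OF M]] by (simp add: r_def)
  ultimately show ?thesis using that by blast
qed

lemma ortho_seq_diff: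
  assumes M: "subspace M" and u: "ortho_seq M e u" and v: "ortho_seq M e' v"
  shows "ortho_seq M (e - e') (\<lambda>n. u n - v n)"
  unfolding ortho_seq_def
proof (intro conjI allI ballI impI)
  show "u n - v n - (e - e') \<in> M" for n
    using subspace_diff[OF M, of "u n - e" "v n - e'"] u v by (simp add: ortho_seq_def algebra_simps)
next
  fix \<epsilon> :: real assume e: "\<epsilon> > 0"
  obtain N where N: "\<And>m n. m \<ge> N \<Longrightarrow> n \<ge> N \<Longrightarrow> sn (u m - u n) < \<epsilon> / 2"
    using ortho_seq_Cauchy[OF u half_gt_zero[OF e]] by blast
  obtain N' where N': "\<And>m n. m \<ge> N' \<Longrightarrow> n \<ge> N' \<Longrightarrow> sn (v m - v n) < \<epsilon> / 2"
    using ortho_seq_Cauchy[OF v half_gt_zero[OF e]] by blast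
  have "sn (u m - v m - (u n - v n)) < \<epsilon>" if "m \<ge> max N N'" "n \<ge> max N N'" for m n
  proof -
    have eq: "u m - v m - (u n - v n) = (u m - u n) + (- 1) *\<^sub>R (v m - v n)" by simp
    have "sn (u m - v m - (u n - v n)) \<le> sn (u m - u n) + sn (v m - v n)"
      unfolding eq using sn_triangle[of "u m - u n" "(- 1) *\<^sub>R (v m - v n)"]
      unfolding sn_scaleR by simp
    then show ?thesis using N[of m n] N'[of m n] that by simp
  qed
  then show "\<exists>N. \<forall>m\<ge>N. \<forall>n\<ge>N. sn (u m - v m - (u n - v n)) < \<epsilon>" by blast
next
  fix k assume "k \<in> M"
  then show "(\<lambda>n. B (u n - v n) k) \<longlonglongrightarrow> 0"
    using u v tendsto_diff[of "\<lambda>n. B (u n) k" 0 sequentially "\<lambda>n. B (v n) k" 0]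
    by (simp add: ortho_seq_def diff_left)
qed

text \<open>Since \<open>e\<close> is in \<open>M\<close>, so are all \<open>u n\<close>, and
  orthogonality may be tested against a fixed \<open>u N1\<close>. In
  \<open>B (u n) (u n) = B (u n) (u n - u N1) + B (u n) (u N1)\<close> the first term is small by
  the Cauchy property and the second by orthogonality.\<close>

lemma ortho_seq_null:
  assumes u: "ortho_seq M e u" and e: "e \<in> M" and M: "subspace M"
  shows "(\<lambda>n. sn (u n)) \<longlonglongrightarrow> 0"
proof (rule LIMSEQ_I)
  have uM: "u n \<in> M" for n
    using subspace_add[OF M _ e, of "u n - e"] u by (simp add: ortho_seq_def)
  obtain N where N: "\<And>m n. m \<ge> N \<Longrightarrow> n \<ge> N \<Longrightarrow> sn (u m - u n) < 1"
    using ortho_seq_Cauchy[OF u, of 1] by auto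
  define R where "R = 1 + sn (u N)"
  have R: "sn (u n) \<le> R" if "n \<ge> N" for n
    using sn_triangle[of "u n - u N" "u N"] N[of n N] that by (simp add: R_def)
  have R0: "R > 0" by (simp add: R_def add_pos_nonneg)
  fix \<epsilon> :: real assume \<epsilon>: "\<epsilon> > 0"
  then have "\<epsilon>\<^sup>2 / (2 * R) > 0" using R0 by simp
  then obtain N1 where N1: "\<And>m n. m \<ge> N1 \<Longrightarrow> n \<ge> N1 \<Longrightarrow> sn (u m - u n) < \<epsilon>\<^sup>2 / (2 * R)"
    using ortho_seq_Cauchy[OF u] by blast
  have "(\<lambda>n. B (u n) (u N1)) \<longlonglongrightarrow> 0" using u uM by (simp add: ortho_seq_def)
  then obtain N2 where N2: "\<And>n. n \<ge> N2 \<Longrightarrow> \<bar>B (u n) (u N1)\<bar> < \<epsilon>\<^sup>2 / 2"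
    using LIMSEQ_D[of _ 0 "\<epsilon>\<^sup>2 / 2"] \<epsilon> by fastforce
  have "sn (u n) < \<epsilon>" if n: "n \<ge> max N (max N1 N2)" for n
  proof (rule power2_less_imp_less)
    have "(sn (u n))\<^sup>2 = B (u n) (u n - u N1) + B (u n) (u N1)" by (simp add: sn_square diff_right)
    also have "B (u n) (u n - u N1) \<le> sn (u n) * sn (u n - u N1)"
      using Cauchy_Schwarz[of "u n" "u n - u N1"] by simp
    also have "\<dots> \<le> R * (\<epsilon>\<^sup>2 / (2 * R))"
      using R[of n] N1[of n N1] n R0 by (intro mult_mono) auto
    finally show "(sn (u n))\<^sup>2 < \<epsilon>\<^sup>2" using N2[of n] n R0 by simp
  qed (use \<epsilon> in simp)
  then show "\<exists>N. \<forall>n\<ge>N. norm (sn (u n) - 0) < \<epsilon>"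
    by (intro exI[of _ "max N (max N1 N2)"]) auto
qed

text \<open>The difference of two sequences for the same \<open>e\<close> is a sequence for 0, hence
  null, so the limit is independent of the sequence. This freedom is essential later: identities for
  \<open>T\<close> are proved by transforming one sequence into another.\<close>

theorem ex_ortho_limit:
  fixes Q :: "'v \<Rightarrow> 'k::{real_normed_vector, complete_space}"
  assumes M: "subspace M" and Q: "linear Q" and C: "C \<ge> 0" "\<And>u. norm (Q u) \<le> C * sn u"
  obtains T where "\<And>e u. ortho_seq M e u \<Longrightarrow> (\<lambda>n. Q (u n)) \<longlonglongrightarrow> T e"
    "\<And>e. norm (T e) \<le> C * sn e"
proof -
  have ex: "\<exists>u t. ortho_seq M e u \<and> (\<lambda>n. Q (u n)) \<longlonglongrightarrow> t \<and> norm t \<le> C * sn e" for e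
  proof -
    obtain u where u: "ortho_seq M e u" "\<And>n. B (u n) (u n) \<le> B e e + inverse (real (Suc n))"
      using ex_ortho_seq[OF M] by blast
    have "Cauchy (\<lambda>n. Q (u n))"
    proof (rule metric_CauchyI)
      fix \<epsilon> :: real assume e: "\<epsilon> > 0"
      then have "\<epsilon> / (C + 1) > 0" using C by simp
      then obtain N where N: "\<And>m n. m \<ge> N \<Longrightarrow> n \<ge> N \<Longrightarrow> sn (u m - u n) < \<epsilon> / (C + 1)"
        using ortho_seq_Cauchy[OF u(1)] by blast
      have "dist (Q (u m)) (Q (u n)) < \<epsilon>" if "m \<ge> N" "n \<ge> N" for m n
      proof -
        have "dist (Q (u m)) (Q (u n)) \<le> C * sn (u m - u n)"
          using C(2)[of "u m - u n"] by (simp add: dist_norm linear_diff[OF Q])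
        also have "\<dots> \<le> (C + 1) * sn (u m - u n)" by (intro mult_right_mono) auto
        also have "\<dots> < \<epsilon>" using N[OF that] C by (simp add: field_simps)
        finally show ?thesis .
      qed
      then show "\<exists>N. \<forall>m\<ge>N. \<forall>n\<ge>N. dist (Q (u m)) (Q (u n)) < \<epsilon>" by blast
    qed
    then obtain t where t: "(\<lambda>n. Q (u n)) \<longlonglongrightarrow> t" using Cauchy_convergent convergent_def by blast
    have "norm (Q (u n)) \<le> C * sqrt (B e e + inverse (real (Suc n)))" for n
      using C(2)[of "u n"] mult_left_mono[OF real_sqrt_le_mono[OF u(2)[of n]] C(1)] by (simp add: sn_def)
    moreover have "(\<lambda>n. C * sqrt (B e e + inverse (real (Suc n)))) \<longlonglongrightarrow> C * sqrt (B e e + 0)"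
      by (intro tendsto_intros LIMSEQ_inverse_real_of_nat)
    ultimately have "norm t \<le> C * sqrt (B e e + 0)"
      by (intro LIMSEQ_le[OF tendsto_norm[OF t]]) auto
    then show ?thesis using u(1) t by (auto simp: sn_def)
  qed
  then obtain U T where UT: "\<And>e. ortho_seq M e (U e)" "\<And>e. (\<lambda>n. Q (U e n)) \<longlonglongrightarrow> T e"
    "\<And>e. norm (T e) \<le> C * sn e" by metis
  have "(\<lambda>n. Q (u n)) \<longlonglongrightarrow> T e" if u: "ortho_seq M e u" for e u
  proof -
    have "ortho_seq M 0 (\<lambda>n. u n - U e n)" using ortho_seq_diff[OF M u UT(1)[of e]] by simp
    then have "(\<lambda>n. sn (u n - U e n)) \<longlonglongrightarrow> 0"
      using ortho_seq_null subspace_0[OF M] M by blast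
    then have "(\<lambda>n. C * sn (u n - U e n)) \<longlonglongrightarrow> 0" by (rule tendsto_mult_right_zero)
    then have "(\<lambda>n. Q (u n - U e n)) \<longlonglongrightarrow> 0"
      by (rule Lim_null_comparison[rotated]) (simp add: C(2))
    from tendsto_add[OF this UT(2)[of e]] show ?thesis by (simp add: linear_diff[OF Q])
  qed
  then show ?thesis using that UT(3) by blast
qed

end

section \<open>The key estimate\<close>

text \<open>The power \<open>(X\<^sup>* X) ^ (2 ^ p)\<close>, obtained by repeated squaring.\<close>

primrec gram_power :: "nat \<Rightarrow> (nat \<Rightarrow> nat \<Rightarrow> 'b::cstar_algebra_1) \<Rightarrow> nat \<Rightarrow> nat \<Rightarrow> nat \<Rightarrow> 'b" where
  "gram_power n X 0 = (\<lambda>i j. \<Sum>k<n. star (X k i) * X k j)"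
| "gram_power n X (Suc p) = (\<lambda>i j. \<Sum>k<n. gram_power n X p i k * gram_power n X p k j)"

lemma star_gram_power: "star (gram_power n X p i j) = gram_power n X p j i"
  by (induction p arbitrary: i j) (simp_all add: star_sum star_mult star_star)

lemma mnorm_gram_power: "mnorm n (gram_power n X p) = ((mnorm n X)\<^sup>2) ^ (2 ^ p)"
proof (induction p)
  case (Suc p)
  have "gram_power n X (Suc p) = (\<lambda>i j. \<Sum>k<n. star (gram_power n X p k i) * gram_power n X p k j)"
    by (simp add: star_gram_power)
  then have "mnorm n (gram_power n X (Suc p)) = (((mnorm n X)\<^sup>2) ^ (2 ^ p))\<^sup>2"
    by (simp only: mnorm_cstar Suc.IH)
  also have "\<dots> = ((mnorm n X)\<^sup>2) ^ (2 ^ Suc p)"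
    by (simp add: power_mult[symmetric] mult.commute)
  finally show ?case .
qed (simp add: mnorm_cstar)

text \<open>Contractive *-homomorphisms are completely contractive: the entrywise comparison costs a
  factor \<open>n * n\<close>, which disappears along the powers \<open>gram_power\<close>.\<close>

lemma mnorm_hom_le:
  fixes s :: "'b::cstar_algebra_1 \<Rightarrow> 'c::cstar_algebra_1"
  assumes s: "linear s" "\<And>x y. s (x * y) = s x * s y" "\<And>x. s (star x) = star (s x)"
    and le: "\<And>x. norm (s x) \<le> norm x"
  shows "mnorm n (\<lambda>i j. s (X i j)) \<le> mnorm n X"
proof -
  have hom: "gram_power n (\<lambda>i j. s (X i j)) p i j = s (gram_power n X p i j)" for p i j
    by (induction p arbitrary: i j) (simp_all add: s linear_sum[OF s(1)])
  have "((mnorm n (\<lambda>i j. s (X i j)))\<^sup>2) ^ (2 ^ p) \<le> real (n * n) * ((mnorm n X)\<^sup>2) ^ (2 ^ p)" for p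
  proof -
    have "mnorm n (gram_power n (\<lambda>i j. s (X i j)) p) \<le> (\<Sum>i<n. \<Sum>j<n. norm (s (gram_power n X p i j)))"
      using mnorm_le_entries[of n "gram_power n (\<lambda>i j. s (X i j)) p"] by (simp add: hom)
    also have "\<dots> \<le> (\<Sum>i<n. \<Sum>j<n. mnorm n (gram_power n X p))"
      by (intro sum_mono order_trans[OF le norm_entry_le_mnorm]) auto
    finally show ?thesis by (simp add: mnorm_gram_power)
  qed
  then have "(mnorm n (\<lambda>i j. s (X i j)))\<^sup>2 \<le> (mnorm n X)\<^sup>2"
    by (rule le_of_power_two_powers_le) auto
  then show ?thesis by (rule power2_le_imp_le) (rule mnorm_nonneg)
qed

text \<open>Taking the algebra part is not multiplicative, but it is the identity minus the
  *-homomorphism onto the scalars, and both are completely contractive.\<close>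

lemma mnorm_alg_le:
  fixes X :: "nat \<Rightarrow> nat \<Rightarrow> 'a::cstar_algebra unitization"
  shows "mnorm n (\<lambda>i j. Unitization (alg (X i j)) 0) \<le> 2 * mnorm n X"
proof -
  let ?s = "\<lambda>x :: 'a unitization. Unitization (0::'a) (scalar x)"
  have "mnorm n (\<lambda>i j. ?s (X i j)) \<le> mnorm n X"
  proof (rule mnorm_hom_le)
    show "linear ?s" by (rule linearI) (simp_all add: plus_unitization_def scaleR_unitization_def)
    show "norm (?s x) \<le> norm x" for x
      using norm_Unitization_le[of "0::'a" "scalar x"] norm_scalar_le[of x] by simp
  qed (simp_all add: times_unitization_def star_unitization_def)
  moreover have "(\<lambda>i j. Unitization (alg (X i j)) 0) = (\<lambda>i j. X i j + (- 1) *\<^sub>C ?s (X i j))"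
    by (simp add: plus_unitization_def scaleC_unitization_def)
  ultimately show ?thesis
    using mnorm_add[of n X "\<lambda>i j. (- 1) *\<^sub>C ?s (X i j)"] by (simp only: mnorm_scaleC) simp
qed

section \<open>From complete boundedness to a quadratic estimate\<close>

lemma mat_op_norm_bound:
  fixes Y :: "('h::chilbert_space \<Rightarrow>\<^sub>L 'k::chilbert_space) mat"
  shows "L2_set (\<lambda>i. norm (\<Sum>j<n. blinfun_apply (Y $$ (i, j)) (\<xi> j))) {..<n}
    \<le> mat_op_norm n Y * L2_set (\<lambda>j. norm (\<xi> j)) {..<n}"
proof -
  define act where "act \<xi> = L2_set (\<lambda>i. norm (\<Sum>j<n. blinfun_apply (Y $$ (i, j)) (\<xi> j))) {..<n}" for \<xi>
  define K where "K = (\<Sum>i<n. \<Sum>j<n. norm (Y $$ (i, j)))"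
  have le: "act \<xi> \<le> K * L2_set (\<lambda>j. norm (\<xi> j)) {..<n}" for \<xi>
  proof -
    have "act \<xi> \<le> (\<Sum>i<n. norm (\<Sum>j<n. blinfun_apply (Y $$ (i, j)) (\<xi> j)))"
      unfolding act_def by (rule L2_set_le_sum) simp
    also have "\<dots> \<le> (\<Sum>i<n. \<Sum>j<n. norm (Y $$ (i, j)) * L2_set (\<lambda>j. norm (\<xi> j)) {..<n})"
      by (intro sum_mono sum_norm_le order_trans[OF norm_blinfun mult_left_mono] member_le_L2_set) auto
    finally show ?thesis by (simp add: K_def sum_distrib_right)
  qed
  have K: "K \<ge> 0" unfolding K_def by (intro sum_nonneg) auto
  have set_eq: "mat_op_norm n Y = Sup {act \<xi> | \<xi>. L2_set (\<lambda>j. norm (\<xi> j)) {..<n} \<le> 1}"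
    by (simp add: mat_op_norm_def act_def)
  have unit: "act \<xi> \<le> mat_op_norm n Y" if "L2_set (\<lambda>j. norm (\<xi> j)) {..<n} \<le> 1" for \<xi>
    unfolding set_eq
  proof (rule cSup_upper)
    show "bdd_above {act \<xi> | \<xi>. L2_set (\<lambda>j. norm (\<xi> j)) {..<n} \<le> 1}"
    proof (rule bdd_aboveI)
      fix r assume "r \<in> {act \<xi> | \<xi>. L2_set (\<lambda>j. norm (\<xi> j)) {..<n} \<le> 1}"
      then obtain \<xi> where "r = act \<xi>" "L2_set (\<lambda>j. norm (\<xi> j)) {..<n} \<le> 1" by blast
      then show "r \<le> K" using le[of \<xi>] mult_left_mono[OF _ K, of "L2_set (\<lambda>j. norm (\<xi> j)) {..<n}" 1] by simp
    qed
  qed (use that in blast)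
  show ?thesis
  proof (cases "L2_set (\<lambda>j. norm (\<xi> j)) {..<n} = 0")
    case True
    then show ?thesis using le[of \<xi>] by (simp add: act_def)
  next
    case False
    define r where "r = L2_set (\<lambda>j. norm (\<xi> j)) {..<n}"
    have r: "r > 0" using False L2_set_nonneg[of "\<lambda>j. norm (\<xi> j)" "{..<n}"]
      unfolding r_def by linarith
    have "L2_set (\<lambda>j. norm (inverse r *\<^sub>R \<xi> j)) {..<n} = inverse r * r"
      using r by (simp add: r_def L2_set_right_distrib)
    then have "act (\<lambda>j. inverse r *\<^sub>R \<xi> j) \<le> mat_op_norm n Y"
      using r by (intro unit) simp
    moreover have "act (\<lambda>j. inverse r *\<^sub>R \<xi> j) = inverse r * act \<xi>"
      using r by (simp add: act_def blinfun.scaleR_right L2_set_right_distrib flip: scaleR_sum_right)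
    ultimately show ?thesis using r by (simp add: act_def r_def field_simps)
  qed
qed

text \<open>Let \<open>X\<close> have the entries \<open>u_k(\<xi>)\<close> divided by the root of
  \<open>D_\<xi>\<close>. Domination says that \<open>X\<close> is a contraction. Applying
  \<open>\<delta>\<close> to its algebra parts and evaluating at the vector with components
  \<open>\<xi>\<close> times the root of \<open>D_\<xi>\<close> gives the components
  \<open>Q u_k\<close>, and the squared length of that vector is \<open>cost D\<close>.\<close>

theorem completely_bounded_estimate:
  fixes \<delta> :: "'a::cstar_algebra \<Rightarrow> 'h::chilbert_space \<Rightarrow>\<^sub>L 'k::chilbert_space"
  assumes lin: "clinear \<delta>" and cb: "completely_bounded \<delta>"
  obtains K where "K > 0" "\<And>(us :: ('h \<Rightarrow>\<^sub>0 'a unitization) list) D. dominated (\<Sum>u\<leftarrow>us. gram u u) D \<Longrightarrow>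
    (\<Sum>u\<leftarrow>us. (norm (lin_ext (\<lambda>\<xi> b. blinfun_apply (\<delta> (alg b)) \<xi>) u))\<^sup>2) \<le> K * cost D"
proof -
  obtain C0 where C0: "\<And>n X. X \<in> carrier_mat n n \<Longrightarrow> mat_op_norm n (map_mat \<delta> X) \<le> C0 * mat_cstar_norm n X"
    using cb unfolding completely_bounded_def by blast
  \<comment> \<open>The constant \<open>C0\<close> has no sign; \<open>C\<close> is positive, so
    \<open>K\<close> is as well.\<close>
  define C where "C = max C0 1"
  define K where "K = (2 * C)\<^sup>2"
  have C: "C > 0" "C0 \<le> C" by (simp_all add: C_def)
  let ?Q = "lin_ext (\<lambda>\<xi> b. blinfun_apply (\<delta> (alg b)) \<xi>)"
  have \<delta>l: "linear \<delta>" using lin by (rule clinear_imp_linear)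
  have "(\<Sum>u\<leftarrow>us. (norm (?Q u))\<^sup>2) \<le> K * cost D"
    if dom: "dominated (\<Sum>u\<leftarrow>us. gram u u) D" for us :: "('h \<Rightarrow>\<^sub>0 'a unitization) list" and D
  proof -
    define L where "L = length us"
    define S where "S = Poly_Mapping.keys D \<union> (\<Union>u\<in>set us. Poly_Mapping.keys u)"
    define n where "n = card S"
    \<comment> \<open>Complete boundedness speaks of square matrices, so the \<open>L\<close> by
      \<open>n\<close> matrix is padded with zeros.\<close>
    define m where "m = max n L"
    have nm: "n \<le> m" "L \<le> m" by (simp_all add: m_def)
    have S: "finite S" "Poly_Mapping.keys D \<subseteq> S" "\<And>k. k < L \<Longrightarrow> Poly_Mapping.keys (us ! k) \<subseteq> S"
      by (auto simp: S_def L_def)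
    have D0: "lk D \<xi> \<ge> 0" for \<xi> using dom by (simp add: dominated_def)
    obtain h where h: "bij_betw h {..<n} S"
      using ex_bij_betw_nat_finite[OF S(1)] by (auto simp: n_def lessThan_atLeast0)
    define g where "g = inv_into {..<n} h"
    have gh: "i < n \<Longrightarrow> g (h i) = i" for i
      using h by (simp add: g_def bij_betw_def)
    have reindex: "(\<Sum>\<xi>\<in>S. F \<xi>) = (\<Sum>i<n. F (h i))" for F :: "'h \<Rightarrow> 'z::comm_monoid_add"
      using sum.reindex_bij_betw[OF h, of F] by simp
    have list_sum: "(\<Sum>u\<leftarrow>us. G u) = (\<Sum>k<L. G (us ! k))" for G :: "('h \<Rightarrow>\<^sub>0 'a unitization) \<Rightarrow> 'z::comm_monoid_add"
      by (simp add: sum_list_sum_nth L_def lessThan_atLeast0)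
    have Q: "?Q (us ! k) = (\<Sum>i<n. blinfun_apply (\<delta> (alg (lk (us ! k) (h i)))) (h i))" if "k < L" for k
    proof -
      have "?Q (us ! k) = (\<Sum>\<xi>\<in>S. blinfun_apply (\<delta> (alg (lk (us ! k) \<xi>))) \<xi>)"
        using S that by (intro lin_ext_superset) (auto simp: linear_0[OF \<delta>l])
      then show ?thesis by (simp only: reindex)
    qed
    have cost: "cost D = (\<Sum>i<n. lk D (h i) * (norm (h i))\<^sup>2)"
      unfolding cost_def by (subst lin_ext_superset[of _ S]) (use S in \<open>auto simp: reindex\<close>)
    have eps: "(\<Sum>u\<leftarrow>us. (norm (?Q u))\<^sup>2) \<le> K * cost D + e * (K * (\<Sum>i<n. (norm (h i))\<^sup>2))" if e: "e > 0" for e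
    proof -
      \<comment> \<open>\<open>D\<close> may vanish at some labels. Adding \<open>e\<close> makes
        the division possible, and \<open>e\<close> tends to 0 at the end.\<close>
      define d where "d \<xi> = sqrt (lk D \<xi> + e)" for \<xi>
      have d: "d \<xi> > 0" "(d \<xi>)\<^sup>2 = lk D \<xi> + e" for \<xi>
        using D0[of \<xi>] e by (simp_all add: d_def)
      define X where "X k i = (if k < L \<and> i < n then (1 / d (h i)) *\<^sub>R lk (us ! k) (h i) else 0)" for k i
      have "mnorm m X \<le> 1"
      proof (rule mnorm_le)
        fix f :: "'a unitization \<Rightarrow> real" and b :: "nat \<Rightarrow> 'a unitization"
        assume f: "pos_functional f"
        note fl = pos_functional_linear[OF f]
        have fpos: "0 \<le> f (star x * x)" for x using f by (simp add: pos_functional_def)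
        \<comment> \<open>The test vector, moved to labels and divided by \<open>d\<close>, so that
          \<open>X\<close> applied to \<open>b\<close> evaluates the rows \<open>us\<close> at
          \<open>b'\<close>.\<close>
        define b' where "b' \<xi> = (1 / d \<xi>) *\<^sub>R b (g \<xi>)" for \<xi>
        have mv: "mat_vec m X b k = vec_eval b' (us ! k)" if "k < L" for k
        proof -
          have "mat_vec m X b k = (\<Sum>i<n. X k i * b i)"
            unfolding mat_vec_def by (rule sum.mono_neutral_right) (auto simp: m_def X_def)
          also have "\<dots> = (\<Sum>i<n. lk (us ! k) (h i) * b' (h i))"
            by (intro sum.cong) (auto simp: X_def b'_def gh that)
          also have "\<dots> = (\<Sum>\<xi>\<in>S. lk (us ! k) \<xi> * b' \<xi>)" by (simp only: reindex)
          finally show ?thesis using vec_eval_superset[OF S(1) S(3)[OF that], of b'] by simp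
        qed
        have mv0: "mat_vec m X b k = 0" if "\<not> k < L" for k
          using that by (simp add: mat_vec_def X_def)
        have "(vec_norm f m (mat_vec m X b))\<^sup>2 = (\<Sum>k<L. f (star (vec_eval b' (us ! k)) * vec_eval b' (us ! k)))"
          unfolding vec_norm_square[OF f]
          by (rule sum.mono_neutral_cong_right) (use nm in \<open>auto simp: mv mv0 linear_0[OF fl]\<close>)
        also have "\<dots> = quad_form f b' (\<Sum>u\<leftarrow>us. gram u u)"
          by (simp add: list_sum linear_sum[OF linear_quad_form[OF f]] quad_form_gram[OF f])
        also have "\<dots> \<le> diag_form f b' D" using dom f by (simp add: dominated_def)
        also have "\<dots> = (\<Sum>\<xi>\<in>S. lk D \<xi> * f (star (b' \<xi>) * b' \<xi>))"
          unfolding diag_form_def using S by (intro lin_ext_superset) auto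
        also have "\<dots> = (\<Sum>i<n. lk D (h i) / (d (h i))\<^sup>2 * f (star (b i) * b i))"
          unfolding reindex
          by (intro sum.cong) (auto simp: b'_def gh star_scaleR linear_scale[OF fl] power2_eq_square)
        also have "\<dots> \<le> (\<Sum>i<n. 1 * f (star (b i) * b i))"
          by (intro sum_mono mult_right_mono fpos) (use d D0 e in \<open>simp add: add_nonneg_pos\<close>)
        also have "\<dots> \<le> (\<Sum>i<m. f (star (b i) * b i))"
          by (simp, intro sum_mono2) (auto simp: m_def fpos)
        finally have "(vec_norm f m (mat_vec m X b))\<^sup>2 \<le> (vec_norm f m b)\<^sup>2"
          by (simp only: vec_norm_square[OF f])
        then have "vec_norm f m (mat_vec m X b) \<le> vec_norm f m b"
          by (rule power2_le_imp_le) simp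
        then show "vec_norm f m (mat_vec m X b) \<le> 1 * vec_norm f m b" by simp
      qed simp
      then have X2: "mnorm m (\<lambda>i j. Unitization (alg (X i j)) 0) \<le> 2"
        using mnorm_alg_le[of m X] by simp
      define Y where "Y = mat m m (\<lambda>(k, i). alg (X k i))"
      have Y: "Y \<in> carrier_mat m m" by (simp add: Y_def)
      have "mnorm m (\<lambda>i j. Unitization (Y $$ (i, j)) 0) = mnorm m (\<lambda>i j. Unitization (alg (X i j)) 0)"
        by (rule mnorm_cong) (simp add: Y_def)
      then have "mat_cstar_norm m Y \<le> 2" using mat_cstar_norm_le_mnorm[OF Y] X2 by simp
      then have "C0 * mat_cstar_norm m Y \<le> C * 2"
        using C mat_cstar_norm_nonneg[OF Y] by (intro mult_mono) auto
      then have op: "mat_op_norm m (map_mat \<delta> Y) \<le> 2 * C" using C0[OF Y] by simp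
      \<comment> \<open>The factor \<open>d (h i)\<close> cancels the division made in
        \<open>X\<close>.\<close>
      define \<zeta> where "\<zeta> i = (if i < n then d (h i) *\<^sub>R h i else 0)" for i
      have act: "(\<Sum>i<m. blinfun_apply (map_mat \<delta> Y $$ (k, i)) (\<zeta> i)) = ?Q (us ! k)" if "k < L" for k
      proof -
        have "(\<Sum>i<m. blinfun_apply (map_mat \<delta> Y $$ (k, i)) (\<zeta> i))
            = (\<Sum>i<m. blinfun_apply (\<delta> (alg (X k i))) (\<zeta> i))"
          using that by (intro sum.cong) (auto simp: Y_def m_def)
        also have "\<dots> = (\<Sum>i<n. blinfun_apply (\<delta> (alg (lk (us ! k) (h i)))) (h i))"
        proof (rule sum.mono_neutral_cong_right)
          fix i assume "i \<in> {..<n}"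
          then show "blinfun_apply (\<delta> (alg (X k i))) (\<zeta> i) = blinfun_apply (\<delta> (alg (lk (us ! k) (h i)))) (h i)"
            using that d(1)[of "h i"]
            by (simp add: X_def \<zeta>_def linear_scale[OF \<delta>l] scaleR_blinfun.rep_eq blinfun.scaleR_right)
        qed (auto simp: m_def \<zeta>_def blinfun.zero_right)
        finally show ?thesis using Q[OF that] by simp
      qed
      let ?A = "\<lambda>k. norm (\<Sum>i<m. blinfun_apply (map_mat \<delta> Y $$ (k, i)) (\<zeta> i))"
      have "(\<Sum>u\<leftarrow>us. (norm (?Q u))\<^sup>2) = (\<Sum>k<L. (?A k)\<^sup>2)"
        unfolding list_sum by (intro sum.cong) (auto simp: act)
      also have "\<dots> \<le> (\<Sum>k<m. (?A k)\<^sup>2)" by (intro sum_mono2) (auto simp: m_def)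
      also have "\<dots> = (L2_set ?A {..<m})\<^sup>2" by (simp add: L2_set_def sum_nonneg)
      also have "\<dots> \<le> (2 * C * L2_set (\<lambda>i. norm (\<zeta> i)) {..<m})\<^sup>2"
        using mat_op_norm_bound[of "map_mat \<delta> Y" \<zeta> m]
          mult_right_mono[OF op L2_set_nonneg[of "\<lambda>i. norm (\<zeta> i)" "{..<m}"]]
        by (intro power_mono) (auto simp: L2_set_nonneg)
      also have "\<dots> = K * (\<Sum>i<m. (norm (\<zeta> i))\<^sup>2)"
        by (simp add: K_def power_mult_distrib L2_set_def sum_nonneg)
      also have "(\<Sum>i<m. (norm (\<zeta> i))\<^sup>2) = (\<Sum>i<n. (lk D (h i) + e) * (norm (h i))\<^sup>2)"
        by (rule sum.mono_neutral_cong_right) (auto simp: m_def \<zeta>_def power_mult_distrib d(2))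
      also have "\<dots> = cost D + e * (\<Sum>i<n. (norm (h i))\<^sup>2)"
        by (simp add: cost distrib_right sum.distrib sum_distrib_left)
      finally show ?thesis by (simp add: algebra_simps)
    qed
    have lim: "((\<lambda>e. K * cost D + e * (K * (\<Sum>i<n. (norm (h i))\<^sup>2))) \<longlongrightarrow> K * cost D + 0 * (K * (\<Sum>i<n. (norm (h i))\<^sup>2))) (at_right 0)"
      by (intro tendsto_intros)
    have "(\<Sum>u\<leftarrow>us. (norm (?Q u))\<^sup>2) \<le> K * cost D + 0 * (K * (\<Sum>i<n. (norm (h i))\<^sup>2))"
      by (rule tendsto_lowerbound[OF lim])
        (auto intro!: eps eventually_at_right_less[THEN eventually_mono])
    then show ?thesis by simp
  qed
  moreover have "K > 0" using C by (simp add: K_def)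
  ultimately show ?thesis using that by blast
qed

section \<open>Innerness\<close>

text \<open>The third conclusion is equivariance under \<open>a + c 1\<close> in the unitization.
  Its case \<open>c = 0\<close> is the relation with \<open>\<delta>\<close>, and its case
  \<open>a = 0\<close> is homogeneity, which together with the first conclusion makes
  \<open>T\<close> complex linear.\<close>

lemma ex_intertwining_operator:
  fixes \<pi> :: "'a::cstar_algebra \<Rightarrow> 'h::chilbert_space \<Rightarrow>\<^sub>L 'h"
    and \<pi>' :: "'a \<Rightarrow> 'k::chilbert_space \<Rightarrow>\<^sub>L 'k"
  assumes \<pi>: "star_representation \<pi>" and \<pi>': "star_representation \<pi>'"
    and der: "derivation \<pi>' \<pi> \<delta>" and cb: "completely_bounded \<delta>"
  obtains T C where
    "\<And>x y. T (x - y) = T x - T y" "\<And>x. norm (T x) \<le> C * norm x"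
    "\<And>a c x. T (blinfun_apply (\<pi> a) x + c *\<^sub>C x)
      = blinfun_apply (\<pi>' a) (T x) + c *\<^sub>C T x + blinfun_apply (\<delta> a) x"
proof -
  have l: "linear \<pi>" "linear \<pi>'" "linear \<delta>"
    using \<pi> \<pi>' der by (auto simp: star_representation_def derivation_def intro: clinear_imp_linear)
  have sc: "\<pi> (c *\<^sub>C a) = c *\<^sub>C \<pi> a" "\<pi>' (c *\<^sub>C a) = c *\<^sub>C \<pi>' a" "\<delta> (c *\<^sub>C a) = c *\<^sub>C \<delta> a" for c a
    using \<pi> \<pi>' der by (auto simp: star_representation_def derivation_def clinear_def)
  have opc: "blinfun_apply (\<pi> a) (c *\<^sub>C x) = c *\<^sub>C blinfun_apply (\<pi> a) x"
    "blinfun_apply (\<pi>' a) (c *\<^sub>C y) = c *\<^sub>C blinfun_apply (\<pi>' a) y"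
    "blinfun_apply (\<delta> a) (c *\<^sub>C x) = c *\<^sub>C blinfun_apply (\<delta> a) x" for a c x y
    using \<pi> \<pi>' der by (auto simp: star_representation_def derivation_def B_ops_def clinear_def image_subset_iff)
  have mult: "\<pi> (a * b) = \<pi> a o\<^sub>L \<pi> b" "\<pi>' (a * b) = \<pi>' a o\<^sub>L \<pi>' b"
    "\<delta> (a * b) = (\<delta> a o\<^sub>L \<pi> b) + (\<pi>' a o\<^sub>L \<delta> b)" for a b
    using \<pi> \<pi>' der by (auto simp: star_representation_def derivation_def)
  define P where "P b \<xi> = blinfun_apply (\<pi> (alg b)) \<xi> + scalar b *\<^sub>C \<xi>" for b \<xi>
  define P' where "P' b \<eta> = blinfun_apply (\<pi>' (alg b)) \<eta> + scalar b *\<^sub>C \<eta>" for b \<eta>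
  have Plin: "linear (\<lambda>b. P b \<xi>)" for \<xi>
    by (rule linearI) (simp_all add: P_def linear_add[OF l(1)] linear_scale[OF l(1)] plus_blinfun.rep_eq
        scaleR_blinfun.rep_eq scaleC_add_left scaleR_scaleC scaleR_add_right)
  have Dlin: "linear (\<lambda>b. blinfun_apply (\<delta> (alg b)) \<xi>)" for \<xi>
    by (rule linearI) (simp_all add: linear_add[OF l(3)] linear_scale[OF l(3)] plus_blinfun.rep_eq
        scaleR_blinfun.rep_eq)
  have P_mult: "P (b * c) \<xi> = P b (P c \<xi>)" for b c \<xi>
    by (simp add: P_def linear_add[OF l(1)] mult sc plus_blinfun.rep_eq scaleC_blinfun.rep_eq
        blinfun.add_right opc scaleC_add_right scaleC_scaleC)
  have D_mult: "blinfun_apply (\<delta> (alg (b * c))) \<xi>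
      = P' b (blinfun_apply (\<delta> (alg c)) \<xi>) + blinfun_apply (\<delta> (alg b)) (P c \<xi>)" for b c \<xi>
    by (simp add: P_def P'_def linear_add[OF l(3)] mult sc plus_blinfun.rep_eq scaleC_blinfun.rep_eq
        blinfun.add_right opc)
  have lin_P: "linear (P b)" and lin_P': "linear (P' b)" for b
    by (rule linearI; simp add: P_def P'_def blinfun.add_right blinfun.scaleR_right scaleC_add_right
        scaleC_scaleR scaleR_add_right)+
  define Q1 where "Q1 = lin_ext (\<lambda>\<xi> b. blinfun_apply (\<delta> (alg b)) \<xi>)"
  define Q2 where "Q2 = lin_ext (\<lambda>\<xi> b. P b \<xi>)"
  have Q1: "linear Q1" unfolding Q1_def by (rule linear_lin_ext) (rule Dlin)
  have Q2: "linear Q2" unfolding Q2_def by (rule linear_lin_ext) (rule Plin)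
  have keys_le: "Poly_Mapping.keys (left_scale b u) \<subseteq> Poly_Mapping.keys u" for b and u :: "'h \<Rightarrow>\<^sub>0 'a unitization"
    by (auto simp: in_keys_iff lookup_left_scale)
  have Q2_scale: "Q2 (left_scale b u) = P b (Q2 u)" for b u
  proof -
    have "Q2 (left_scale b u) = (\<Sum>\<xi>\<in>Poly_Mapping.keys u. P (b * lk u \<xi>) \<xi>)"
      unfolding Q2_def by (subst lin_ext_superset[of _ "Poly_Mapping.keys u"])
        (use keys_le in \<open>auto simp: linear_0[OF Plin] lookup_left_scale\<close>)
    then show ?thesis by (simp add: P_mult Q2_def lin_ext_def linear_sum[OF lin_P])
  qed
  have Q1_scale: "Q1 (left_scale b u) = P' b (Q1 u) + blinfun_apply (\<delta> (alg b)) (Q2 u)" for b u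
  proof -
    have "Q1 (left_scale b u) = (\<Sum>\<xi>\<in>Poly_Mapping.keys u. blinfun_apply (\<delta> (alg (b * lk u \<xi>))) \<xi>)"
      unfolding Q1_def by (subst lin_ext_superset[of _ "Poly_Mapping.keys u"])
        (use keys_le linear_0[OF Dlin] in \<open>auto simp: lookup_left_scale\<close>)
    then show ?thesis
      by (simp only: D_mult Q1_def Q2_def lin_ext_def linear_sum[OF lin_P'] blinfun.sum_right sum.distrib)
  qed
  have cl: "clinear \<delta>" using der by (simp add: derivation_def)
  obtain K where K: "K > 0" "\<And>(us :: ('h \<Rightarrow>\<^sub>0 'a unitization) list) D.
      dominated (\<Sum>u\<leftarrow>us. gram u u) D \<Longrightarrow> (\<Sum>u\<leftarrow>us. (norm (Q1 u))\<^sup>2) \<le> K * cost D"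
    using completely_bounded_estimate[OF cl cb, folded Q1_def] by blast
  obtain F where F: "linear F" "\<And>u. (norm (Q1 u))\<^sup>2 \<le> K * F (gram u u)"
    "\<And>w D. dominated w D \<Longrightarrow> F w \<le> cost D"
    using ex_dominating_functional[OF Q1 K] by blast
  \<comment> \<open>Domination by the zero diagonal: an inequality valid under all positive
    functionals passes to \<open>F\<close>. This gives the symmetry of \<open>B\<close> and the
    boundedness of left multiplication.\<close>
  have F_le0: "F w \<le> 0" if "\<And>f b. pos_functional f \<Longrightarrow> quad_form f b w \<le> 0" for w
    using F(3)[of w 0] that by (simp add: dominated_def linear_0[OF linear_diag_form] linear_0[OF linear_cost])
  define B where "B u v = F (gram u v)" for u v :: "'h \<Rightarrow>\<^sub>0 'a unitization"
  interpret B: semi_inner B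
  proof (rule semi_inner.intro)
    show "linear (\<lambda>u. B u v)" for v
      unfolding B_def using linear_compose[OF linear_gram_left F(1)] by (simp add: o_def)
    have "F (gram u v - gram v u) \<le> 0" for u v :: "'h \<Rightarrow>\<^sub>0 'a unitization"
    proof (rule F_le0)
      fix f b assume f: "pos_functional (f :: 'a unitization \<Rightarrow> real)"
      interpret S: semi_inner "\<lambda>x y. f (star x * y)" using f by (rule semi_inner_pos_functional)
      show "quad_form f b (gram u v - gram v u) \<le> 0"
        using S.sym[of "vec_eval b u" "vec_eval b v"]
        by (simp add: linear_diff[OF linear_quad_form[OF f]] quad_form_gram[OF f])
    qed
    then show "B u v = B v u" for u v
      unfolding B_def linear_diff[OF F(1)] by (simp add: antisym)
    show "0 \<le> B u u" for u
      using order_trans[OF zero_le_power2 F(2)[of u]] K(1) by (simp add: B_def zero_le_mult_iff)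
  qed
  have sn_scale: "B.sn (left_scale b u) \<le> norm b * B.sn u" for b u
  proof -
    have "F (gram (left_scale b u) (left_scale b u) - (norm b)\<^sup>2 *\<^sub>R gram u u) \<le> 0"
    proof (rule F_le0)
      fix f e assume f: "pos_functional (f :: 'a unitization \<Rightarrow> real)"
      show "quad_form f e (gram (left_scale b u) (left_scale b u) - (norm b)\<^sup>2 *\<^sub>R gram u u) \<le> 0"
        using pos_functional_conj_le[OF f, of b "vec_eval e u"]
        by (simp add: linear_diff[OF linear_quad_form[OF f]] linear_scale[OF linear_quad_form[OF f]]
            quad_form_gram[OF f] vec_eval_left_scale)
    qed
    then have "B (left_scale b u) (left_scale b u) \<le> (norm b)\<^sup>2 * B u u"
      by (simp add: B_def linear_diff[OF F(1)] linear_scale[OF F(1)])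
    from real_sqrt_le_mono[OF this] show ?thesis by (simp add: B.sn_def real_sqrt_mult)
  qed
  let ?e = "\<lambda>\<xi>. Poly_Mapping.single \<xi> (1 :: 'a unitization)"
  have sn_single: "B.sn (?e \<xi>) \<le> norm \<xi>" for \<xi>
  proof -
    \<comment> \<open>The two forms coincide here: this Gram matrix is the diagonal unit at
      \<open>\<xi>\<close>, whose cost is \<open>(norm \<xi>)\<^sup>2\<close>.\<close>
    have "dominated (gram (?e \<xi>) (?e \<xi>)) (Poly_Mapping.single \<xi> 1)"
      unfolding dominated_def
      by (auto simp: lookup_single when_def quad_form_gram diag_form_single vec_eval_def lin_ext_single)
    from F(3)[OF this] have "B (?e \<xi>) (?e \<xi>) \<le> (norm \<xi>)\<^sup>2"
      by (simp add: B_def cost_def lin_ext_single)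
    from real_sqrt_le_mono[OF this] show ?thesis by (simp add: B.sn_def)
  qed
  define M where "M = {u. Q2 u = 0}"
  have M: "subspace M"
    by (auto simp: M_def subspace_def linear_0[OF Q2] linear_add[OF Q2] linear_scale[OF Q2])
  have C: "norm (Q1 u) \<le> sqrt K * B.sn u" for u
    using real_sqrt_le_mono[OF F(2)[of u]] by (simp add: B.sn_def B_def real_sqrt_mult)
  obtain T where T: "\<And>e u. B.ortho_seq M e u \<Longrightarrow> (\<lambda>n. Q1 (u n)) \<longlonglongrightarrow> T e"
    "\<And>e. norm (T e) \<le> sqrt K * B.sn e"
    using B.ex_ortho_limit[OF M Q1 _ C] K(1) by auto
  \<comment> \<open>The orthogonal component depends on \<open>e\<close> only modulo
    \<open>M\<close>, that is, through \<open>Q2 e\<close>.\<close>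
  have shift: "B.ortho_seq M e' u" if "B.ortho_seq M e u" "Q2 e = Q2 e'" for e e' u
    using that by (simp add: B.ortho_seq_def M_def linear_diff[OF Q2])
  have Q2_single: "Q2 (Poly_Mapping.single \<xi> b) = P b \<xi>" for \<xi> b
    unfolding Q2_def by (rule lin_ext_single) (rule linear_0[OF Plin])
  have P_one: "P 1 \<xi> = \<xi>" for \<xi> by (simp add: P_def linear_0[OF l(1)])
  define T0 where "T0 \<xi> = T (?e \<xi>)" for \<xi>
  have "T0 (\<xi> - \<eta>) = T0 \<xi> - T0 \<eta>" for \<xi> \<eta>
  proof -
    obtain u v where u: "B.ortho_seq M (?e \<xi>) u" and v: "B.ortho_seq M (?e \<eta>) v"
      using B.ex_ortho_seq[OF M] by metis
    \<comment> \<open>\<open>?e (\<xi> - \<eta>)\<close> and \<open>?e \<xi> - ?e \<eta>\<close> are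
      different functions on labels with the same image under \<open>Q2\<close>.\<close>
    have "B.ortho_seq M (?e (\<xi> - \<eta>)) (\<lambda>n. u n - v n)"
      by (rule shift[OF B.ortho_seq_diff[OF M u v]]) (simp add: linear_diff[OF Q2] Q2_single P_one)
    from T(1)[OF this] have "(\<lambda>n. Q1 (u n) - Q1 (v n)) \<longlonglongrightarrow> T0 (\<xi> - \<eta>)"
      by (simp add: T0_def linear_diff[OF Q1])
    moreover have "(\<lambda>n. Q1 (u n) - Q1 (v n)) \<longlonglongrightarrow> T0 \<xi> - T0 \<eta>"
      unfolding T0_def by (intro tendsto_diff T u v)
    ultimately show ?thesis by (rule LIMSEQ_unique)
  qed
  moreover have "norm (T0 \<xi>) \<le> sqrt K * norm \<xi>" for \<xi>
    unfolding T0_def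
    by (rule order_trans[OF T(2) mult_left_mono[OF sn_single]]) (use K in simp)
  moreover have "T0 (P b \<xi>) = P' b (T0 \<xi>) + blinfun_apply (\<delta> (alg b)) \<xi>" for b \<xi>
  proof -
    obtain u where u: "B.ortho_seq M (?e \<xi>) u" using B.ex_ortho_seq[OF M] by metis
    \<comment> \<open>All members of the sequence differ from \<open>?e \<xi>\<close> by the kernel
      of \<open>Q2\<close>, so the term \<open>\<delta>(b) (Q2 (u n))\<close> is constant along
      it.\<close>
    have Q2u: "Q2 (u n) = \<xi>" for n
      using u by (simp add: B.ortho_seq_def M_def linear_diff[OF Q2] Q2_single P_one)
    have "B.ortho_seq M (left_scale b (?e \<xi>)) (\<lambda>n. left_scale b (u n))"
      unfolding B.ortho_seq_def
    proof (intro conjI allI ballI impI)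
      show "left_scale b (u n) - left_scale b (?e \<xi>) \<in> M" for n
        by (simp add: M_def linear_diff[OF Q2] Q2_scale Q2u Q2_single P_one)
    next
      fix \<epsilon> :: real assume \<epsilon>: "\<epsilon> > 0"
      then have "\<epsilon> / (norm b + 1) > 0" by (simp add: add_nonneg_pos)
      then obtain N where N: "\<And>m n. m \<ge> N \<Longrightarrow> n \<ge> N \<Longrightarrow> B.sn (u m - u n) < \<epsilon> / (norm b + 1)"
        using B.ortho_seq_Cauchy[OF u] by blast
      have "B.sn (left_scale b (u m) - left_scale b (u n)) < \<epsilon>" if "m \<ge> N" "n \<ge> N" for m n
      proof -
        have "B.sn (left_scale b (u m) - left_scale b (u n)) \<le> norm b * B.sn (u m - u n)"
          using sn_scale[of b "u m - u n"] by (simp add: linear_diff[OF linear_left_scale])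
        also have "\<dots> \<le> (norm b + 1) * B.sn (u m - u n)" by (intro mult_right_mono) auto
        also have "\<dots> < \<epsilon>"
          using N[OF that] pos_less_divide_eq[of "norm b + 1" "B.sn (u m - u n)" \<epsilon>]
          by (simp add: add_nonneg_pos mult.commute)
        finally show ?thesis .
      qed
      then show "\<exists>N. \<forall>m\<ge>N. \<forall>n\<ge>N. B.sn (left_scale b (u m) - left_scale b (u n)) < \<epsilon>" by blast
    next
      fix k assume "k \<in> M"
      \<comment> \<open>Orthogonality to \<open>M\<close> survives left multiplication by
        \<open>b\<close>, because the adjoint \<open>star b\<close> maps \<open>M\<close> into
        itself.\<close>
      then have "left_scale (star b) k \<in> M" by (simp add: M_def Q2_scale linear_0[OF lin_P])
      then show "(\<lambda>n. B (left_scale b (u n)) k) \<longlonglongrightarrow> 0"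
        using u by (simp add: B_def gram_left_scale B.ortho_seq_def)
    qed
    then have "B.ortho_seq M (?e (P b \<xi>)) (\<lambda>n. left_scale b (u n))"
      by (rule shift) (simp add: Q2_scale Q2_single P_one)
    from T(1)[OF this] have "(\<lambda>n. P' b (Q1 (u n)) + blinfun_apply (\<delta> (alg b)) \<xi>) \<longlonglongrightarrow> T0 (P b \<xi>)"
      by (simp add: Q1_scale Q2u T0_def)
    moreover have "(\<lambda>n. P' b (Q1 (u n)) + blinfun_apply (\<delta> (alg b)) \<xi>) \<longlonglongrightarrow> P' b (T0 \<xi>) + blinfun_apply (\<delta> (alg b)) \<xi>"
      unfolding P'_def T0_def
      by (intro tendsto_add tendsto_const bounded_linear.tendsto[OF blinfun.bounded_linear_right]
          bounded_linear.tendsto[OF bounded_linear_scaleC_right] T(1)[OF u])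
    ultimately show ?thesis by (rule LIMSEQ_unique)
  qed
  from this[of "Unitization _ _"]
  have "T0 (blinfun_apply (\<pi> a) x + c *\<^sub>C x)
      = blinfun_apply (\<pi>' a) (T0 x) + c *\<^sub>C T0 x + blinfun_apply (\<delta> a) x" for a c x
    by (simp add: P_def P'_def)
  ultimately show ?thesis using that by blast
qed

theorem theoremA3:
  fixes \<pi> :: "'a::cstar_algebra \<Rightarrow> 'h::chilbert_space \<Rightarrow>\<^sub>L 'h"
    and \<pi>' :: "'a \<Rightarrow> 'k::chilbert_space \<Rightarrow>\<^sub>L 'k"
    and \<delta> :: "'a \<Rightarrow> 'h \<Rightarrow>\<^sub>L 'k"
  assumes "star_representation \<pi>"
    and "star_representation \<pi>'"
    and "derivation \<pi>' \<pi> \<delta>"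
    and "completely_bounded \<delta>"
  shows "inner_derivation \<pi>' \<pi> \<delta>"
proof -
  obtain T C where diff: "\<And>x y. T (x - y) = T x - T y" and bound: "\<And>x. norm (T x) \<le> C * norm x"
    and T: "\<And>a c x. T (blinfun_apply (\<pi> a) x + c *\<^sub>C x)
      = blinfun_apply (\<pi>' a) (T x) + c *\<^sub>C T x + blinfun_apply (\<delta> a) x"
    using ex_intertwining_operator[OF assms] by blast
  have "linear \<pi>" "linear \<pi>'" "linear \<delta>"
    using assms by (auto simp: star_representation_def derivation_def intro: clinear_imp_linear)
  then have zero: "\<pi> 0 = 0" "\<pi>' 0 = 0" "\<delta> 0 = 0" by (simp_all add: linear_0)
  \<comment> \<open>Homogeneity is equivariance under the scalars of the unitization.\<close>
  have T_scaleC: "T (c *\<^sub>C x) = c *\<^sub>C T x" for c x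
    using T[of 0 x c] by (simp add: zero)
  have T_add: "T (x + y) = T x + T y" for x y
    using diff[of "x + y" y] by simp
  have "bounded_linear (\<lambda>x. - T x)"
  proof (rule bounded_linear_intro)
    show "- T (r *\<^sub>R x) = r *\<^sub>R - T x" for r x
      using T_scaleC[of "complex_of_real r" x] by (simp add: scaleC_of_real)
    show "norm (- T x) \<le> norm x * C" for x using bound[of x] by (simp add: mult.commute)
  qed (simp add: T_add)
  then have S: "blinfun_apply (Blinfun (\<lambda>x. - T x)) = (\<lambda>x. - T x)"
    by (rule bounded_linear_Blinfun_apply)
  show ?thesis
    unfolding inner_derivation_def
  proof (intro bexI[of _ "Blinfun (\<lambda>x. - T x)"] allI)
    show "Blinfun (\<lambda>x. - T x) \<in> B_ops"
      by (simp add: B_ops_def S clinear_def T_add T_scaleC scaleC_minus_right)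
    show "\<delta> a = (\<pi>' a o\<^sub>L Blinfun (\<lambda>x. - T x)) - (Blinfun (\<lambda>x. - T x) o\<^sub>L \<pi> a)" for a
      by (rule blinfun_eqI) (use T[of a _ 0] in \<open>simp add: S minus_blinfun.rep_eq blinfun.minus_right\<close>)
  qed
qed

end
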